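(* Let $X$ be a Banach space over $\mathbb{K}$ ($\mathbb{K}=\mathbb{R}$ or $\mathbb{C}$) whose dual $X'$ is separable and has the approximation property, and let $N\in\mathbb{N}$. Then the set of all scalar-valued polynomials $P\in\mathcal{P}(^NX)$ whose Aron-Berner extension $\overline{P}\in\mathcal{P}(^NX'')$ attains its norm is dense in $\mathcal{P}(^NX)$.
   Context: $X'$, $X''$ denote the topological dual and bidual, $B_X$ the closed unit ball. $\mathcal{P}(^NX)$ is the Banach space of continuous $N$-homogeneous polynomials $P:X\to\mathbb{K}$ (i.e. $P(x)=\Phi(x,\dots,x)$ for some continuous $N$-linear form $\Phi$ on $X$) with norm $\|P\|=\sup_{x\in B_X}|P(x)|$. A polynomial $Q\in\mathcal{P}(^NX'')$ attains its norm if there is $a\in B_{X''}$ with $|Q(a)|=\|Q\|$. Aron-Berner extension: for a continuous $N$-linear form $\Phi$ on $X$ its canonical (Arens) extension to $X''$ is $\overline{\Phi}(x_1'',\dots,x_N'')=\lim_{\alpha_1}\cdots\lim_{\alpha_N}\Phi(x_{1,\alpha_1},\dots,x_{N,\alpha_N})$, where $(x_{j,\alpha_j})_{\alpha_j}\subset X$ is a net $w^*$-convergent to $x_j''$ (iterated limits). For $P\in\mathcal{P}(^NX)$ with associated symmetric $N$-linear form $\Phi$, $\overline{P}(x'')=\overline{\Phi}(x'',\dots,x'')$. *)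

theory Defs
  imports "HOL-Analysis.Analysis"
begin

text \<open>
  The scalar field. Up to isometric isomorphism the only instances are the reals and the
  complex numbers, since the norm of a real normed field is multiplicative.
\<close>

class real_or_complex = real_normed_field + euclidean_space +
  assumes real_or_complex:
    "(\<forall>z. \<exists>a. z = a *\<^sub>R 1) \<or>
     (\<exists>i. i * i = - 1 \<and> (\<forall>z. \<exists>a b. z = a *\<^sub>R 1 + b *\<^sub>R i))"

instance real :: real_or_complex
proof
  have "\<forall>z::real. \<exists>a. z = a *\<^sub>R 1" by simp
  then show "(\<forall>z::real. \<exists>a. z = a *\<^sub>R 1) \<or>
     (\<exists>i::real. i * i = - 1 \<and> (\<forall>z. \<exists>a b. z = a *\<^sub>R 1 + b *\<^sub>R i))" ..
qed

instance complex :: real_or_complex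
proof
  have "\<exists>a b. z = a *\<^sub>R 1 + b *\<^sub>R \<i>" for z
    by (intro exI[of _ "Re z"] exI[of _ "Im z"]) (simp add: complex_eq_iff)
  then show "(\<forall>z::complex. \<exists>a. z = a *\<^sub>R 1) \<or>
     (\<exists>i::complex. i * i = - 1 \<and> (\<forall>z. \<exists>a b. z = a *\<^sub>R 1 + b *\<^sub>R i))"
    by (intro disjI2 exI[of _ "\<i>"]) auto
qed

text \<open>
  The type class provides the underlying real normed space, \<open>scale\<close> is the scalar
  multiplication by the field \<open>'k\<close>.
\<close>

locale normed_space_over = vector_space scale
  for scale :: "'k::real_or_complex \<Rightarrow> 'a::real_normed_vector \<Rightarrow> 'a" +
  assumes norm_scale: "norm (scale c x) = norm c * norm x"
    and scale_of_real: "scale (of_real r) x = r *\<^sub>R x"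

definition sup_norm_on :: "'x set \<Rightarrow> ('x \<Rightarrow> 'k::real_normed_vector) \<Rightarrow> real"
  where "sup_norm_on B Q = (SUP x\<in>B. norm (Q x))"

definition bounded_linear_on ::
  "'x set \<Rightarrow> ('k \<Rightarrow> 'x \<Rightarrow> 'x) \<Rightarrow> ('k \<Rightarrow> 'y \<Rightarrow> 'y) \<Rightarrow>
    ('x::real_normed_vector \<Rightarrow> 'y::real_normed_vector) \<Rightarrow> bool"
  where "bounded_linear_on E s s' T \<longleftrightarrow>
    (\<forall>x\<in>E. \<forall>y\<in>E. T (x + y) = T x + T y) \<and>
    (\<forall>c. \<forall>x\<in>E. T (s c x) = s' c (T x)) \<and>
    (\<exists>C. \<forall>x\<in>E. norm (T x) \<le> C * norm x)"

text \<open>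
  Approximation property of a subspace \<open>E\<close> of a normed space, regarded as a normed space in
  its own right: the identity is approximated, uniformly on compact sets, by bounded finite-rank
  operators from \<open>E\<close> to \<open>E\<close>.
\<close>

definition approximation_property ::
  "('k::real_or_complex \<Rightarrow> 'x \<Rightarrow> 'x) \<Rightarrow> 'x::real_normed_vector set \<Rightarrow> bool"
  where "approximation_property s E \<longleftrightarrow>
    (\<forall>K \<epsilon>. K \<subseteq> E \<and> compact K \<and> \<epsilon> > 0 \<longrightarrow>
      (\<exists>T. bounded_linear_on E s s T \<and> T ` E \<subseteq> E \<and>
        (\<exists>B. finite B \<and> T ` E \<subseteq> module.span s B) \<and>
        (\<forall>x\<in>K. norm (T x - x) \<le> \<epsilon>)))"

text \<open>
  The topological dual. The library type of bounded linear maps only asks for real linearity;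
  its norm is the operator norm.
\<close>

definition dual :: "('k::real_or_complex \<Rightarrow> 'a \<Rightarrow> 'a) \<Rightarrow> ('a::real_normed_vector \<Rightarrow>\<^sub>L 'k) set"
  where "dual s = {f. \<forall>c x. blinfun_apply f (s c x) = c * blinfun_apply f x}"

definition dual_scale :: "'k::real_or_complex \<Rightarrow> ('a::real_normed_vector \<Rightarrow>\<^sub>L 'k) \<Rightarrow> ('a \<Rightarrow>\<^sub>L 'k)"
  where "dual_scale c f = blinfun_mult_right c o\<^sub>L f"

text \<open>
  The bidual consists of functionals on \<^const>\<open>dual\<close>, represented as functions that vanish
  outside of it.
\<close>

definition bidual ::
  "('k::real_or_complex \<Rightarrow> 'a \<Rightarrow> 'a) \<Rightarrow> (('a::real_normed_vector \<Rightarrow>\<^sub>L 'k) \<Rightarrow> 'k) set"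
  where "bidual s =
    {z. (\<forall>f. f \<notin> dual s \<longrightarrow> z f = 0) \<and> bounded_linear_on (dual s) dual_scale (*) z}"

definition bidual_ball ::
  "('k::real_or_complex \<Rightarrow> 'a \<Rightarrow> 'a) \<Rightarrow> (('a::real_normed_vector \<Rightarrow>\<^sub>L 'k) \<Rightarrow> 'k) set"
  where "bidual_ball s = {z \<in> bidual s. sup_norm_on (dual s \<inter> cball 0 1) z \<le> 1}"

definition canonical_embedding ::
  "('k::real_or_complex \<Rightarrow> 'a \<Rightarrow> 'a) \<Rightarrow> 'a::real_normed_vector \<Rightarrow> ('a \<Rightarrow>\<^sub>L 'k) \<Rightarrow> 'k"
  where "canonical_embedding s x = (\<lambda>f. if f \<in> dual s then blinfun_apply f x else 0)"

text \<open>
  The filter on \<open>X\<close> describing \<open>x \<longlongrightarrow> z\<close> in the weak* topology of the bidual. Here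
  \<^term>\<open>nhds z\<close> refers to the product topology on functions, that is, to pointwise
  convergence, which on \<^const>\<open>bidual\<close> is the weak* topology. A net in \<open>X\<close> is weak*
  convergent to \<open>z\<close> iff its tail filter is finer than this filter.
\<close>

definition wstar_at ::
  "('k::real_or_complex \<Rightarrow> 'a \<Rightarrow> 'a) \<Rightarrow> (('a::real_normed_vector \<Rightarrow>\<^sub>L 'k) \<Rightarrow> 'k) \<Rightarrow> 'a filter"
  where "wstar_at s z = filtercomap (canonical_embedding s) (nhds z)"

text \<open>
  Continuous \<open>N\<close>-linear forms on \<open>X\<close>. An argument tuple is a sequence of which only the entries
  with index less than \<open>N\<close> matter; continuity is with respect to the product topology.
\<close>

definition multilinear_form ::
  "('k::real_or_complex \<Rightarrow> 'a \<Rightarrow> 'a) \<Rightarrow> nat \<Rightarrow> ((nat \<Rightarrow> 'a::real_normed_vector) \<Rightarrow> 'k) \<Rightarrow> bool"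
  where "multilinear_form s N \<Phi> \<longleftrightarrow>
    (\<forall>x y. (\<forall>i<N. x i = y i) \<longrightarrow> \<Phi> x = \<Phi> y) \<and>
    (\<forall>x. \<forall>i<N. Vector_Spaces.linear s (*) (\<lambda>v. \<Phi> (x(i := v)))) \<and>
    continuous_on UNIV \<Phi>"

definition symmetric_form :: "nat \<Rightarrow> ((nat \<Rightarrow> 'a) \<Rightarrow> 'k) \<Rightarrow> bool"
  where "symmetric_form N \<Phi> \<longleftrightarrow> (\<forall>\<sigma> x. \<sigma> permutes {..<N} \<longrightarrow> \<Phi> (x \<circ> \<sigma>) = \<Phi> x)"

definition hom_polys ::
  "('k::real_or_complex \<Rightarrow> 'a \<Rightarrow> 'a) \<Rightarrow> nat \<Rightarrow> ('a::real_normed_vector \<Rightarrow> 'k) set"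
  where "hom_polys s N = {P. \<exists>\<Phi>. multilinear_form s N \<Phi> \<and> (\<forall>x. P x = \<Phi> (\<lambda>_. x))}"

definition associated_form ::
  "('k::real_or_complex \<Rightarrow> 'a \<Rightarrow> 'a) \<Rightarrow> nat \<Rightarrow> ('a::real_normed_vector \<Rightarrow> 'k) \<Rightarrow> (nat \<Rightarrow> 'a) \<Rightarrow> 'k"
  where "associated_form s N P =
    (THE \<Phi>. multilinear_form s N \<Phi> \<and> symmetric_form N \<Phi> \<and> (\<forall>x. P x = \<Phi> (\<lambda>_. x)))"

text \<open>
  \<open>iterated_lim s z n \<Phi>\<close> replaces the arguments with index less than \<open>n\<close> by iterated weak*
  limits; the limit in the argument with index \<open>n - 1\<close> is the innermost one, and the limit in
  the argument with index \<open>0\<close> is the outermost one.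
\<close>

primrec iterated_lim ::
  "('k::real_or_complex \<Rightarrow> 'a \<Rightarrow> 'a) \<Rightarrow> (nat \<Rightarrow> ('a::real_normed_vector \<Rightarrow>\<^sub>L 'k) \<Rightarrow> 'k) \<Rightarrow> nat \<Rightarrow>
    ((nat \<Rightarrow> 'a) \<Rightarrow> 'k) \<Rightarrow> (nat \<Rightarrow> 'a) \<Rightarrow> 'k"
  where
    "iterated_lim s z 0 \<Phi> = \<Phi>"
  | "iterated_lim s z (Suc n) \<Phi> =
      iterated_lim s z n (\<lambda>x. Lim (wstar_at s (z n)) (\<lambda>v. \<Phi> (x(n := v))))"

text \<open>
  After the \<open>N\<close> limits none of the arguments of \<open>\<Phi>\<close> is left, so the value does not depend on
  the final sequence, here \<^term>\<open>\<lambda>_. 0\<close>.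
\<close>

definition arens_extension ::
  "('k::real_or_complex \<Rightarrow> 'a \<Rightarrow> 'a) \<Rightarrow> nat \<Rightarrow> ((nat \<Rightarrow> 'a::real_normed_vector) \<Rightarrow> 'k) \<Rightarrow>
    (nat \<Rightarrow> ('a \<Rightarrow>\<^sub>L 'k) \<Rightarrow> 'k) \<Rightarrow> 'k"
  where "arens_extension s N \<Phi> z = iterated_lim s z N \<Phi> (\<lambda>_. 0)"

definition aron_berner ::
  "('k::real_or_complex \<Rightarrow> 'a \<Rightarrow> 'a) \<Rightarrow> nat \<Rightarrow> ('a::real_normed_vector \<Rightarrow> 'k) \<Rightarrow>
    (('a \<Rightarrow>\<^sub>L 'k) \<Rightarrow> 'k) \<Rightarrow> 'k"
  where "aron_berner s N P z = arens_extension s N (associated_form s N P) (\<lambda>_. z)"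

definition attains_norm_on :: "'x set \<Rightarrow> ('x \<Rightarrow> 'k::real_normed_vector) \<Rightarrow> bool"
  where "attains_norm_on B Q \<longleftrightarrow> (\<exists>a\<in>B. norm (Q a) = sup_norm_on B Q)"

end

theory Submission
  imports Defs "HOL-Probability.Probability" "HOL-Library.Function_Algebras"
begin

text \<open>
  The Bishop--Phelps argument, applied to the symmetric projective tensor product, whose dual is
  the space of polynomials, replaces \<open>P\<close> by a nearby \<open>Q\<close> that attains its norm at an element
  \<open>u\<close> of the unit ball of that product. On the one hand \<open>u\<close> is an absolutely convergent series
  \<open>\<Sum>j. c j \<otimes>\<^sup>N x j\<close>, on the other hand it is a limit of combinations of total weight at most \<open>1\<close>.
  Read as laws of random points of the ball, these combinations converge weak* along a
  subsequence to a random functional \<open>\<xi>\<close> in the bidual ball with a random scalar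
  \<open>\<theta>\<close>, \<open>\<bar>\<theta>\<bar> \<le> 1\<close>, so that \<open>\<langle>u, R\<rangle> = E[\<theta> R(\<xi>)]\<close> for products \<open>R\<close> of functionals. Because of
  the approximation property a nuclear operator on the dual has a well-defined trace, and this
  extends the formula to all polynomials, one argument at a time, with the Aron--Berner extension
  on the right. Hence \<open>\<parallel>Q\<parallel> = E[\<theta> AB(Q)(\<xi>)]\<close> where \<open>\<bar>AB(Q)\<bar> \<le> \<parallel>Q\<parallel>\<close> on the bidual ball, and
  \<open>\<bar>AB(Q)(\<xi>)\<bar>\<close> must equal \<open>\<parallel>Q\<parallel>\<close> somewhere.
\<close>

section \<open>Linear functionals below sublinear ones\<close>

text \<open>\<open>Q\<close> need not attain its norm at an elementary tensor, so the point
  \<open>u\<close> is in general an infinite mixture, and neither of its two descriptions suffices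
  alone. The coefficients of the series may have total modulus above 1, so equality in the norm
  singles out no term. The random description has total weight at most 1, so a mean equal to the
  maximum forces the maximum to occur, but its points lie in the bidual. There the extension of a
  general polynomial need not be weak* continuous, and even its measurability has to be proved, so
  the formula cannot pass from products of functionals to polynomials by a limit. The trace
  overcomes this: in each slot both descriptions become nuclear representations of one operator on
  the dual, and the value wanted is its trace. Separability of the dual serves the probabilistic
  side: countably many coordinates decide weak* convergence on the ball, and norms of random
  functionals become measurable. Completions are avoided; \<open>u\<close> is present only as a
  sequence of finite combinations with summable successive differences.\<close>

definition sublinear_on :: "'v::real_vector set \<Rightarrow> ('v \<Rightarrow> real) \<Rightarrow> bool"
  where "sublinear_on V q \<longleftrightarrow>
    (\<forall>x\<in>V. \<forall>y\<in>V. q (x + y) \<le> q x + q y) \<and> (\<forall>r\<ge>0. \<forall>x\<in>V. q (r *\<^sub>R x) \<le> r * q x)"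

definition linear_on_subspace :: "'v::real_vector set \<Rightarrow> ('v \<Rightarrow> real) \<Rightarrow> bool"
  where "linear_on_subspace V f \<longleftrightarrow>
    (\<forall>x\<in>V. \<forall>y\<in>V. f (x + y) = f x + f y) \<and> (\<forall>r. \<forall>x\<in>V. f (r *\<^sub>R x) = r * f x)"

lemma linear_on_subspaceD:
  assumes "linear_on_subspace V f" "subspace V"
  shows "x \<in> V \<Longrightarrow> y \<in> V \<Longrightarrow> f (x + y) = f x + f y"
    and "x \<in> V \<Longrightarrow> f (r *\<^sub>R x) = r * f x"
    and "x \<in> V \<Longrightarrow> y \<in> V \<Longrightarrow> f (x - y) = f x - f y"
    and "x \<in> V \<Longrightarrow> f (- x) = - f x"
    and "f 0 = 0"
proof -
  have add: "f (x + y) = f x + f y" if "x \<in> V" "y \<in> V" for x y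
    using assms that by (simp add: linear_on_subspace_def)
  have scale: "f (r *\<^sub>R x) = r * f x" if "x \<in> V" for x r
    using assms that by (simp add: linear_on_subspace_def)
  have neg: "f (- x) = - f x" if "x \<in> V" for x
    using scale[OF that, of "- 1"] by simp
  show "x \<in> V \<Longrightarrow> y \<in> V \<Longrightarrow> f (x + y) = f x + f y" "x \<in> V \<Longrightarrow> f (r *\<^sub>R x) = r * f x"
    "x \<in> V \<Longrightarrow> f (- x) = - f x"
    by (fact add scale neg)+
  show "x \<in> V \<Longrightarrow> y \<in> V \<Longrightarrow> f (x - y) = f x - f y"
    using add[of x "- y"] neg[of y] assms(2) by (simp add: subspace_neg)
  show "f 0 = 0"
    using scale[of 0 0] assms(2) by (simp add: subspace_0)
qed

context
  fixes V :: "'v::real_vector set"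
  assumes V: "subspace V"
begin

lemma sublinear_on_zero:
  assumes "sublinear_on V q"
  shows "q 0 = 0"
proof -
  have 0: "0 \<in> V" using V by (simp add: subspace_0)
  have "q (0 + 0) \<le> q 0 + q 0" "q (0 *\<^sub>R 0) \<le> 0 * q 0"
    using assms 0 unfolding sublinear_on_def by blast+
  then show ?thesis by simp
qed

lemma sublinear_on_neg:
  assumes "sublinear_on V q" "x \<in> V"
  shows "- q (- x) \<le> q x"
proof -
  have "- x \<in> V" using V assms by (simp add: subspace_neg)
  then have "q (x + - x) \<le> q x + q (- x)"
    using assms unfolding sublinear_on_def by blast
  then show ?thesis using sublinear_on_zero[OF assms(1)] by simp
qed

text \<open>Zorn's lemma applies because chains have pointwise infima: \<open>- p (- x)\<close>
  bounds all candidates from below at \<open>x\<close>, and any two members of a chain are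
  comparable, so subadditivity passes to the infimum.\<close>

lemma minimal_sublinear_exists:
  assumes p: "sublinear_on V p"
  shows "\<exists>q. sublinear_on V q \<and> (\<forall>x\<in>V. q x \<le> p x) \<and>
    (\<forall>q'. sublinear_on V q' \<longrightarrow> (\<forall>x\<in>V. q' x \<le> q x) \<longrightarrow> (\<forall>x\<in>V. q' x = q x))"
proof -
  \<comment> \<open>Values outside \<open>V\<close> are pinned to 0, so that minimality in the
    pointwise order of functions speaks about \<open>V\<close> alone.\<close>
  define A where "A = {q. sublinear_on V q \<and> (\<forall>x\<in>V. q x \<le> p x) \<and> (\<forall>x. x \<notin> V \<longrightarrow> q x = 0)}"
  have "\<exists>m\<in>A. \<forall>a\<in>A. a \<le> m \<longrightarrow> a = m"
  proof (rule predicate_Zorn)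
    show "partial_order_on A (relation_of (\<lambda>a b. b \<le> a) A)"
      by (rule partial_order_on_relation_ofI) auto
    fix C assume C: "C \<in> Chains (relation_of (\<lambda>a b. b \<le> a) A)"
    then have CA: "C \<subseteq> A" and tot: "\<And>a b. a \<in> C \<Longrightarrow> b \<in> C \<Longrightarrow> a \<le> b \<or> b \<le> a"
      by (auto simp: Chains_def relation_of_def)
    have sub: "sublinear_on V q" "\<And>x. x \<in> V \<Longrightarrow> q x \<le> p x" "\<And>x. x \<notin> V \<Longrightarrow> q x = 0"
      if "q \<in> C" for q using that CA by (auto simp: A_def)
    show "\<exists>u\<in>A. \<forall>a\<in>C. u \<le> a"
    proof (cases "C = {}")
      case True
      have "(\<lambda>x. if x \<in> V then p x else 0) \<in> A"
        using p V by (auto simp: A_def sublinear_on_def subspace_add subspace_scale)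
      then show ?thesis using True by auto
    next
      case False
      define u where "u x = (if x \<in> V then INF q\<in>C. q x else 0)" for x
      have lower: "- p (- x) \<le> q x" if "q \<in> C" "x \<in> V" for q x
      proof -
        have "q (- x) \<le> p (- x)" using sub(2)[OF that(1)] V that by (simp add: subspace_neg)
        then show ?thesis using sublinear_on_neg[OF sub(1)[OF that(1)] that(2)] by simp
      qed
      have bdd: "bdd_below ((\<lambda>q. q x) ` C)" if "x \<in> V" for x
        using lower that by (auto intro!: bdd_belowI2)
      have u_le: "u x \<le> q x" if "q \<in> C" for q x
        using that sub(3)[OF that] bdd by (auto simp: u_def intro!: cINF_lower)
      have u_ge: "c \<le> u x" if "x \<in> V" "\<And>q. q \<in> C \<Longrightarrow> c \<le> q x" for c x
        using that False by (auto simp: u_def intro!: cINF_greatest)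
      have "u (x + y) \<le> u x + u y" if "x \<in> V" "y \<in> V" for x y
      proof -
        have 1: "u (x + y) \<le> q1 x + q2 y" if q: "q1 \<in> C" "q2 \<in> C" for q1 q2
        proof -
          have add: "q (x + y) \<le> q x + q y" if "q \<in> C" for q
            using sub(1)[OF that] \<open>x \<in> V\<close> \<open>y \<in> V\<close> by (simp add: sublinear_on_def)
          show ?thesis
            using tot[OF q] u_le[OF q(1), of "x + y"] u_le[OF q(2), of "x + y"] add[OF q(1)] add[OF q(2)]
            by (smt (verit) le_funD)
        qed
        have "u (x + y) - q2 y \<le> u x" if "q2 \<in> C" for q2
          using 1[OF _ that] by (intro u_ge \<open>x \<in> V\<close>) (simp add: algebra_simps)
        then have "u (x + y) - u x \<le> u y"
          by (intro u_ge \<open>y \<in> V\<close>) (simp add: algebra_simps)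
        then show ?thesis by simp
      qed
      moreover have "u (r *\<^sub>R x) \<le> r * u x" if "r \<ge> 0" "x \<in> V" for r x
      proof (cases "r = 0")
        case True
        obtain q where "q \<in> C" using False by auto
        then show ?thesis using u_le[of q 0] sublinear_on_zero[OF sub(1)[of q]] True by simp
      next
        case r: False
        have "u (r *\<^sub>R x) / r \<le> u x"
        proof (rule u_ge[OF that(2)])
          fix q assume "q \<in> C"
          then have "u (r *\<^sub>R x) \<le> r * q x"
            using u_le[of q "r *\<^sub>R x"] sub(1)[of q] that by (force simp: sublinear_on_def)
          then show "u (r *\<^sub>R x) / r \<le> q x" using r that by (simp add: field_simps)
        qed
        then show ?thesis using r that by (simp add: field_simps)
      qed
      moreover have "u x \<le> p x" if "x \<in> V" for x
      proof -
        obtain q where "q \<in> C" using False by auto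
        then show ?thesis using u_le[of q x] sub(2)[of q x] that by simp
      qed
      ultimately have "u \<in> A" by (simp add: A_def sublinear_on_def u_def)
      then show ?thesis using u_le by (auto simp: le_fun_def)
    qed
  qed
  then obtain m where m: "m \<in> A" "\<And>a. a \<in> A \<Longrightarrow> a \<le> m \<Longrightarrow> a = m" by blast
  show ?thesis
  proof (intro exI[of _ m] conjI allI impI)
    show "sublinear_on V m" "\<forall>x\<in>V. m x \<le> p x" using m(1) by (auto simp: A_def)
    fix q' assume q': "sublinear_on V q'" "\<forall>x\<in>V. q' x \<le> m x"
    define a where "a x = (if x \<in> V then q' x else 0)" for x
    have "a \<in> A"
      using q' m(1) V unfolding A_def a_def
      by (force simp: sublinear_on_def subspace_add subspace_scale)
    moreover have "a \<le> m" using q'(2) m(1) by (auto simp: a_def A_def le_fun_def)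
    ultimately have "a = m" by (rule m(2))
    then show "\<forall>x\<in>V. q' x = m x" by (metis a_def)
  qed
qed

text \<open>A minimal sublinear functional is linear: moving along a direction \<open>a\<close> and
  charging \<open>q a\<close> for it produces another sublinear functional below \<open>q\<close>,
  which by minimality equals \<open>q\<close>, and this yields superadditivity.\<close>

theorem sublinear_dominates_linear:
  assumes p: "sublinear_on V p"
  shows "\<exists>R. linear_on_subspace V R \<and> (\<forall>x\<in>V. R x \<le> p x)"
proof -
  obtain q where q: "sublinear_on V q" and qp: "\<forall>x\<in>V. q x \<le> p x"
    and min: "\<And>q'. sublinear_on V q' \<Longrightarrow> (\<forall>x\<in>V. q' x \<le> q x) \<Longrightarrow> (\<forall>x\<in>V. q' x = q x)"
    using minimal_sublinear_exists[OF p] by blast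
  have qadd: "q (x + y) \<le> q x + q y" if "x \<in> V" "y \<in> V" for x y
    using q that by (simp add: sublinear_on_def)
  have qscale: "q (r *\<^sub>R x) \<le> r * q x" if "x \<in> V" "r \<ge> 0" for x r
    using q that by (simp add: sublinear_on_def)
  have q0: "q 0 = 0" by (rule sublinear_on_zero[OF q])
  have qscale_eq: "q (r *\<^sub>R x) = r * q x" if "x \<in> V" "r \<ge> 0" for x r
  proof (cases "r = 0")
    case False
    have "q ((1 / r) *\<^sub>R (r *\<^sub>R x)) \<le> (1 / r) * q (r *\<^sub>R x)"
      using that V by (intro qscale) (auto simp: subspace_scale)
    then have "r * q x \<le> q (r *\<^sub>R x)" using that False by (simp add: field_simps)
    with qscale[OF that] show ?thesis by simp
  qed (simp add: q0)
  have sup: "q x + q a \<le> q (x + a)" if x: "x \<in> V" and a: "a \<in> V" for x a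
  proof -
    \<comment> \<open>The term at \<open>t = 0\<close> shows \<open>qa \<le> q\<close>; the term at
      \<open>t = 1\<close> will give \<open>q x + q a \<le> q (x + a)\<close>.\<close>
    define qa where "qa y = (INF t\<in>{0..}. q (y + t *\<^sub>R a) - t * q a)" for y
    have ta: "t *\<^sub>R a \<in> V" for t using a V by (simp add: subspace_scale)
    have lower: "- q (- y) \<le> q (y + t *\<^sub>R a) - t * q a" if "t \<ge> 0" "y \<in> V" for y t
    proof -
      have "q (t *\<^sub>R a) \<le> q (y + t *\<^sub>R a) + q (- y)"
        using qadd[of "y + t *\<^sub>R a" "- y"] that ta V by (simp add: subspace_add subspace_neg)
      then show ?thesis using qscale_eq[OF a that(1)] by simp
    qed
    have bdd: "bdd_below ((\<lambda>t. q (y + t *\<^sub>R a) - t * q a) ` {0..})" if "y \<in> V" for y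
      using lower that by (auto intro!: bdd_belowI2)
    have qa_le: "qa y \<le> q (y + t *\<^sub>R a) - t * q a" if "t \<ge> 0" "y \<in> V" for y t
      unfolding qa_def using that bdd by (intro cINF_lower) auto
    have qa_ge: "c \<le> qa y" if "\<And>t. t \<ge> 0 \<Longrightarrow> c \<le> q (y + t *\<^sub>R a) - t * q a" for y c
      unfolding qa_def using that by (intro cINF_greatest) auto
    have "sublinear_on V qa"
      unfolding sublinear_on_def
    proof (intro conjI ballI allI impI)
      fix y z assume y: "y \<in> V" and z: "z \<in> V"
      have 1: "qa (y + z) \<le> (q (y + t *\<^sub>R a) - t * q a) + (q (z + s *\<^sub>R a) - s * q a)"
        if "t \<ge> 0" "s \<ge> 0" for t s
      proof -
        have "qa (y + z) \<le> q (y + z + (t + s) *\<^sub>R a) - (t + s) * q a"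
          using that y z V by (intro qa_le) (auto simp: subspace_add)
        also have "y + z + (t + s) *\<^sub>R a = (y + t *\<^sub>R a) + (z + s *\<^sub>R a)"
          by (simp add: algebra_simps)
        also have "q \<dots> \<le> q (y + t *\<^sub>R a) + q (z + s *\<^sub>R a)"
          using y z ta V by (intro qadd) (auto simp: subspace_add)
        finally show ?thesis by (simp add: algebra_simps)
      qed
      have "qa (y + z) - (q (z + s *\<^sub>R a) - s * q a) \<le> qa y" if "s \<ge> 0" for s
        using 1[OF _ that] by (intro qa_ge) (simp add: algebra_simps)
      then have "qa (y + z) - qa y \<le> qa z"
        by (intro qa_ge) (simp add: algebra_simps)
      then show "qa (y + z) \<le> qa y + qa z" by simp
    next
      fix r :: real and y assume r: "0 \<le> r" and y: "y \<in> V"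
      show "qa (r *\<^sub>R y) \<le> r * qa y"
      proof (cases "r = 0")
        case True
        then show ?thesis using qa_le[of 0 0] V q0 by (simp add: subspace_0)
      next
        case False
        have "qa (r *\<^sub>R y) / r \<le> qa y"
        proof (rule qa_ge)
          fix t :: real assume t: "0 \<le> t"
          have "qa (r *\<^sub>R y) \<le> q (r *\<^sub>R y + (r * t) *\<^sub>R a) - (r * t) * q a"
            using r t y V by (intro qa_le) (auto simp: subspace_scale)
          also have "r *\<^sub>R y + (r * t) *\<^sub>R a = r *\<^sub>R (y + t *\<^sub>R a)"
            by (simp add: algebra_simps)
          also have "q \<dots> = r * q (y + t *\<^sub>R a)"
            using r y ta V by (intro qscale_eq) (auto simp: subspace_add)
          finally show "qa (r *\<^sub>R y) / r \<le> q (y + t *\<^sub>R a) - t * q a"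
            using r False by (simp add: field_simps)
        qed
        then show ?thesis using r False by (simp add: field_simps)
      qed
    qed
    moreover have "\<forall>y\<in>V. qa y \<le> q y" using qa_le[of 0] by auto
    ultimately have "qa x = q x" using min x by blast
    then show ?thesis using qa_le[of 1 x] x by simp
  qed
  have add: "q (x + y) = q x + q y" if "x \<in> V" "y \<in> V" for x y
    using sup[OF that] qadd[OF that] by simp
  have neg: "q (- x) = - q x" if "x \<in> V" for x
    using add[OF that, of "- x"] that V q0 by (simp add: subspace_neg)
  have "q (r *\<^sub>R x) = r * q x" if "x \<in> V" for x r
  proof (cases "r \<ge> 0")
    case False
    then have "q (- ((- r) *\<^sub>R x)) = - ((- r) * q x)"
      using neg[of "(- r) *\<^sub>R x"] qscale_eq[OF that, of "- r"] that V
      by (simp add: subspace_scale del: scaleR_minus_left)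
    then show ?thesis by simp
  qed (simp add: qscale_eq that)
  then have "linear_on_subspace V q" using add by (simp add: linear_on_subspace_def)
  then show ?thesis using qp by blast
qed

end

section \<open>The Bishop--Phelps argument\<close>

definition seminorm_on :: "'v::real_vector set \<Rightarrow> ('v \<Rightarrow> real) \<Rightarrow> bool"
  where "seminorm_on V \<pi> \<longleftrightarrow>
    (\<forall>x\<in>V. 0 \<le> \<pi> x) \<and> (\<forall>x\<in>V. \<forall>y\<in>V. \<pi> (x + y) \<le> \<pi> x + \<pi> y) \<and>
    (\<forall>r. \<forall>x\<in>V. \<pi> (r *\<^sub>R x) = \<bar>r\<bar> * \<pi> x)"

context
  fixes V B :: "'v::real_vector set" and f \<pi> :: "'v \<Rightarrow> real" and \<epsilon> M :: real
  assumes V: "subspace V" and f: "linear_on_subspace V f" and \<pi>: "seminorm_on V \<pi>"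
    and BV: "B \<subseteq> V" and B_ne: "B \<noteq> {}" and \<epsilon>: "\<epsilon> > 0" and bound: "\<And>v. v \<in> B \<Longrightarrow> f v \<le> M"
begin

text \<open>Ekeland's principle with the limit point left out, as \<open>V\<close> carries no
  completeness. A move from \<open>x\<close> to \<open>v\<close> is admissible if \<open>f\<close>
  gains at least \<open>\<epsilon>\<close> times the distance. Admissibility is transitive, and each
  \<open>w (Suc m)\<close> nearly exhausts the gain available from \<open>w m\<close>.\<close>

lemma ekeland_sequence:
  obtains w where "\<And>m. w m \<in> B"
    and "\<And>m n. m \<le> n \<Longrightarrow> \<epsilon> * \<pi> (w n - w m) \<le> f (w n) - f (w m)"
    and "\<And>m n. m \<le> n \<Longrightarrow> f (w n) - f (w m) \<le> (1/2) ^ m"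
    and "\<And>m v. v \<in> B \<Longrightarrow> f v \<le> f (w m) + \<epsilon> * \<pi> (v - w m) + (1/2) ^ m"
proof -
  have inV: "x - y \<in> V" if "x \<in> B" "y \<in> B" for x y
    using that BV V by (auto intro: subspace_diff)
  have \<pi>_nonneg: "0 \<le> \<pi> x" if "x \<in> V" for x
    using \<pi> that by (simp add: seminorm_on_def)
  have \<pi>0: "\<pi> 0 = 0"
    using \<pi> V unfolding seminorm_on_def
    by (metis abs_zero mult_zero_left scaleR_zero_left subspace_0)
  have tri: "\<pi> (x - z) \<le> \<pi> (x - y) + \<pi> (y - z)" if "x \<in> B" "y \<in> B" "z \<in> B" for x y z
  proof -
    have "\<pi> ((x - y) + (y - z)) \<le> \<pi> (x - y) + \<pi> (y - z)"
      using \<pi> inV that unfolding seminorm_on_def by blast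
    then show ?thesis by simp
  qed
  define S where "S x = {v\<in>B. \<epsilon> * \<pi> (v - x) \<le> f v - f x}" for x
  have "\<exists>w. \<forall>m. w m \<in> B \<and> w (Suc m) \<in> S (w m) \<and> (\<forall>v\<in>S (w m). f v \<le> f (w (Suc m)) + (1/2) ^ m)"
  proof (rule dependent_nat_choice)
    fix x m assume x: "x \<in> B"
    have xS: "x \<in> S x" using x \<pi>0 by (simp add: S_def)
    have bdd: "bdd_above (f ` S x)" using bound by (auto simp: S_def intro!: bdd_aboveI2)
    obtain y where y: "y \<in> S x" "(SUP v\<in>S x. f v) - (1/2) ^ m < f y"
      using less_cSUP_iff[OF _ bdd, of "(SUP v\<in>S x. f v) - (1/2) ^ m"] xS by auto
    show "\<exists>y. y \<in> B \<and> y \<in> S x \<and> (\<forall>v\<in>S x. f v \<le> f y + (1/2) ^ m)"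
    proof (intro exI[of _ y] conjI ballI)
      fix v assume "v \<in> S x"
      then have "f v \<le> (SUP v\<in>S x. f v)" using bdd by (rule cSUP_upper)
      then show "f v \<le> f y + (1/2) ^ m" using y by simp
    qed (use y in \<open>auto simp: S_def\<close>)
  qed (use B_ne in auto)
  then obtain w where wB: "\<And>m. w m \<in> B" and wS: "\<And>m. w (Suc m) \<in> S (w m)"
    and wsup: "\<And>m v. v \<in> S (w m) \<Longrightarrow> f v \<le> f (w (Suc m)) + (1/2) ^ m" by blast
  have S_trans: "z \<in> S x" if "y \<in> S x" "z \<in> S y" "x \<in> B" for x y z
  proof -
    have "\<epsilon> * \<pi> (z - x) \<le> \<epsilon> * (\<pi> (z - y) + \<pi> (y - x))"
      using that tri[of z y x] \<epsilon> by (intro mult_left_mono) (auto simp: S_def)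
    also have "\<dots> \<le> f z - f x" using that by (auto simp: S_def algebra_simps)
    finally show ?thesis using that by (auto simp: S_def)
  qed
  have wmono: "w n \<in> S (w m)" if "m \<le> n" for m n
    using that
  proof (induction n rule: dec_induct)
    case base
    show ?case using wB \<pi>0 by (simp add: S_def)
  next
    case (step n)
    show ?case using S_trans[OF step.IH wS wB] .
  qed
  show ?thesis
  \<comment> \<open>The shift by one lets the near maximality of \<open>w (Suc m)\<close> over
    \<open>S (w m)\<close> bound every gain still available from \<open>w (Suc m)\<close> itself.
    Points outside \<open>S (w (Suc m))\<close> satisfy the last inequality by definition of
    \<open>S\<close>.\<close>
  proof (rule that[of "\<lambda>m. w (Suc m)"])
    show "w (Suc m) \<in> B" for m by (rule wB)
    show "\<epsilon> * \<pi> (w (Suc n) - w (Suc m)) \<le> f (w (Suc n)) - f (w (Suc m))" if "m \<le> n" for m n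
      using wmono[of "Suc m" "Suc n"] that by (simp add: S_def)
    show "f (w (Suc n)) - f (w (Suc m)) \<le> (1/2) ^ m" if "m \<le> n" for m n
      using wsup[OF wmono[of m "Suc n"]] that by simp
    show "f v \<le> f (w (Suc m)) + \<epsilon> * \<pi> (v - w (Suc m)) + (1/2) ^ m" if v: "v \<in> B" for m v
    proof (cases "v \<in> S (w (Suc m))")
      case True
      have "0 \<le> \<epsilon> * \<pi> (v - w (Suc m))" using \<pi>_nonneg[OF inV[OF v wB]] \<epsilon> by simp
      then show ?thesis using wsup[OF S_trans[OF wS True wB]] by simp
    next
      case False
      then have "f v < f (w (Suc m)) + \<epsilon> * \<pi> (v - w (Suc m))" using v by (simp add: S_def)
      then show ?thesis by (smt (verit) zero_le_power zero_le_divide_iff)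
    qed
  qed
qed

text \<open>
  Instead of supporting \<open>f - R\<close> at the limit of the sequence
  \<open>w\<close>, which need not exist in \<open>V\<close>, the support inequality is asked for up to an error.
\<close>

theorem bishop_phelps_sequence:
  assumes convex: "convex B"
  obtains w R where "\<And>m. w m \<in> B" and "linear_on_subspace V R"
    and "\<And>x. x \<in> V \<Longrightarrow> R x \<le> \<epsilon> * \<pi> x"
    and "\<And>m n. m \<le> n \<Longrightarrow> \<epsilon> * \<pi> (w n - w m) \<le> (1/2) ^ m"
    and "\<And>m v. v \<in> B \<Longrightarrow> f v - R v \<le> f (w m) - R (w m) + 4 * (1/2) ^ m"
proof -
  obtain w where wB: "\<And>m. w m \<in> B"
    and w_diff: "\<And>m n. m \<le> n \<Longrightarrow> \<epsilon> * \<pi> (w n - w m) \<le> f (w n) - f (w m)"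
    and w_f: "\<And>m n. m \<le> n \<Longrightarrow> f (w n) - f (w m) \<le> (1/2) ^ m"
    and w_max: "\<And>m v. v \<in> B \<Longrightarrow> f v \<le> f (w m) + \<epsilon> * \<pi> (v - w m) + (1/2) ^ m"
    using ekeland_sequence by metis
  note fD = linear_on_subspaceD[OF f V]
  have \<pi>D: "0 \<le> \<pi> x" "\<pi> (x + y) \<le> \<pi> x + \<pi> y" "\<pi> (r *\<^sub>R x) = \<bar>r\<bar> * \<pi> x"
    if "x \<in> V" "y \<in> V" for x y r
    using \<pi> that by (simp_all add: seminorm_on_def)
  have BinV: "x \<in> V" if "x \<in> B" for x using that BV by auto
  note wV = BinV[OF wB]
  have \<pi>minus: "\<pi> (- x) = \<pi> x" if "x \<in> V" for x
    using \<pi>D(3)[OF that that, of "- 1"] by simp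
  have dV: "x - y \<in> V" if "x \<in> V" "y \<in> V" for x y using V that by (rule subspace_diff)
  have sV: "r *\<^sub>R x \<in> V" if "x \<in> V" for x r using V that by (rule subspace_scale)
  have aV: "x + y \<in> V" if "x \<in> V" "y \<in> V" for x y using V that by (rule subspace_add)
  \<comment> \<open>The factor 4 makes \<open>T\<close> decrease in \<open>m\<close>: one half of
    \<open>4 * (1/2) ^ m\<close> covers \<open>\<eta> n\<close> for \<open>n > m\<close>, the other
    half covers \<open>\<epsilon>\<close> times the distance of \<open>w m\<close> and
    \<open>w n\<close> and the gain of \<open>f\<close> between them, each at most
    \<open>(1/2) ^ m\<close>.\<close>
  define \<eta> :: "nat \<Rightarrow> real" where "\<eta> m = 4 * (1/2) ^ m" for m
  \<comment> \<open>A linear functional below all \<open>T x m t v\<close> solves the problem: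
    \<open>t = 0\<close> bounds it by \<open>\<epsilon> * \<pi> x\<close>, and \<open>t = 1\<close>
    with \<open>x = w m - v\<close> is the approximate support inequality at
    \<open>w m\<close>.\<close>
  define T where "T x m t v = \<epsilon> * \<pi> (x + t *\<^sub>R (v - w m)) + t * \<eta> m - t * (f v - f (w m))" for x m t v
  have T_lower: "- \<epsilon> * \<pi> x \<le> T x m t v" if "x \<in> V" "t \<ge> 0" "v \<in> B" for x m t v
  proof -
    let ?y = "v - w m"
    have y: "?y \<in> V" using dV[OF BinV[OF that(3)] wV] .
    have "t * (f v - f (w m)) \<le> t * (\<epsilon> * \<pi> ?y + \<eta> m)"
    proof (rule mult_left_mono)
      have "0 \<le> (1/2::real) ^ m" by simp
      then show "f v - f (w m) \<le> \<epsilon> * \<pi> ?y + \<eta> m"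
        using w_max[OF that(3), of m] unfolding \<eta>_def by linarith
    qed (fact that)
    moreover have "t * \<pi> ?y \<le> \<pi> (x + t *\<^sub>R ?y) + \<pi> x"
    proof -
      have "t * \<pi> ?y = \<pi> ((x + t *\<^sub>R ?y) + (- x))" using \<pi>D(3)[OF y y, of t] that(2) by simp
      also have "\<dots> \<le> \<pi> (x + t *\<^sub>R ?y) + \<pi> (- x)"
        using y that V by (intro \<pi>D aV sV) (auto intro: subspace_neg)
      finally show ?thesis using \<pi>minus[OF that(1)] by simp
    qed
    then have "\<epsilon> * (t * \<pi> ?y) \<le> \<epsilon> * (\<pi> (x + t *\<^sub>R ?y) + \<pi> x)"
      using \<epsilon> by (intro mult_left_mono) auto
    ultimately show ?thesis by (simp add: T_def algebra_simps)
  qed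
  have T_mono: "T x n t v \<le> T x m t v" if "m \<le> n" "x \<in> V" "t \<ge> 0" "v \<in> B" for x m n t v
  proof (cases "m = n")
    case False
    then have mn: "Suc m \<le> n" using that by simp
    let ?d = "w m - w n"
    have d: "?d \<in> V" using dV[OF wV wV] .
    have y: "v - w m \<in> V" using dV[OF BinV[OF that(4)] wV] .
    have "\<pi> (x + t *\<^sub>R (v - w n)) = \<pi> ((x + t *\<^sub>R (v - w m)) + t *\<^sub>R ?d)"
      by (simp add: algebra_simps)
    also have "\<dots> \<le> \<pi> (x + t *\<^sub>R (v - w m)) + \<pi> (t *\<^sub>R ?d)"
      using that y d by (intro \<pi>D aV sV)
    also have "\<pi> (t *\<^sub>R ?d) = t * \<pi> (w n - w m)"
      using \<pi>D(3)[OF d d, of t] \<pi>minus[OF d] that by simp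
    finally have "\<epsilon> * \<pi> (x + t *\<^sub>R (v - w n)) \<le> \<epsilon> * (\<pi> (x + t *\<^sub>R (v - w m)) + t * \<pi> (w n - w m))"
      using \<epsilon> by (intro mult_left_mono) auto
    moreover have "t * (\<epsilon> * \<pi> (w n - w m) + \<eta> n + (f (w n) - f (w m))) \<le> t * \<eta> m"
    proof (rule mult_left_mono)
      have "(1/2::real) ^ n \<le> (1/2) ^ Suc m" using mn by (intro power_decreasing) auto
      then show "\<epsilon> * \<pi> (w n - w m) + \<eta> n + (f (w n) - f (w m)) \<le> \<eta> m"
        using w_diff[OF that(1)] w_f[OF that(1)] by (simp add: \<eta>_def)
    qed (fact that)
    ultimately show ?thesis by (simp add: T_def algebra_simps)
  qed simp
  define I where "I = {(m::nat, t::real, v). t \<ge> 0 \<and> v \<in> B}"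
  define q where "q x = (INF (m, t, v)\<in>I. T x m t v)" for x
  have I_ne: "I \<noteq> {}" using B_ne by (auto simp: I_def)
  have bdd: "bdd_below ((\<lambda>(m, t, v). T x m t v) ` I)" if "x \<in> V" for x
    using T_lower[OF that] by (auto simp: I_def intro!: bdd_belowI2)
  have q_le: "q x \<le> T x m t v" if "x \<in> V" "t \<ge> 0" "v \<in> B" for x m t v
    using cINF_lower[OF bdd[OF that(1)], of "(m, t, v)"] that by (simp add: q_def I_def)
  have q_ge: "c \<le> q x" if "\<And>m t v. t \<ge> 0 \<Longrightarrow> v \<in> B \<Longrightarrow> c \<le> T x m t v" for c x
    unfolding q_def using I_ne that by (intro cINF_greatest) (auto simp: I_def)
  have "sublinear_on V q"
    unfolding sublinear_on_def
  proof (intro conjI ballI allI impI)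
    fix x y assume x: "x \<in> V" and y: "y \<in> V"
    have 1: "q (x + y) \<le> T x m t v + T y n s u"
      if "t \<ge> 0" "v \<in> B" "s \<ge> 0" "u \<in> B" for m t v n s u
    proof -
      \<comment> \<open>Terms with different \<open>m\<close> and \<open>n\<close> are first moved
        to the larger index by \<open>T_mono\<close>; then convexity of \<open>B\<close> merges the
        two directions into one with parameter \<open>t + s\<close>.\<close>
      define k where "k = max m n"
      have "q (x + y) \<le> T x k t v + T y k s u"
      proof (cases "t + s = 0")
        case True
        then have "t = 0" "s = 0" using that by auto
        have "q (x + y) \<le> T (x + y) k 0 v" using x y that aV by (intro q_le) auto
        also have "\<dots> \<le> \<epsilon> * (\<pi> x + \<pi> y)"
          using \<pi>D(2)[OF x y] \<epsilon> by (simp add: T_def)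
        finally show ?thesis using \<open>t = 0\<close> \<open>s = 0\<close> by (simp add: T_def algebra_simps)
      next
        case False
        define z where "z = (t / (t + s)) *\<^sub>R v + (s / (t + s)) *\<^sub>R u"
        have z: "z \<in> B"
          unfolding z_def using that False
          by (intro convexD[OF convex]) (auto simp: add_divide_distrib[symmetric])
        have tz: "(t + s) *\<^sub>R z = t *\<^sub>R v + s *\<^sub>R u"
          using False by (simp add: z_def scaleR_add_right)
        have "(t + s) * f z = f ((t + s) *\<^sub>R z)" using fD(2)[OF BinV[OF z]] by simp
        also have "\<dots> = t * f v + s * f u"
          unfolding tz using that by (simp add: fD BinV sV)
        finally have fz: "(t + s) * f z = t * f v + s * f u" .
        have "q (x + y) \<le> T (x + y) k (t + s) z" using x y z that aV by (intro q_le) auto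
        also have "\<dots> = \<epsilon> * \<pi> ((x + t *\<^sub>R (v - w k)) + (y + s *\<^sub>R (u - w k))) + (t + s) * \<eta> k
            - (t * (f v - f (w k)) + s * (f u - f (w k)))"
          unfolding T_def scaleR_diff_right tz using fz by (simp add: algebra_simps)
        also have "\<pi> ((x + t *\<^sub>R (v - w k)) + (y + s *\<^sub>R (u - w k))) \<le>
            \<pi> (x + t *\<^sub>R (v - w k)) + \<pi> (y + s *\<^sub>R (u - w k))"
          by (intro \<pi>D aV sV dV x y wV BinV[OF that(2)] BinV[OF that(4)])
        finally show ?thesis using \<epsilon> by (simp add: T_def algebra_simps)
      qed
      also have "\<dots> \<le> T x m t v + T y n s u"
        using that x y by (intro add_mono T_mono) (auto simp: k_def)
      finally show ?thesis .
    qed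
    have "q (x + y) - T y n s u \<le> q x" if "s \<ge> 0" "u \<in> B" for n s u
      using 1[OF _ _ that] by (intro q_ge) (simp add: algebra_simps)
    then have "q (x + y) - q x \<le> q y" by (intro q_ge) (simp add: algebra_simps)
    then show "q (x + y) \<le> q x + q y" by simp
  next
    fix r :: real and x assume r: "0 \<le> r" and x: "x \<in> V"
    obtain b where b: "b \<in> B" using B_ne by auto
    show "q (r *\<^sub>R x) \<le> r * q x"
    proof (cases "r = 0")
      case True
      have "\<pi> 0 = 0" using \<pi>D(3)[OF x x, of 0] by simp
      then show ?thesis using q_le[of 0 0 b 0] b True V by (simp add: T_def subspace_0)
    next
      case False
      have "q (r *\<^sub>R x) / r \<le> q x"
      proof (rule q_ge)
        fix m t v assume t: "0 \<le> (t::real)" and v: "v \<in> B"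
        have y: "x + t *\<^sub>R (v - w m) \<in> V" by (intro aV sV dV x wV BinV[OF v])
        have "q (r *\<^sub>R x) \<le> T (r *\<^sub>R x) m (r * t) v" using r t v x sV by (intro q_le) auto
        also have "\<dots> = \<epsilon> * \<pi> (r *\<^sub>R (x + t *\<^sub>R (v - w m))) + r * t * \<eta> m - r * t * (f v - f (w m))"
          by (simp add: T_def scaleR_add_right)
        also have "\<dots> = r * T x m t v" using \<pi>D(3)[OF y y] r by (simp add: T_def algebra_simps)
        finally show "q (r *\<^sub>R x) / r \<le> T x m t v" using r False by (simp add: field_simps)
      qed
      then show ?thesis using r False by (simp add: field_simps)
    qed
  qed
  then obtain R where R: "linear_on_subspace V R" and Rq: "\<And>x. x \<in> V \<Longrightarrow> R x \<le> q x"
    using sublinear_dominates_linear[OF V] by blast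
  note RD = linear_on_subspaceD[OF R V]
  show ?thesis
  proof (rule that[OF wB R])
    obtain b where b: "b \<in> B" using B_ne by auto
    show "R x \<le> \<epsilon> * \<pi> x" if "x \<in> V" for x
      using Rq[OF that] q_le[OF that _ b, of 0 0] by (simp add: T_def)
    show "\<epsilon> * \<pi> (w n - w m) \<le> (1/2) ^ m" if "m \<le> n" for m n
      using w_diff[OF that] w_f[OF that] by simp
    show "f v - R v \<le> f (w m) - R (w m) + 4 * (1/2) ^ m" if v: "v \<in> B" for m v
    proof -
      have y: "v - w m \<in> V" using dV[OF BinV[OF v] wV] .
      have "\<pi> 0 = 0" using \<pi>D(3)[OF y y, of 0] by simp
      moreover have "R (- (v - w m)) \<le> q (- (v - w m))" using y V by (intro Rq subspace_neg)
      moreover have "q (- (v - w m)) \<le> T (- (v - w m)) m 1 v"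
        using y v V by (intro q_le subspace_neg) auto
      ultimately have "R (- (v - w m)) \<le> \<eta> m - (f v - f (w m))" by (simp add: T_def)
      moreover have "R (- (v - w m)) = - (R v - R (w m))" using y v by (simp add: RD BinV wB del: minus_diff_eq)
      ultimately show ?thesis by (simp add: \<eta>_def)
    qed
  qed
qed

end

section \<open>The scalar field\<close>

text \<open>The inner product with 1 serves as real part, so that real and complex scalars are
  treated at once.\<close>

definition re :: "'k::real_or_complex \<Rightarrow> real"
  where "re z = z \<bullet> 1"

lemma bounded_linear_re: "bounded_linear re"
  unfolding re_def by (rule bounded_linear_inner_left)

lemma linear_re: "linear re"
  by (rule bounded_linear.linear[OF bounded_linear_re])

lemmas re_add = linear_add[OF linear_re]
  and re_diff = linear_diff[OF linear_re]
  and re_neg = linear_neg[OF linear_re]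
  and re_scaleR = linear_scale[OF linear_re]
  and re_sum = linear_sum[OF linear_re]
  and re_zero[simp] = linear_0[OF linear_re]
  and tendsto_re = bounded_linear.tendsto[OF bounded_linear_re]

lemma re_one [simp]: "re 1 = 1"
  by (simp add: re_def dot_square_norm)

lemma re_of_real [simp]: "re (of_real r) = r"
  by (simp add: of_real_def re_scaleR)

lemma re_of_real_mult: "re (of_real r * z) = r * re z"
  by (simp add: scaleR_conv_of_real[symmetric] re_scaleR)

lemma abs_re_le: "\<bar>re z\<bar> \<le> norm z"
  unfolding re_def using Cauchy_Schwarz_ineq2[of z 1] by simp

lemma re_le: "re z \<le> norm z"
  using abs_re_le[of z] by simp

lemma exists_unimodular:
  fixes z :: "'k::real_or_complex"
  obtains c where "norm c = 1" "c * z = of_real (norm z)"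
proof (cases "z = 0")
  case False
  then show ?thesis by (intro that[of "of_real (norm z) / z"]) (auto simp: norm_divide)
qed (use that[of 1] in auto)

text \<open>A unimodular factor turns the norm into a real part. This carries estimates for real
  functionals back to scalars.\<close>

lemma norm_le_re:
  fixes z :: "'k::real_or_complex"
  assumes "\<And>c. norm c = 1 \<Longrightarrow> re (c * z) \<le> C"
  shows "norm z \<le> C"
  using exists_unimodular[of z] assms by (metis re_of_real)

lemma eq_re:
  fixes z w :: "'k::real_or_complex"
  assumes "\<And>c. re (c * z) = re (c * w)"
  shows "z = w"
proof -
  have "norm (z - w) \<le> 0" by (rule norm_le_re) (simp add: right_diff_distrib re_diff assms)
  then show ?thesis by simp
qed

text \<open>The coordinates of the functional given by \<open>c\<close> depend linearly on
  \<open>c\<close>, and injectively because \<open>re (inverse c * c) = 1\<close>; counting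
  dimensions, every functional arises.\<close>

lemma linear_eq_re_mult:
  fixes F :: "'k::real_or_complex \<Rightarrow> real"
  assumes F: "linear F"
  obtains c where "\<And>z. F z = re (z * c)"
proof -
  have lin: "linear (\<lambda>z. re (z * c))" for c :: 'k
    by (intro bounded_linear.linear bounded_linear_compose[OF bounded_linear_re] bounded_linear_mult_left)
  define A where "A c = (\<Sum>b\<in>Basis. re (b * c) *\<^sub>R b)" for c :: 'k
  have A: "linear A"
    unfolding A_def
    by (intro linear_compose_sum ballI bounded_linear.linear bounded_linear_compose[OF bounded_linear_scaleR_left]
        bounded_linear_compose[OF bounded_linear_re] bounded_linear_mult_right)
  have coord: "A c \<bullet> b = re (b * c)" if "b \<in> Basis" for c b
    unfolding A_def using that by simp
  have "c = 0" if "A c = 0" for c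
  proof (rule ccontr)
    assume "c \<noteq> 0"
    have "(\<lambda>z. re (z * c)) = (\<lambda>z. 0)"
      using coord[of _ c] that by (intro linear_eq_stdbasis lin linear_zero) auto
    then have "re (inverse c * c) = 0" by (rule fun_cong)
    then show False using \<open>c \<noteq> 0\<close> by simp
  qed
  then have "surj A"
    using linear_injective_imp_surjective[OF A] linear_injective_0[OF A] by blast
  then obtain c where c: "A c = (\<Sum>b\<in>Basis. F b *\<^sub>R b)" by (metis surjD)
  have "F = (\<lambda>z. re (z * c))"
  proof (rule linear_eq_stdbasis[OF F lin])
    fix b :: 'k assume b: "b \<in> Basis"
    then show "F b = re (b * c)" using coord[OF b, of c] unfolding c by simp
  qed
  then show ?thesis using that by metis
qed

section \<open>Multilinear forms\<close>

lemma tendsto_fun_coordinatewise: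
  fixes f :: "'x \<Rightarrow> 'i \<Rightarrow> 'b::topological_space"
  assumes "\<And>i. ((\<lambda>x. f x i) \<longlongrightarrow> l i) F"
  shows "(f \<longlongrightarrow> l) F"
proof -
  have "limitin (product_topology (\<lambda>_. euclidean) UNIV) f l F"
    unfolding limitin_componentwise using assms by auto
  then show ?thesis by (simp add: euclidean_product_topology)
qed

lemma vector_space_mult: "vector_space ((*) :: 'k::field \<Rightarrow> 'k \<Rightarrow> 'k)"
  by unfold_locales (auto simp: algebra_simps)

context normed_space_over
begin

definition mform :: "nat \<Rightarrow> ((nat \<Rightarrow> 'a) \<Rightarrow> 'k) \<Rightarrow> bool"
  where "mform N \<Phi> \<longleftrightarrow>
    (\<forall>x y. (\<forall>i<N. x i = y i) \<longrightarrow> \<Phi> x = \<Phi> y) \<and>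
    (\<forall>x. \<forall>i<N. \<forall>u v. \<Phi> (x(i := u + v)) = \<Phi> (x(i := u)) + \<Phi> (x(i := v))) \<and>
    (\<forall>x. \<forall>i<N. \<forall>c u. \<Phi> (x(i := scale c u)) = c * \<Phi> (x(i := u)))"

lemma mformD:
  assumes "mform N \<Phi>"
  shows mform_cong: "(\<And>i. i < N \<Longrightarrow> x i = y i) \<Longrightarrow> \<Phi> x = \<Phi> y"
    and mform_add: "i < N \<Longrightarrow> \<Phi> (x(i := u + v)) = \<Phi> (x(i := u)) + \<Phi> (x(i := v))"
    and mform_scale: "i < N \<Longrightarrow> \<Phi> (x(i := scale c u)) = c * \<Phi> (x(i := u))"
  using assms unfolding mform_def by blast+

lemma multilinear_form_iff:
  "multilinear_form scale N \<Phi> \<longleftrightarrow> mform N \<Phi> \<and> continuous_on UNIV \<Phi>"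
  unfolding multilinear_form_def mform_def Vector_Spaces.linear_iff
  using vector_space_axioms vector_space_mult by blast

lemma mform_zero:
  assumes "mform N \<Phi>" "i < N" "x i = 0"
  shows "\<Phi> x = 0"
proof -
  have "\<Phi> (x(i := scale 0 0)) = 0" using mform_scale[OF assms(1,2), of x 0 0] by simp
  moreover have "x(i := scale 0 0) = x" using assms(3) by (auto simp: fun_eq_iff)
  ultimately show ?thesis by simp
qed

lemma mform_diff:
  assumes "mform N \<Phi>" "i < N"
  shows "\<Phi> (x(i := u - v)) = \<Phi> (x(i := u)) - \<Phi> (x(i := v))"
  using mform_add[OF assms, of x "u - v" v] by simp

lemma mform_sum:
  assumes "mform N \<Phi>" "i < N"
  shows "\<Phi> (x(i := sum f A)) = (\<Sum>a\<in>A. \<Phi> (x(i := f a)))"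
proof (induction A rule: infinite_finite_induct)
  case (insert a A)
  then show ?case by (metis sum.insert mform_add[OF assms])
qed (auto intro: mform_zero[OF assms])

lemma mform_scale_all:
  assumes "mform N \<Phi>"
  shows "\<Phi> (\<lambda>i. scale (a i) (x i)) = (\<Prod>i<N. a i) * \<Phi> x"
proof -
  have "\<Phi> (\<lambda>i. if i < j then scale (a i) (x i) else x i) = (\<Prod>i<j. a i) * \<Phi> x" if "j \<le> N" for j
    using that
  proof (induction j)
    case (Suc j)
    let ?y = "\<lambda>i. if i < j then scale (a i) (x i) else x i"
    have "(\<lambda>i. if i < Suc j then scale (a i) (x i) else x i) = ?y(j := scale (a j) (x j))"
      by (auto simp: fun_eq_iff)
    moreover have "?y(j := x j) = ?y" by (auto simp: fun_eq_iff)
    ultimately have "\<Phi> (\<lambda>i. if i < Suc j then scale (a i) (x i) else x i) = a j * \<Phi> ?y"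
      using mform_scale[OF assms, of j ?y] Suc.prems by simp
    then show ?case using Suc by simp
  qed simp
  from this[of N] show ?thesis
    using mform_cong[OF assms, of "\<lambda>i. if i < N then scale (a i) (x i) else x i" "\<lambda>i. scale (a i) (x i)"]
    by simp
qed

lemma mform_scale_diag:
  assumes "mform N \<Phi>"
  shows "\<Phi> (\<lambda>_. scale c x) = c ^ N * \<Phi> (\<lambda>_. x)"
  using mform_scale_all[OF assms, of "\<lambda>_. c" "\<lambda>_. x"] by simp

text \<open>Continuity in quantitative form. The constant is carried along because it survives
  unchanged when arguments are replaced by functionals in the bidual ball.\<close>

definition bform :: "nat \<Rightarrow> real \<Rightarrow> ((nat \<Rightarrow> 'a) \<Rightarrow> 'k) \<Rightarrow> bool"
  where "bform N C \<Phi> \<longleftrightarrow> mform N \<Phi> \<and> (\<forall>x. norm (\<Phi> x) \<le> C * (\<Prod>i<N. norm (x i)))"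

lemma mform_imp_bform:
  assumes m: "mform N \<Phi>" and n: "\<And>x. (\<And>i. i < N \<Longrightarrow> norm (x i) \<le> \<delta>) \<Longrightarrow> norm (\<Phi> x) \<le> K"
    and \<delta>: "\<delta> > 0" and K: "K \<ge> 0"
  shows "bform N (K * (1 / \<delta>) ^ N) \<Phi>"
  unfolding bform_def
proof (intro conjI allI m)
  fix x
  show "norm (\<Phi> x) \<le> K * (1 / \<delta>) ^ N * (\<Prod>i<N. norm (x i))"
  proof (cases "\<exists>i<N. x i = 0")
    case True
    then show ?thesis using mform_zero[OF m] K \<delta> by (force intro!: mult_nonneg_nonneg prod_nonneg)
  next
    case False
    define y where "y i = (\<delta> / norm (x i)) *\<^sub>R x i" for i
    have "\<Phi> x = \<Phi> (\<lambda>i. scale (of_real (norm (x i) / \<delta>)) (y i))"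
      using False \<delta> by (intro mform_cong[OF m]) (simp add: y_def scale_of_real del: of_real_divide)
    also have "norm \<dots> = (\<Prod>i<N. norm (x i) / \<delta>) * norm (\<Phi> y)"
      unfolding mform_scale_all[OF m] using \<delta>
      by (simp add: norm_mult prod_norm[symmetric] norm_divide)
    also have "\<dots> \<le> (\<Prod>i<N. norm (x i) / \<delta>) * K"
      using False \<delta> by (intro mult_left_mono n prod_nonneg) (auto simp: y_def)
    also have "\<dots> = K * (1 / \<delta>) ^ N * (\<Prod>i<N. norm (x i))"
      by (simp add: prod_dividef power_divide)
    finally show ?thesis .
  qed
qed

text \<open>Continuity at 0 bounds the form on some box of small vectors, and multilinearity
  rescales the box.\<close>

lemma multilinear_imp_bform:
  assumes "multilinear_form scale N \<Phi>"
  obtains C where "C \<ge> 0" "bform N C \<Phi>"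
proof -
  have m: "mform N \<Phi>" and cont: "continuous_on UNIV \<Phi>"
    using assms by (auto simp: multilinear_form_iff)
  have "\<exists>n. \<forall>x. (\<forall>i<N. norm (x i) \<le> inverse (real (Suc n))) \<longrightarrow> norm (\<Phi> x) \<le> norm (\<Phi> (\<lambda>_. 0)) + 1"
  proof (rule ccontr)
    assume "\<not> ?thesis"
    then obtain x where x: "\<And>n i. i < N \<Longrightarrow> norm (x n i) \<le> inverse (real (Suc n))"
      and big: "\<And>n. norm (\<Phi> (x n)) > norm (\<Phi> (\<lambda>_. 0)) + 1"
      by (metis not_le)
    \<comment> \<open>The entries of \<open>x n\<close> from index \<open>N\<close> on are
      arbitrary; setting them to 0 leaves the value of \<open>\<Phi>\<close> unchanged and gives
      convergence in the product topology.\<close>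
    define y where "y n i = (if i < N then x n i else 0)" for n i
    have "(\<lambda>n. y n i) \<longlonglongrightarrow> 0" for i
    proof (rule Lim_null_comparison[OF _ LIMSEQ_inverse_real_of_nat])
      show "\<forall>\<^sub>F n in sequentially. norm (y n i) \<le> inverse (real (Suc n))"
        using x by (auto simp: y_def)
    qed
    then have "y \<longlonglongrightarrow> (\<lambda>_. 0)" by (intro tendsto_fun_coordinatewise) 
    then have "(\<lambda>n. \<Phi> (y n)) \<longlonglongrightarrow> \<Phi> (\<lambda>_. 0)"
      using continuous_on_tendsto_compose[OF cont] by auto
    then have "(\<lambda>n. norm (\<Phi> (y n))) \<longlonglongrightarrow> norm (\<Phi> (\<lambda>_. 0))" by (rule tendsto_norm)
    then have ev: "\<forall>\<^sub>F n in sequentially. norm (\<Phi> (y n)) < norm (\<Phi> (\<lambda>_. 0)) + 1"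
      by (rule order_tendstoD) simp
    have eq: "\<Phi> (y n) = \<Phi> (x n)" for n by (rule mform_cong[OF m]) (simp add: y_def)
    have "\<forall>\<^sub>F n in sequentially. False"
      using ev
    proof (rule eventually_mono)
      show False if "norm (\<Phi> (y n)) < norm (\<Phi> (\<lambda>_. 0)) + 1" for n
        using that big[of n] eq[of n] by simp
    qed
    then show False by simp
  qed
  then obtain n where n: "\<And>x. (\<And>i. i < N \<Longrightarrow> norm (x i) \<le> inverse (real (Suc n))) \<Longrightarrow>
    norm (\<Phi> x) \<le> norm (\<Phi> (\<lambda>_. 0)) + 1" by blast
  show ?thesis
  proof (rule that)
    show "bform N ((norm (\<Phi> (\<lambda>_. 0)) + 1) * (1 / inverse (real (Suc n))) ^ N) \<Phi>"
      by (rule mform_imp_bform[OF m n]) auto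
  qed auto
qed

lemma bform_imp_continuous:
  assumes "bform N C \<Phi>"
  shows "continuous_on UNIV \<Phi>"
proof -
  have m: "mform N \<Phi>" and bound: "\<And>x. norm (\<Phi> x) \<le> C * (\<Prod>i<N. norm (x i))"
    using assms by (auto simp: bform_def)
  have "(\<Phi> \<longlongrightarrow> \<Phi> y) (at y)" for y
  proof -
    have coord: "((\<lambda>x. x i) \<longlongrightarrow> y i) (at y)" for i
      using continuous_on_tendsto_compose[OF continuous_on_product_coordinates tendsto_ident_at, of y UNIV i] by simp
    \<comment> \<open>Passing from \<open>y\<close> to \<open>x\<close> one coordinate at a time
      changes the value by that of \<open>\<Phi>\<close> at a tuple with entry
      \<open>x j - y j\<close>, which tends to 0, so the product bound applies.\<close>
    define h where "h j x i = (if i < j then x i else y i)" for j and x :: "nat \<Rightarrow> 'a" and i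
    have "((\<lambda>x. \<Phi> (h j x)) \<longlongrightarrow> \<Phi> y) (at y)" if "j \<le> N" for j
      using that
    proof (induction j)
      case 0
      have "h 0 x = y" for x by (simp add: h_def fun_eq_iff)
      then show ?case by simp
    next
      case (Suc j)
      define z where "z x = (h j x)(j := x j - y j)" for x
      have eq: "\<Phi> (h (Suc j) x) = \<Phi> (h j x) + \<Phi> (z x)" for x
      proof -
        have "(h j x)(j := x j) = h (Suc j) x" "(h j x)(j := y j) = h j x"
          by (auto simp: h_def fun_eq_iff)
        then show ?thesis using mform_diff[OF m, of j "h j x" "x j" "y j"] Suc.prems by (simp add: z_def)
      qed
      have "((\<lambda>x. z x i) \<longlongrightarrow> (if i = j then 0 else y i)) (at y)" for i
        using coord[of i] tendsto_diff[OF coord[of i] tendsto_const[of "y i"]]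
        by (cases "i < j") (auto simp: z_def h_def)
      then have "((\<lambda>x. C * (\<Prod>i<N. norm (z x i))) \<longlongrightarrow> C * (\<Prod>i<N. norm (if i = j then 0 else y i))) (at y)"
        by (intro tendsto_intros)
      moreover have "(\<Prod>i<N. norm (if i = j then 0 else y i)) = 0"
        using Suc.prems by (auto simp: prod_zero_iff)
      ultimately have "((\<lambda>x. C * (\<Prod>i<N. norm (z x i))) \<longlongrightarrow> 0) (at y)" by simp
      then have "((\<lambda>x. \<Phi> (z x)) \<longlongrightarrow> 0) (at y)"
        by (rule Lim_null_comparison[rotated]) (simp add: bound)
      from tendsto_add[OF Suc.IH this] show ?case unfolding eq using Suc.prems by simp
    qed
    from this[of N] show ?thesis
      using mform_cong[OF m, of "h N _"] by (simp add: h_def)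
  qed
  then show ?thesis by (simp add: continuous_on_def)
qed

lemma bform_imp_multilinear: "bform N C \<Phi> \<Longrightarrow> multilinear_form scale N \<Phi>"
  using bform_imp_continuous by (auto simp: multilinear_form_iff bform_def)

end

section \<open>Polarization\<close>

text \<open>Inclusion-exclusion: between a proper subset \<open>R\<close> and \<open>T\<close> there
  are as many sets of even as of odd size.\<close>

lemma sum_supersets_alternating:
  assumes "finite T" "R \<subseteq> T"
  shows "(\<Sum>S | S \<subseteq> T \<and> R \<subseteq> S. (-1) ^ (card T + card S)) = (if R = T then 1 else (0::'r::comm_ring_1))"
proof (cases "R = T")
  case True
  then have "{S. S \<subseteq> T \<and> R \<subseteq> S} = {T}" by auto
  then show ?thesis using True by (simp flip: mult_2)
next
  case False
  have "(\<Sum>S | S \<subseteq> T \<and> R \<subseteq> S. (-1) ^ card S) = (0::'r)"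
    using assms False by (intro sum_alternating_cancels) (auto simp: card_subsupersets_even_odd conj_assoc)
  then show ?thesis using False by (simp add: power_add sum_distrib_left[symmetric])
qed

context normed_space_over
begin

lemma mform_sum_all:
  fixes f :: "'i \<Rightarrow> 'a"
  assumes "mform N \<Phi>" "finite A"
  shows "\<Phi> (\<lambda>_. \<Sum>a\<in>A. f a) = (\<Sum>m\<in>{..<N} \<rightarrow>\<^sub>E A. \<Phi> (\<lambda>i. f (m i)))"
proof -
  define g where "g j m i = (if i < j then f (m i) else (\<Sum>a\<in>A. f a))" for j and m :: "nat \<Rightarrow> 'i" and i :: nat
  have "\<Phi> (\<lambda>_. \<Sum>a\<in>A. f a) = (\<Sum>m\<in>{..<j} \<rightarrow>\<^sub>E A. \<Phi> (g j m))" if "j \<le> N" for j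
    using that
  proof (induction j)
    case 0
    then show ?case by (simp add: g_def)
  next
    case (Suc j)
    have "(\<Sum>m\<in>{..<Suc j} \<rightarrow>\<^sub>E A. \<Phi> (g (Suc j) m)) =
        (\<Sum>(a, m)\<in>A \<times> ({..<j} \<rightarrow>\<^sub>E A). \<Phi> (g (Suc j) (m(j := a))))"
      unfolding lessThan_Suc PiE_insert_eq
      by (subst sum.reindex[OF inj_combinator]) (auto simp: case_prod_unfold)
    also have "\<dots> = (\<Sum>m\<in>{..<j} \<rightarrow>\<^sub>E A. \<Sum>a\<in>A. \<Phi> (g (Suc j) (m(j := a))))"
      by (subst sum.cartesian_product[symmetric]) (rule sum.swap)
    also have "\<dots> = (\<Sum>m\<in>{..<j} \<rightarrow>\<^sub>E A. \<Phi> (g j m))"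
    proof (rule sum.cong[OF refl])
      fix m
      have "g (Suc j) (m(j := a)) = (g j m)(j := f a)" for a
        by (auto simp: g_def fun_eq_iff)
      moreover have "(g j m)(j := (\<Sum>a\<in>A. f a)) = g j m" by (auto simp: g_def fun_eq_iff)
      ultimately show "(\<Sum>a\<in>A. \<Phi> (g (Suc j) (m(j := a)))) = \<Phi> (g j m)"
        using mform_sum[OF assms(1), of j "g j m" f A] Suc.prems by simp
    qed
    finally show ?case using Suc by simp
  qed
  from this[of N] have "\<Phi> (\<lambda>_. \<Sum>a\<in>A. f a) = (\<Sum>m\<in>{..<N} \<rightarrow>\<^sub>E A. \<Phi> (g N m))" by simp
  also have "\<dots> = (\<Sum>m\<in>{..<N} \<rightarrow>\<^sub>E A. \<Phi> (\<lambda>i. f (m i)))"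
    by (intro sum.cong refl mform_cong[OF assms(1)]) (simp add: g_def)
  finally show ?thesis .
qed

text \<open>The polarization formula over subset sums. It makes sense for every function
  \<open>P\<close>, and so can be used to recognize a polynomial before any form for it is
  known.\<close>

definition polar :: "nat \<Rightarrow> ('a \<Rightarrow> 'k) \<Rightarrow> (nat \<Rightarrow> 'a) \<Rightarrow> 'k"
  where "polar N P x = (\<Sum>S\<in>Pow {..<N}. (- 1) ^ (N + card S) / fact N * P (\<Sum>i\<in>S. x i))"

text \<open>Expanding the subset sums gives one term for each map of the index set to itself. The
  alternating signs cancel all maps that are not onto, and the remaining ones are the
  permutations.\<close>

lemma polarization:
  assumes m: "mform N \<Psi>"
  shows "polar N (\<lambda>x. \<Psi> (\<lambda>_. x)) x = (\<Sum>\<sigma> | \<sigma> permutes {..<N}. \<Psi> (x \<circ> \<sigma>)) / fact N"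
proof -
  let ?T = "{..<N}"
  have "fact N * polar N (\<lambda>x. \<Psi> (\<lambda>_. x)) x = (\<Sum>S\<in>Pow ?T. (- 1) ^ (N + card S) * \<Psi> (\<lambda>_. \<Sum>i\<in>S. x i))"
    by (simp add: polar_def sum_distrib_left field_simps)
  also have "\<dots> = (\<Sum>S\<in>Pow ?T. \<Sum>m | m \<in> ?T \<rightarrow>\<^sub>E ?T \<and> m ` ?T \<subseteq> S. (- 1) ^ (N + card S) * \<Psi> (\<lambda>i. x (m i)))"
  proof (rule sum.cong[OF refl])
    fix S assume S: "S \<in> Pow ?T"
    then have "finite S" by (auto intro: finite_subset)
    moreover have "{m \<in> ?T \<rightarrow>\<^sub>E ?T. m ` ?T \<subseteq> S} = ?T \<rightarrow>\<^sub>E S"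
      using S by (auto simp: PiE_def Pi_def)
    ultimately show "(- 1) ^ (N + card S) * \<Psi> (\<lambda>_. \<Sum>i\<in>S. x i) =
        (\<Sum>m | m \<in> ?T \<rightarrow>\<^sub>E ?T \<and> m ` ?T \<subseteq> S. (- 1) ^ (N + card S) * \<Psi> (\<lambda>i. x (m i)))"
      by (simp add: mform_sum_all[OF m] sum_distrib_left)
  qed
  also have "\<dots> = (\<Sum>m\<in>?T \<rightarrow>\<^sub>E ?T. \<Sum>S | S \<in> Pow ?T \<and> m ` ?T \<subseteq> S. (- 1) ^ (N + card S) * \<Psi> (\<lambda>i. x (m i)))"
    by (rule sum.swap_restrict) (auto intro: finite_PiE)
  also have "\<dots> = (\<Sum>m\<in>?T \<rightarrow>\<^sub>E ?T. if m ` ?T = ?T then \<Psi> (\<lambda>i. x (m i)) else 0)"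
  proof (rule sum.cong[OF refl])
    fix m assume "m \<in> ?T \<rightarrow>\<^sub>E ?T"
    then have "m ` ?T \<subseteq> ?T" by auto
    from sum_supersets_alternating[OF _ this, where 'r = 'k]
    show "(\<Sum>S | S \<in> Pow ?T \<and> m ` ?T \<subseteq> S. (- 1) ^ (N + card S) * \<Psi> (\<lambda>i. x (m i))) =
        (if m ` ?T = ?T then \<Psi> (\<lambda>i. x (m i)) else 0)"
      by (simp add: sum_distrib_right[symmetric])
  qed
  also have "\<dots> = (\<Sum>m | m \<in> ?T \<rightarrow>\<^sub>E ?T \<and> m ` ?T = ?T. \<Psi> (\<lambda>i. x (m i)))"
    by (rule sum.inter_filter[symmetric]) (auto intro: finite_PiE)
  also have "\<dots> = (\<Sum>\<sigma> | \<sigma> permutes ?T. \<Psi> (x \<circ> \<sigma>))"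
  \<comment> \<open>A permutation is the identity off \<open>{..<N}\<close>, whereas a function in
    the extensional product is \<open>undefined\<close> there; the two witnesses translate.\<close>
  proof (rule sum.reindex_bij_witness[where i = "\<lambda>\<sigma>. restrict \<sigma> ?T" and j = "\<lambda>m i. if i \<in> ?T then m i else i"])
    fix m assume "m \<in> {m \<in> ?T \<rightarrow>\<^sub>E ?T. m ` ?T = ?T}"
    then have m': "m \<in> ?T \<rightarrow>\<^sub>E ?T" "m ` ?T = ?T" by auto
    show "restrict (\<lambda>i. if i \<in> ?T then m i else i) ?T = m"
      using m'(1) by (auto simp: fun_eq_iff PiE_iff extensional_def)
    have "bij_betw m ?T ?T"
      using m'(2) by (auto simp: bij_betw_def intro: eq_card_imp_inj_on)
    then show "(\<lambda>i. if i \<in> ?T then m i else i) \<in> {\<sigma>. \<sigma> permutes ?T}"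
      by (auto intro!: bij_imp_permutes simp: bij_betw_def inj_on_def)
    show "\<Psi> (x \<circ> (\<lambda>i. if i \<in> ?T then m i else i)) = \<Psi> (\<lambda>i. x (m i))"
      by (rule mform_cong[OF m]) simp
  next
    fix \<sigma> assume "\<sigma> \<in> {\<sigma>. \<sigma> permutes ?T}"
    then have \<sigma>: "\<sigma> permutes ?T" by simp
    show "(\<lambda>i. if i \<in> ?T then restrict \<sigma> ?T i else i) = \<sigma>"
      using permutes_not_in[OF \<sigma>] by (auto simp: fun_eq_iff)
    show "restrict \<sigma> ?T \<in> {m \<in> ?T \<rightarrow>\<^sub>E ?T. m ` ?T = ?T}"
      using permutes_image[OF \<sigma>] by (auto simp: image_restrict_eq)
  qed
  finally show ?thesis by (simp add: field_simps)
qed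

lemma mform_linear_combination:
  assumes "\<And>j. j \<in> J \<Longrightarrow> mform N (\<Phi> j)"
  shows "mform N (\<lambda>x. \<Sum>j\<in>J. a j * \<Phi> j x)"
  unfolding mform_def
proof (intro conjI allI impI)
  show "(\<Sum>j\<in>J. a j * \<Phi> j x) = (\<Sum>j\<in>J. a j * \<Phi> j y)" if "\<forall>i<N. x i = y i" for x y
    by (rule sum.cong[OF refl]) (metis assms mform_cong that)
  show "(\<Sum>j\<in>J. a j * \<Phi> j (x(i := u + v))) = (\<Sum>j\<in>J. a j * \<Phi> j (x(i := u))) + (\<Sum>j\<in>J. a j * \<Phi> j (x(i := v)))"
    if "i < N" for x i u v
    unfolding sum.distrib[symmetric] 
    by (rule sum.cong[OF refl]) (simp only: mform_add[OF assms that] distrib_left)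
  show "(\<Sum>j\<in>J. a j * \<Phi> j (x(i := scale c u))) = c * (\<Sum>j\<in>J. a j * \<Phi> j (x(i := u)))"
    if "i < N" for x i c u
    unfolding sum_distrib_left
    by (rule sum.cong[OF refl]) (simp only: mform_scale[OF assms that] mult.left_commute)
qed

lemma multilinear_linear_combination:
  assumes "\<And>j. j \<in> J \<Longrightarrow> multilinear_form scale N (\<Phi> j)"
  shows "multilinear_form scale N (\<lambda>x. \<Sum>j\<in>J. a j * \<Phi> j x)"
  using assms mform_linear_combination[of J N \<Phi> a]
  by (auto simp: multilinear_form_iff intro!: continuous_intros)

lemma fun_upd_comp_permutes:
  assumes "\<sigma> permutes A"
  shows "x(i := u) \<circ> \<sigma> = (x \<circ> \<sigma>)(inv \<sigma> i := u)"
  using permutes_bij[OF assms] by (auto simp: fun_eq_iff bij_inv_eq_iff bij_def)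

lemma multilinear_permute:
  assumes m: "multilinear_form scale N \<Psi>" and \<sigma>: "\<sigma> permutes {..<N}"
  shows "multilinear_form scale N (\<lambda>x. \<Psi> (x \<circ> \<sigma>))"
  unfolding multilinear_form_iff
proof
  have "mform N \<Psi>" and cont: "continuous_on UNIV \<Psi>" using m by (auto simp: multilinear_form_iff)
  note mD = mformD[OF this(1)]
  have lt: "\<sigma> i < N" "inv \<sigma> i < N" if "i < N" for i
    using that permutes_in_image[OF \<sigma>] permutes_in_image[OF permutes_inv[OF \<sigma>]] by auto
  show "mform N (\<lambda>x. \<Psi> (x \<circ> \<sigma>))"
    unfolding mform_def
  proof (intro conjI allI impI)
    show "\<Psi> (x \<circ> \<sigma>) = \<Psi> (y \<circ> \<sigma>)" if "\<forall>i<N. x i = y i" for x y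
      using that lt by (intro mD(1)) auto
  qed (simp_all only: fun_upd_comp_permutes[OF \<sigma>] mD(2,3) lt)
  show "continuous_on UNIV (\<lambda>x. \<Psi> (x \<circ> \<sigma>))"
  proof (rule continuous_on_compose2[OF cont])
    show "continuous_on UNIV (\<lambda>x. x \<circ> \<sigma>)"
      by (intro continuous_on_coordinatewise_then_product) (auto intro: continuous_intros)
  qed simp
qed

lemma hom_polysE:
  assumes "P \<in> hom_polys scale N"
  obtains \<Psi> where "multilinear_form scale N \<Psi>" "P = (\<lambda>x. \<Psi> (\<lambda>_. x))"
  using assms by (auto simp: hom_polys_def fun_eq_iff)

lemma hom_polysI:
  assumes "multilinear_form scale N \<Psi>"
  shows "(\<lambda>x. \<Psi> (\<lambda>_. x)) \<in> hom_polys scale N"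
  using assms by (auto simp: hom_polys_def)

lemma polar_symmetric_form:
  assumes "P \<in> hom_polys scale N"
  shows "multilinear_form scale N (polar N P)" "symmetric_form N (polar N P)" "polar N P (\<lambda>_. x) = P x"
proof -
  obtain \<Psi> where \<Psi>: "multilinear_form scale N \<Psi>" "P = (\<lambda>x. \<Psi> (\<lambda>_. x))"
    using hom_polysE[OF assms] .
  have m: "mform N \<Psi>" using \<Psi>(1) by (simp add: multilinear_form_iff)
  have eq: "polar N P = (\<lambda>x. \<Sum>\<sigma> | \<sigma> permutes {..<N}. (1 / fact N) * \<Psi> (x \<circ> \<sigma>))"
    unfolding \<Psi>(2) using polarization[OF m] by (auto simp: sum_divide_distrib fun_eq_iff)
  show "multilinear_form scale N (polar N P)"
    unfolding eq using multilinear_permute[OF \<Psi>(1)] by (intro multilinear_linear_combination) auto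
  show "symmetric_form N (polar N P)"
    unfolding symmetric_form_def
  proof (intro allI impI)
    fix \<tau> x assume \<tau>: "\<tau> permutes {..<N}"
    show "polar N P (x \<circ> \<tau>) = polar N P x"
      unfolding eq
      by (rule sum.reindex_bij_witness[where i = "\<lambda>\<sigma>. inv \<tau> \<circ> \<sigma>" and j = "\<lambda>\<sigma>. \<tau> \<circ> \<sigma>"])
        (auto intro: permutes_compose permutes_inv \<tau>
          simp: o_assoc permutes_inv_o[OF \<tau>])
  qed
  have "(\<lambda>_::nat. x) \<circ> \<sigma> = (\<lambda>_. x)" for \<sigma> :: "nat \<Rightarrow> nat" by auto
  then show "polar N P (\<lambda>_. x) = P x"
    unfolding eq by (simp add: \<Psi>(2) card_permutations[where n=N] o_def)
qed

text \<open>Polarization recovers a symmetric form from its diagonal, so the description in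
  \<open>associated_form\<close> has exactly one solution.\<close>

lemma associated_form_eq_polar:
  assumes P: "P \<in> hom_polys scale N"
  shows "associated_form scale N P = polar N P"
  unfolding associated_form_def
proof (rule the_equality)
  show "multilinear_form scale N (polar N P) \<and> symmetric_form N (polar N P) \<and> (\<forall>x. P x = polar N P (\<lambda>_. x))"
    using polar_symmetric_form[OF P] by simp
  fix \<Phi> assume \<Phi>: "multilinear_form scale N \<Phi> \<and> symmetric_form N \<Phi> \<and> (\<forall>x. P x = \<Phi> (\<lambda>_. x))"
  then have "P = (\<lambda>x. \<Phi> (\<lambda>_. x))" and m: "mform N \<Phi>" by (auto simp: multilinear_form_iff)
  have "\<Phi> x = polar N P x" for x
  proof -
    have "polar N P x = (\<Sum>\<sigma> | \<sigma> permutes {..<N}. \<Phi> x) / fact N"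
      unfolding \<open>P = _\<close> polarization[OF m] using \<Phi> by (simp add: symmetric_form_def)
    also have "\<dots> = \<Phi> x" by (simp add: card_permutations[where n=N])
    finally show ?thesis by simp
  qed
  then show "\<Phi> = polar N P" by auto
qed

lemma hom_polys_diff:
  assumes "P \<in> hom_polys scale N" "Q \<in> hom_polys scale N"
  shows "(\<lambda>x. P x - Q x) \<in> hom_polys scale N"
proof -
  obtain \<Phi> where \<Phi>: "multilinear_form scale N \<Phi>" "P = (\<lambda>x. \<Phi> (\<lambda>_. x))"
    using hom_polysE[OF assms(1)] .
  obtain \<Psi> where \<Psi>: "multilinear_form scale N \<Psi>" "Q = (\<lambda>x. \<Psi> (\<lambda>_. x))"
    using hom_polysE[OF assms(2)] .
  have "multilinear_form scale N (\<lambda>x. \<Sum>j\<in>(UNIV::bool set). (if j then 1 else - 1) * (if j then \<Phi> else \<Psi>) x)"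
    using \<Phi>(1) \<Psi>(1) by (intro multilinear_linear_combination) auto
  then have "multilinear_form scale N (\<lambda>x. \<Phi> x - \<Psi> x)" by (simp add: UNIV_bool)
  from hom_polysI[OF this] show ?thesis by (simp add: \<Phi>(2) \<Psi>(2))
qed

lemma hom_poly_scale:
  assumes "P \<in> hom_polys scale N"
  shows "P (scale c x) = c ^ N * P x"
  using assms by (elim hom_polysE) (auto simp: multilinear_form_iff mform_scale_diag)

lemma hom_poly_bound:
  assumes "P \<in> hom_polys scale N"
  obtains C where "C \<ge> 0" "\<And>x. norm (P x) \<le> C * norm x ^ N"
proof -
  obtain \<Phi> where \<Phi>: "multilinear_form scale N \<Phi>" "P = (\<lambda>x. \<Phi> (\<lambda>_. x))"
    using hom_polysE[OF assms] .
  obtain C where C: "C \<ge> 0" "bform N C \<Phi>" using multilinear_imp_bform[OF \<Phi>(1)] .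
  show ?thesis
  proof (rule that[OF C(1)])
    fix x
    have "norm (\<Phi> (\<lambda>_. x)) \<le> C * (\<Prod>i<N. norm x)" using C(2) unfolding bform_def by blast
    then show "norm (P x) \<le> C * norm x ^ N" by (simp add: \<Phi>(2))
  qed
qed

lemma hom_poly_bdd_above:
  assumes "P \<in> hom_polys scale N"
  shows "bdd_above ((\<lambda>x. norm (P x)) ` cball 0 1)"
proof -
  obtain C where C: "C \<ge> 0" "\<And>x. norm (P x) \<le> C * norm x ^ N"
    using hom_poly_bound[OF assms] by metis
  show ?thesis
  proof (rule bdd_aboveI2)
    fix x :: 'a assume "x \<in> cball 0 1"
    then have "C * norm x ^ N \<le> C * 1" using C(1) by (intro mult_left_mono power_le_one) auto
    then show "norm (P x) \<le> C" using C(2)[of x] by simp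
  qed
qed

lemma hom_poly_sgn:
  assumes "P \<in> hom_polys scale N"
  shows "P x = of_real (norm x) ^ N * P (sgn x)"
proof -
  have "P x = P (scale (of_real (norm x)) (sgn x))"
    by (cases "x = 0") (simp_all add: scale_of_real sgn_div_norm)
  then show ?thesis by (simp add: hom_poly_scale[OF assms])
qed

lemma norm_hom_poly_le:
  assumes "P \<in> hom_polys scale N"
  shows "norm (P x) \<le> sup_norm_on (cball 0 1) P * norm x ^ N"
proof -
  have "norm (P x) = norm x ^ N * norm (P (sgn x))"
    by (subst hom_poly_sgn[OF assms]) (simp add: norm_mult norm_power)
  also have "\<dots> \<le> norm x ^ N * sup_norm_on (cball 0 1) P"
    unfolding sup_norm_on_def
    by (intro mult_left_mono cSUP_upper hom_poly_bdd_above[OF assms]) (auto simp: norm_sgn)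
  finally show ?thesis by (simp add: mult.commute)
qed

text \<open>
  A function that satisfies all linear relations between point evaluations on \<open>hom_polys\<close>
  is a polynomial: multilinearity of \<^const>\<open>polar\<close> is such a relation.
\<close>

lemma hom_polys_if_relations:
  assumes rel: "\<And>w. (\<And>P. P \<in> hom_polys scale N \<Longrightarrow> (\<Sum>(c, x)\<leftarrow>w. c * P x) = 0) \<Longrightarrow>
      (\<Sum>(c, x)\<leftarrow>w. c * \<rho> x) = 0"
    and bound: "\<And>x. norm (\<rho> x) \<le> C * norm x ^ N" and C: "C \<ge> 0"
  shows "\<rho> \<in> hom_polys scale N"
proof -
  \<comment> \<open>Relations come as lists; the ones needed below are sums indexed by pairs of a
    subset and a number.\<close>
  have relS: "(\<Sum>i\<in>I. c i * \<rho> (y i)) = 0"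
    if fin: "finite I" and P0: "\<And>P. P \<in> hom_polys scale N \<Longrightarrow> (\<Sum>i\<in>I. c i * P (y i)) = 0"
    for I :: "(nat set \<times> nat) set" and c y
  proof -
    obtain js where js: "distinct js" "set js = I" using finite_distinct_list[OF fin] by blast
    have "(\<Sum>(c, x)\<leftarrow>map (\<lambda>i. (c i, y i)) js. c * Q x) = (\<Sum>i\<in>I. c i * Q (y i))" for Q
      using js by (simp add: o_def sum_list_distinct_conv_sum_set)
    then show ?thesis using rel[of "map (\<lambda>i. (c i, y i)) js"] P0 by simp
  qed
  define s where "s S = ((- 1) ^ (N + card S) / fact N :: 'k)" for S :: "nat set"
  \<comment> \<open>Multilinearity in a slot is a linear relation between at most three polarized
    values, with coefficients \<open>1, - 1, - 1\<close> for additivity and \<open>1, - c, 0\<close>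
    for homogeneity. The number in the index selects one of the three tuples.\<close>
  have comb: "a * polar N \<rho> x + b * polar N \<rho> y + c * polar N \<rho> z = 0"
    if P0: "\<And>P. P \<in> hom_polys scale N \<Longrightarrow> a * polar N P x + b * polar N P y + c * polar N P z = 0" for a b c x y z
  proof -
    define I where "I = Pow {..<N} \<times> {..<3::nat}"
    define d where "d = (\<lambda>(S, k::nat). s S * (if k = 0 then a else if k = 1 then b else c))"
    define u where "u = (\<lambda>(S, k::nat). \<Sum>i\<in>S. (if k = 0 then x i else if k = 1 then y i else z i))"
    have eq: "(\<Sum>i\<in>I. d i * Q (u i)) = a * polar N Q x + b * polar N Q y + c * polar N Q z" for Q
    proof -
      have "(\<Sum>i\<in>I. d i * Q (u i)) = (\<Sum>S\<in>Pow {..<N}. \<Sum>k<3. d (S, k) * Q (u (S, k)))"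
        unfolding I_def by (simp add: sum.cartesian_product)
      also have "\<dots> = a * polar N Q x + b * polar N Q y + c * polar N Q z"
        by (simp add: polar_def d_def u_def s_def sum_distrib_left sum.distrib numeral_3_eq_3 algebra_simps)
      finally show ?thesis .
    qed
    have "(\<Sum>i\<in>I. d i * \<rho> (u i)) = 0"
      using P0 by (intro relS) (auto simp: eq, simp add: I_def)
    then show ?thesis by (simp add: eq)
  qed
  have m: "mform N (polar N P)" if "P \<in> hom_polys scale N" for P
    using polar_symmetric_form(1)[OF that] by (simp add: multilinear_form_iff)
  have "mform N (polar N \<rho>)"
    unfolding mform_def
  proof (intro conjI allI impI)
    show "polar N \<rho> x = polar N \<rho> y" if "\<forall>i<N. x i = y i" for x y
    proof -
      have "(\<Sum>i\<in>S. x i) = (\<Sum>i\<in>S. y i)" if "S \<in> Pow {..<N}" for S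
        using \<open>\<forall>i<N. x i = y i\<close> that by (intro sum.cong) auto
      then show ?thesis by (simp add: polar_def)
    qed
    fix x i assume i: "i < N"
    show "polar N \<rho> (x(i := u + v)) = polar N \<rho> (x(i := u)) + polar N \<rho> (x(i := v))" for u v
      using comb[of 1 "x(i := u + v)" "- 1" "x(i := u)" "- 1" "x(i := v)"] mform_add[OF m i, of _ x u v]
      by (simp add: algebra_simps)
    show "polar N \<rho> (x(i := scale c u)) = c * polar N \<rho> (x(i := u))" for c u
      using comb[of 1 "x(i := scale c u)" "- c" "x(i := u)" 0 x] mform_scale[OF m i, of _ x c u]
      by (simp add: algebra_simps)
  qed
  \<comment> \<open>A subset sum of at most \<open>N\<close> vectors of the unit ball has norm at
    most \<open>N\<close>, whence \<open>C * real N ^ N\<close> for each summand.\<close>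
  moreover define K where "K = (\<Sum>S\<in>Pow {..<N}. norm (s S) * (C * real N ^ N))"
  have "norm (polar N \<rho> x) \<le> K" if x: "\<And>i. i < N \<Longrightarrow> norm (x i) \<le> 1" for x
      unfolding polar_def s_def[symmetric] K_def
    proof (rule sum_norm_le)
      fix S assume S: "S \<in> Pow {..<N}"
      have "norm (\<Sum>i\<in>S. x i) \<le> (\<Sum>i\<in>S. 1)" using x S by (intro sum_norm_le) auto
      also have "\<dots> \<le> real N" using S card_mono[of "{..<N}" S] by simp
      finally have "C * norm (\<Sum>i\<in>S. x i) ^ N \<le> C * real N ^ N"
        using C by (intro mult_left_mono power_mono) auto
      then have "norm (\<rho> (\<Sum>i\<in>S. x i)) \<le> C * real N ^ N" using bound order_trans by blast
      then show "norm (s S * \<rho> (\<Sum>i\<in>S. x i)) \<le> norm (s S) * (C * real N ^ N)"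
        by (simp add: norm_mult mult_left_mono)
    qed
  moreover have "K \<ge> 0" unfolding K_def using C by (intro sum_nonneg) auto
  ultimately have "bform N (K * (1 / 1) ^ N) (polar N \<rho>)"
    by (intro mform_imp_bform) auto
  then have "multilinear_form scale N (polar N \<rho>)" by (rule bform_imp_multilinear)
  moreover have "polar N \<rho> (\<lambda>_. x) = \<rho> x" for x
  proof -
    \<comment> \<open>The extra index \<open>({}, 1)\<close> contributes \<open>- Q x\<close>; the
      others give the polarization on the diagonal.\<close>
    define I where "I = insert ({}, 1) (Pow {..<N} \<times> {0::nat})"
    define d where "d = (\<lambda>(S, k::nat). if k = 0 then s S else - 1)"
    define u where "u = (\<lambda>(S::nat set, k::nat). if k = 0 then (\<Sum>i\<in>S. x) else x)"
    have eq: "(\<Sum>i\<in>I. d i * Q (u i)) = polar N Q (\<lambda>_. x) - Q x" for Q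
    proof -
      have "(\<Sum>i\<in>I. d i * Q (u i)) = - Q x + (\<Sum>i\<in>Pow {..<N} \<times> {0}. d i * Q (u i))"
        unfolding I_def by (subst sum.insert) (auto simp: d_def u_def)
      also have "(\<Sum>i\<in>Pow {..<N} \<times> {0}. d i * Q (u i)) = polar N Q (\<lambda>_. x)"
      proof -
        have "(\<Sum>i\<in>Pow {..<N} \<times> {0}. d i * Q (u i)) = (\<Sum>S\<in>Pow {..<N}. \<Sum>k\<in>{0}. d (S, k) * Q (u (S, k)))"
          unfolding sum.cartesian_product by (simp only: case_prod_unfold prod.collapse)
        then show ?thesis by (simp add: polar_def d_def u_def s_def)
      qed
      finally show ?thesis by simp
    qed
    have "(\<Sum>i\<in>I. d i * \<rho> (u i)) = 0"
      using polar_symmetric_form(3) by (intro relS) (auto simp: eq, simp add: I_def)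
    then show ?thesis by (simp add: eq)
  qed
  ultimately show ?thesis using hom_polysI[of N "polar N \<rho>"] by simp
qed

end

section \<open>Point evaluations of polynomials\<close>

text \<open>Functions on polynomials with pointwise operations are the real vector space to which
  the Bishop-Phelps argument is applied.\<close>

instantiation "fun" :: (type, real_vector) real_vector
begin

definition scaleR_fun_def: "r *\<^sub>R f = (\<lambda>x. r *\<^sub>R f x)"

instance
  by standard (auto simp: scaleR_fun_def fun_eq_iff algebra_simps)

end

lemma scaleR_fun_apply [simp]: "(r *\<^sub>R f) x = r *\<^sub>R f x"
  by (simp add: scaleR_fun_def)

context normed_space_over
begin

text \<open>
  A list of pairs of scalars and points stands for a combination of point evaluations on
  \<open>hom_polys\<close>, an element of the symmetric tensor product. Its real part determines it,
  because \<open>hom_polys\<close> is closed under multiplication by scalars.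
\<close>

definition evl :: "('k \<times> 'a) list \<Rightarrow> ('a \<Rightarrow> 'k) \<Rightarrow> 'k"
  where "evl w P = (\<Sum>(c, x)\<leftarrow>w. c * P x)"

definition cost :: "nat \<Rightarrow> ('k \<times> 'a) list \<Rightarrow> real"
  where "cost N w = (\<Sum>(c, x)\<leftarrow>w. norm c * norm x ^ N)"

text \<open>The value 0 outside \<open>hom_polys\<close> makes equality of these functions mean
  equality on polynomials, so that different lists for the same tensor are identified.\<close>

definition evl_re :: "nat \<Rightarrow> ('k \<times> 'a) list \<Rightarrow> ('a \<Rightarrow> 'k) \<Rightarrow> real"
  where "evl_re N w = (\<lambda>P. if P \<in> hom_polys scale N then re (evl w P) else 0)"

definition mult_list :: "'k \<Rightarrow> ('k \<times> 'a) list \<Rightarrow> ('k \<times> 'a) list"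
  where "mult_list a w = map (\<lambda>(c, x). (a * c, x)) w"

lemma evl_simps [simp]:
  "evl [] P = 0" "evl ((c, x) # w) P = c * P x + evl w P"
  "evl (w @ w') P = evl w P + evl w' P"
  "evl (mult_list a w) P = a * evl w P"
proof -
  show "evl (mult_list a w) P = a * evl w P"
    by (induction w) (auto simp: evl_def mult_list_def algebra_simps)
qed (simp_all add: evl_def)

lemma cost_simps [simp]:
  "cost N [] = 0" "cost N ((c, x) # w) = norm c * norm x ^ N + cost N w"
  "cost N (w @ w') = cost N w + cost N w'"
  "cost N (mult_list a w) = norm a * cost N w"
proof -
  show "cost N (mult_list a w) = norm a * cost N w"
    by (induction w) (auto simp: cost_def mult_list_def algebra_simps norm_mult)
qed (simp_all add: cost_def)

lemma cost_nonneg: "0 \<le> cost N w"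
  by (induction w) auto

lemma evl_diff: "evl w (\<lambda>x. P x - Q x) = evl w P - evl w Q"
  by (induction w) (auto simp: algebra_simps)

lemma norm_evl_le:
  assumes "\<And>x. norm (P x) \<le> C * norm x ^ N"
  shows "norm (evl w P) \<le> C * cost N w"
proof (induction w)
  case (Cons a w)
  obtain c x where a: "a = (c, x)" by fastforce
  have "norm (c * P x + evl w P) \<le> norm c * norm (P x) + norm (evl w P)"
    by (metis norm_mult norm_triangle_ineq)
  also have "\<dots> \<le> norm c * (C * norm x ^ N) + C * cost N w"
    using assms Cons by (intro add_mono mult_left_mono) auto
  finally show ?case by (simp add: a algebra_simps)
qed simp

lemma hom_polys_mult:
  assumes "P \<in> hom_polys scale N"
  shows "(\<lambda>x. a * P x) \<in> hom_polys scale N"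
proof -
  obtain \<Phi> where \<Phi>: "multilinear_form scale N \<Phi>" "P = (\<lambda>x. \<Phi> (\<lambda>_. x))"
    using hom_polysE[OF assms] .
  have "multilinear_form scale N (\<lambda>x. \<Sum>j\<in>{()}. a * \<Phi> x)"
    using \<Phi>(1) by (intro multilinear_linear_combination)
  from hom_polysI[OF this] show ?thesis by (simp add: \<Phi>(2))
qed

lemma evl_mult_poly: "evl w (\<lambda>x. a * P x) = a * evl w P"
  by (induction w) (auto simp: algebra_simps)

lemma evl_eq_if_evl_re_eq:
  assumes "evl_re N w = evl_re N w'" "P \<in> hom_polys scale N"
  shows "evl w P = evl w' P"
proof (rule eq_re)
  fix c
  have "evl_re N w (\<lambda>x. c * P x) = evl_re N w' (\<lambda>x. c * P x)" by (simp add: assms(1))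
  then show "re (c * evl w P) = re (c * evl w' P)"
    using hom_polys_mult[OF assms(2)] by (simp add: evl_re_def evl_mult_poly)
qed

lemma evl_re_append: "evl_re N (w @ w') = evl_re N w + evl_re N w'"
  by (auto simp: evl_re_def fun_eq_iff re_add)

lemma evl_re_mult: "evl_re N (mult_list (of_real r) w) = r *\<^sub>R evl_re N w"
  by (auto simp: evl_re_def fun_eq_iff re_of_real_mult)

lemma evl_re_Nil: "evl_re N [] = 0"
  by (auto simp: evl_re_def fun_eq_iff)

lemma subspace_evl_re: "real_vector.subspace (range (evl_re N))"
  unfolding real_vector.subspace_def
  by (auto simp: evl_re_append[symmetric] evl_re_mult[symmetric] intro!: range_eqI[where x = "[]"] evl_re_Nil[symmetric])

text \<open>The projective seminorm on symmetric tensors. A functional bounded by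
  \<open>\<epsilon>\<close> times it will turn out to be a polynomial bounded by
  \<open>\<epsilon>\<close> on the unit ball.\<close>

definition proj_norm :: "nat \<Rightarrow> (('a \<Rightarrow> 'k) \<Rightarrow> real) \<Rightarrow> real"
  where "proj_norm N \<phi> = (INF w\<in>{w. evl_re N w = \<phi>}. cost N w)"

lemma proj_norm_le: "evl_re N w = \<phi> \<Longrightarrow> proj_norm N \<phi> \<le> cost N w"
  unfolding proj_norm_def by (intro cINF_lower bdd_belowI2[of _ 0] cost_nonneg) auto

lemma proj_norm_less:
  assumes "\<phi> \<in> range (evl_re N)" "proj_norm N \<phi> < r"
  obtains w where "evl_re N w = \<phi>" "cost N w < r"
proof -
  have "{w. evl_re N w = \<phi>} \<noteq> {}" using assms(1) by auto
  moreover have "bdd_below (cost N ` {w. evl_re N w = \<phi>})"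
    using cost_nonneg by (rule bdd_belowI2)
  ultimately show ?thesis
    using cINF_less_iff[of _ "cost N" r] assms(2) that by (auto simp: proj_norm_def)
qed

lemma proj_norm_nonneg: "\<phi> \<in> range (evl_re N) \<Longrightarrow> 0 \<le> proj_norm N \<phi>"
  unfolding proj_norm_def by (intro cINF_greatest cost_nonneg) auto

lemma seminorm_on_proj_norm: "seminorm_on (range (evl_re N)) (proj_norm N)"
  unfolding seminorm_on_def
proof (intro conjI ballI allI)
  let ?V = "range (evl_re N)"
  fix \<phi> assume \<phi>: "\<phi> \<in> ?V"
  show "0 \<le> proj_norm N \<phi>" using proj_norm_nonneg[OF \<phi>] .
  show "proj_norm N (\<phi> + \<psi>) \<le> proj_norm N \<phi> + proj_norm N \<psi>" if \<psi>: "\<psi> \<in> ?V" for \<psi>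
  proof (rule field_le_epsilon)
    fix e :: real assume "e > 0"
    obtain w where w: "evl_re N w = \<phi>" "cost N w < proj_norm N \<phi> + e / 2"
      using proj_norm_less[OF \<phi>, of "proj_norm N \<phi> + e / 2"] \<open>e > 0\<close> by auto
    obtain w' where w': "evl_re N w' = \<psi>" "cost N w' < proj_norm N \<psi> + e / 2"
      using proj_norm_less[OF \<psi>, of "proj_norm N \<psi> + e / 2"] \<open>e > 0\<close> by auto
    have "proj_norm N (\<phi> + \<psi>) \<le> cost N (w @ w')"
      by (rule proj_norm_le) (simp add: evl_re_append w w')
    then show "proj_norm N (\<phi> + \<psi>) \<le> proj_norm N \<phi> + proj_norm N \<psi> + e" using w w' by simp
  qed
  have le: "proj_norm N (r *\<^sub>R \<psi>) \<le> \<bar>r\<bar> * proj_norm N \<psi>" if \<psi>: "\<psi> \<in> ?V" for r \<psi>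
  proof (rule field_le_epsilon)
    fix e :: real assume "e > 0"
    then have "e / (\<bar>r\<bar> + 1) > 0" by simp
    then obtain w where w: "evl_re N w = \<psi>" "cost N w < proj_norm N \<psi> + e / (\<bar>r\<bar> + 1)"
      using proj_norm_less[OF \<psi>, of "proj_norm N \<psi> + e / (\<bar>r\<bar> + 1)"] by auto
    have "proj_norm N (r *\<^sub>R \<psi>) \<le> cost N (mult_list (of_real r) w)"
      by (rule proj_norm_le) (simp add: evl_re_mult w)
    also have "\<dots> \<le> \<bar>r\<bar> * (proj_norm N \<psi> + e / (\<bar>r\<bar> + 1))"
      using w by (simp add: mult_left_mono)
    also have "\<dots> \<le> \<bar>r\<bar> * proj_norm N \<psi> + e"
      using \<open>e > 0\<close> by (simp add: field_simps)
    finally show "proj_norm N (r *\<^sub>R \<psi>) \<le> \<bar>r\<bar> * proj_norm N \<psi> + e" .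
  qed
  show "proj_norm N (r *\<^sub>R \<phi>) = \<bar>r\<bar> * proj_norm N \<phi>" for r
  proof (cases "r = 0")
    case True
    then show ?thesis using le[OF \<phi>, of 0] proj_norm_nonneg[of 0 N] real_vector.subspace_0[OF subspace_evl_re] by simp
  next
    case False
    have "proj_norm N ((1 / r) *\<^sub>R (r *\<^sub>R \<phi>)) \<le> \<bar>1 / r\<bar> * proj_norm N (r *\<^sub>R \<phi>)"
      using real_vector.subspace_scale[OF subspace_evl_re \<phi>] by (rule le)
    then have "\<bar>r\<bar> * proj_norm N \<phi> \<le> proj_norm N (r *\<^sub>R \<phi>)" using False by (simp add: field_simps)
    with le[OF \<phi>, of r] show ?thesis by simp
  qed
qed

text \<open>The functional to be perturbed is evaluation at \<open>P\<close> on combinations of cost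
  at most 1. The perturbation \<open>R\<close> is itself evaluation at a polynomial
  \<open>\<rho>\<close> of norm at most \<open>\<epsilon>\<close>, and \<open>Q\<close> is
  \<open>P - \<rho>\<close>. Consecutive near-maximizers differ by combinations \<open>d m\<close>
  of geometrically small cost.\<close>

theorem bishop_phelps_hom_polys:
  assumes P: "P \<in> hom_polys scale N" and \<epsilon>: "\<epsilon> > 0"
  obtains Q w d where "Q \<in> hom_polys scale N"
    and "\<And>x. norm (P x - Q x) \<le> \<epsilon> * norm x ^ N"
    and "\<And>m. cost N (w m) \<le> 1"
    and "\<And>m x. norm x \<le> 1 \<Longrightarrow> norm (Q x) \<le> re (evl (w m) Q) + 4 * (1/2) ^ m"
    and "\<And>m. cost N (d m) \<le> (1 / \<epsilon> + 1) * (1/2) ^ m"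
    and "\<And>m R. R \<in> hom_polys scale N \<Longrightarrow> evl (w (Suc m)) R = evl (w m) R + evl (d m) R"
proof -
  let ?V = "range (evl_re N)"
  let ?B = "evl_re N ` {w. cost N w \<le> 1}"
  let ?f = "\<lambda>\<phi>::('a \<Rightarrow> 'k) \<Rightarrow> real. \<phi> P"
  obtain C where C: "C \<ge> 0" "\<And>x. norm (P x) \<le> C * norm x ^ N" using hom_poly_bound[OF P] by metis
  have lin: "linear_on_subspace ?V ?f" by (simp add: linear_on_subspace_def)
  have bnd: "?f v \<le> C" if v: "v \<in> ?B" for v
  proof -
    obtain w where w: "v = evl_re N w" "cost N w \<le> 1" using v by auto
    have "re (evl w P) \<le> norm (evl w P)" by (rule re_le)
    also have "\<dots> \<le> C * cost N w" by (rule norm_evl_le[OF C(2)])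
    also have "\<dots> \<le> C * 1" using C(1) w(2) by (intro mult_left_mono)
    finally show ?thesis using P by (simp add: w evl_re_def)
  qed
  have ne: "?B \<noteq> {}" by (auto intro!: exI[of _ "[]"])
  have cvx: "convex ?B"
  proof (rule convexI)
    fix x y and u v :: real assume "x \<in> ?B" "y \<in> ?B" and uv: "0 \<le> u" "0 \<le> v" "u + v = 1"
    then obtain w w' where w: "x = evl_re N w" "cost N w \<le> 1" "y = evl_re N w'" "cost N w' \<le> 1"
      by auto
    have "u *\<^sub>R x + v *\<^sub>R y = evl_re N (mult_list (of_real u) w @ mult_list (of_real v) w')"
      by (simp add: w evl_re_append evl_re_mult)
    moreover have "cost N (mult_list (of_real u) w @ mult_list (of_real v) w') \<le> 1"
      using w(2,4) uv convex_bound_le[of "cost N w" 1 "cost N w'" u v] by simp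
    ultimately show "u *\<^sub>R x + v *\<^sub>R y \<in> ?B" by blast
  qed
  have sub: "?B \<subseteq> ?V" by auto
  have "\<exists>\<omega> R. (\<forall>m. \<omega> m \<in> ?B) \<and> linear_on_subspace ?V R \<and>
      (\<forall>x\<in>?V. R x \<le> \<epsilon> * proj_norm N x) \<and>
      (\<forall>m n. m \<le> n \<longrightarrow> \<epsilon> * proj_norm N (\<omega> n - \<omega> m) \<le> (1/2) ^ m) \<and>
      (\<forall>m. \<forall>v\<in>?B. v P - R v \<le> \<omega> m P - R (\<omega> m) + 4 * (1/2) ^ m)"
  proof (rule bishop_phelps_sequence[where V = ?V and B = ?B and f = ?f and \<pi> = "proj_norm N" and \<epsilon> = \<epsilon> and M = C])
    show "v P \<le> C" if "v \<in> ?B" for v using that by (rule bnd)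
    fix \<omega> R
    assume 1: "\<And>m. \<omega> m \<in> ?B" "linear_on_subspace ?V R" "\<And>x. x \<in> ?V \<Longrightarrow> R x \<le> \<epsilon> * proj_norm N x"
      "\<And>m n. m \<le> n \<Longrightarrow> \<epsilon> * proj_norm N (\<omega> n - \<omega> m) \<le> (1/2) ^ m"
      "\<And>m v. v \<in> ?B \<Longrightarrow> v P - R v \<le> \<omega> m P - R (\<omega> m) + 4 * (1/2) ^ m"
    show "\<exists>\<omega> R. (\<forall>m. \<omega> m \<in> ?B) \<and> linear_on_subspace ?V R \<and>
      (\<forall>x\<in>?V. R x \<le> \<epsilon> * proj_norm N x) \<and>
      (\<forall>m n. m \<le> n \<longrightarrow> \<epsilon> * proj_norm N (\<omega> n - \<omega> m) \<le> (1/2) ^ m) \<and>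
      (\<forall>m. \<forall>v\<in>?B. v P - R v \<le> \<omega> m P - R (\<omega> m) + 4 * (1/2) ^ m)"
      by (rule exI[of _ \<omega>], rule exI[of _ R], intro conjI allI ballI impI) (erule 1 | rule 1)+
  qed (fact subspace_evl_re lin seminorm_on_proj_norm sub ne \<epsilon> cvx)+
  then obtain \<omega> R where 1: "\<forall>m. \<omega> m \<in> ?B" and R: "linear_on_subspace ?V R"
    and 2: "\<forall>x\<in>?V. R x \<le> \<epsilon> * proj_norm N x"
    and 3: "\<forall>m n. m \<le> n \<longrightarrow> \<epsilon> * proj_norm N (\<omega> n - \<omega> m) \<le> (1/2) ^ m"
    and 4: "\<forall>m. \<forall>v\<in>?B. v P - R v \<le> \<omega> m P - R (\<omega> m) + 4 * (1/2) ^ m"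
    by (elim exE conjE) (rule that)
  note \<omega> = 1[rule_format] and R_le = 2[rule_format] and \<omega>_diff = 3[rule_format] and \<omega>_max = 4[rule_format]
  obtain w where w: "\<And>m. \<omega> m = evl_re N (w m)" and cost_w: "\<And>m. cost N (w m) \<le> 1"
    using \<omega> by (simp add: image_iff) metis
  note RD = linear_on_subspaceD[OF R subspace_evl_re]
  have R_append: "R (evl_re N (v @ v')) = R (evl_re N v) + R (evl_re N v')" for v v'
    by (simp add: evl_re_append RD)
  \<comment> \<open>At a fixed point \<open>x\<close> the functional \<open>R\<close> is real linear
    in the coefficient, hence given by multiplication with a scalar, which becomes
    \<open>\<rho> x\<close>.\<close>
  have "\<exists>r. \<forall>c. R (evl_re N [(c, x)]) = re (c * r)" for x
  proof -
    have "linear (\<lambda>c. R (evl_re N [(c, x)]))"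
    proof
      show "R (evl_re N [(b + c, x)]) = R (evl_re N [(b, x)]) + R (evl_re N [(c, x)])" for b c
      proof -
        have "evl_re N [(b + c, x)] = evl_re N ([(b, x)] @ [(c, x)])"
          by (auto simp: evl_re_def fun_eq_iff algebra_simps)
        then show ?thesis by (simp only: R_append)
      qed
      show "R (evl_re N [(r *\<^sub>R c, x)]) = r *\<^sub>R R (evl_re N [(c, x)])" for r c
      proof -
        have "evl_re N [(r *\<^sub>R c, x)] = r *\<^sub>R evl_re N [(c, x)]"
          by (auto simp: evl_re_def fun_eq_iff re_scaleR)
        then show ?thesis by (simp add: RD)
      qed
    qed
    from linear_eq_re_mult[OF this] show ?thesis by metis
  qed
  then obtain \<rho> where \<rho>: "\<And>c x. R (evl_re N [(c, x)]) = re (c * \<rho> x)" by metis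
  have R_Nil: "R (evl_re N []) = 0" by (simp only: evl_re_Nil RD)
  have R_eq: "R (evl_re N v) = re (evl v \<rho>)" for v
  proof (induction v)
    case (Cons a v)
    obtain c x where a: "a = (c, x)" by fastforce
    show ?case using R_append[of "[(c, x)]" v] Cons \<rho>[of c x] by (simp add: a re_add)
  qed (simp add: R_Nil)
  have \<rho>_bound: "norm (\<rho> x) \<le> \<epsilon> * norm x ^ N" for x
  proof (rule norm_le_re)
    fix c :: 'k assume c: "norm c = 1"
    have "re (c * \<rho> x) \<le> \<epsilon> * proj_norm N (evl_re N [(c, x)])"
      unfolding \<rho>[symmetric] by (intro R_le) simp
    also have "\<dots> \<le> \<epsilon> * cost N [(c, x)]"
      using \<epsilon> by (intro mult_left_mono proj_norm_le) auto
    finally show "re (c * \<rho> x) \<le> \<epsilon> * norm x ^ N" using c by simp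
  qed
  have \<rho>_poly: "\<rho> \<in> hom_polys scale N"
  proof (rule hom_polys_if_relations[OF _ \<rho>_bound])
    fix v assume v: "\<And>P. P \<in> hom_polys scale N \<Longrightarrow> (\<Sum>(c, x)\<leftarrow>v. c * P x) = 0"
    \<comment> \<open>A combination that vanishes on all polynomials is the zero vector of
      \<open>range (evl_re N)\<close>, and so are its multiples by scalars; \<open>R\<close>
      vanishes on all of them.\<close>
    have "evl v \<rho> = 0"
    proof (rule eq_re)
      fix c
      have "evl_re N (mult_list c v) = evl_re N []"
        using v by (auto simp: evl_re_def fun_eq_iff) (simp add: evl_def)
      then have "R (evl_re N (mult_list c v)) = 0" by (simp only: R_Nil)
      then show "re (c * evl v \<rho>) = re (c * 0)" by (simp add: R_eq)
    qed
    then show "(\<Sum>(c, x)\<leftarrow>v. c * \<rho> x) = 0" by (simp add: evl_def)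
  qed (use \<epsilon> in auto)
  define Q where "Q x = P x - \<rho> x" for x
  have Q: "Q \<in> hom_polys scale N" unfolding Q_def using P \<rho>_poly by (rule hom_polys_diff)
  have fR: "?f (evl_re N v) - R (evl_re N v) = re (evl v Q)" for v
    unfolding Q_def by (simp add: R_eq evl_diff re_diff) (simp add: evl_re_def P)
  \<comment> \<open>The part \<open>1 / \<epsilon>\<close> comes from the distance bound
    \<open>(1/2) ^ m / \<epsilon>\<close>; the added 1 pays for an actual list, as the infimum in
    \<open>proj_norm\<close> need not be attained.\<close>
  have "\<exists>d. cost N d \<le> (1 / \<epsilon> + 1) * (1/2) ^ m \<and> evl_re N d = \<omega> (Suc m) - \<omega> m" for m
  proof -
    have "\<omega> (Suc m) - \<omega> m \<in> ?V" using real_vector.subspace_diff[OF subspace_evl_re] by (simp add: w)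
    moreover have "proj_norm N (\<omega> (Suc m) - \<omega> m) \<le> (1 / \<epsilon>) * (1/2) ^ m"
      using \<omega>_diff[of m "Suc m"] \<epsilon> by (simp add: field_simps)
    then have "proj_norm N (\<omega> (Suc m) - \<omega> m) < (1 / \<epsilon> + 1) * (1/2) ^ m"
      by (simp add: algebra_simps) (smt (verit) zero_less_power zero_less_divide_iff)
    ultimately show ?thesis using proj_norm_less less_imp_le by metis
  qed
  then obtain d where cost_d: "\<And>m. cost N (d m) \<le> (1 / \<epsilon> + 1) * (1/2) ^ m"
    and d: "\<And>m. evl_re N (d m) = \<omega> (Suc m) - \<omega> m" by metis
  show ?thesis
  proof (rule that[OF Q])
    show "norm (P x - Q x) \<le> \<epsilon> * norm x ^ N" for x using \<rho>_bound by (simp add: Q_def)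
    show "cost N (w m) \<le> 1" for m by (rule cost_w)
    show "norm (Q x) \<le> re (evl (w m) Q) + 4 * (1/2) ^ m" if "norm x \<le> 1" for m x
    proof (rule norm_le_re)
      fix c :: 'k assume c: "norm c = 1"
      have "evl_re N [(c, x)] \<in> ?B" using c that by (auto intro!: imageI power_le_one)
      from \<omega>_max[OF this, of m] show "re (c * Q x) \<le> re (evl (w m) Q) + 4 * (1/2) ^ m"
        unfolding w fR by simp
    qed
    show "cost N (d m) \<le> (1 / \<epsilon> + 1) * (1/2) ^ m" for m by (rule cost_d)
    show "evl (w (Suc m)) R = evl (w m) R + evl (d m) R" if "R \<in> hom_polys scale N" for m R
    proof -
      have "evl_re N (w (Suc m)) = evl_re N (w m @ d m)" by (simp add: evl_re_append d w)
      from evl_eq_if_evl_re_eq[OF this that] show ?thesis by simp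
    qed
  qed
qed

end

section \<open>Traces of nuclear operators on the dual\<close>

lemma compact_insert_limit:
  fixes f :: "nat \<Rightarrow> 'b::topological_space"
  assumes "f \<longlonglongrightarrow> l"
  shows "compact (insert l (range f))"
  unfolding compact_eq_Heine_Borel
proof (intro allI impI, elim conjE)
  fix C assume C: "\<forall>U\<in>C. open U" "insert l (range f) \<subseteq> \<Union>C"
  then obtain U where U: "U \<in> C" "l \<in> U" by blast
  then obtain n0 where n0: "\<And>n. n \<ge> n0 \<Longrightarrow> f n \<in> U"
    using topological_tendstoD[OF assms, of U] C(1) by (auto simp: eventually_sequentially)
  have "\<forall>n. \<exists>W\<in>C. f n \<in> W" using C(2) by blast
  then obtain W where W: "\<And>n. W n \<in> C" "\<And>n. f n \<in> W n" by metis
  have "insert l (range f) \<subseteq> \<Union>(insert U (W ` {..<n0}))"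
    using U n0 W(2) by (auto simp: not_less) (metis lessThan_iff not_less)
  then show "\<exists>C'\<subseteq>C. finite C' \<and> insert l (range f) \<subseteq> \<Union>C'"
    using U(1) W(1) by (intro exI[of _ "insert U (W ` {..<n0})"]) auto
qed

text \<open>Dividing by the square roots of the tails keeps the series convergent, by telescoping.
  This serves to rescale the vectors of a nuclear representation to a null sequence, hence into a
  compact set, at finite cost.\<close>

lemma summable_weights:
  fixes s :: "nat \<Rightarrow> real"
  assumes s: "summable s" and nonneg: "\<And>k. 0 \<le> s k"
  obtains b where "\<And>k. b k > 0" "b \<longlonglongrightarrow> 0" "summable (\<lambda>k. s k / b k)"
proof -
  \<comment> \<open>The geometric term keeps all tails positive.\<close>
  define t where "t k = s k + (1/2) ^ k" for k
  have t: "summable t" unfolding t_def by (intro summable_add s summable_geometric) simp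
  have t_pos: "0 < t k" for k using nonneg[of k] by (simp add: t_def add_nonneg_pos)
  define r where "r k = (\<Sum>j. t (j + k))" for k
  have r_pos: "0 < r k" for k
    unfolding r_def using t t_pos by (intro suminf_pos) (auto simp: summable_iff_shift)
  have r_step: "r k = t k + r (Suc k)" for k
    unfolding r_def using suminf_split_head[of "\<lambda>j. t (j + k)"] t by (simp add: summable_iff_shift)
  have "r \<longlonglongrightarrow> 0"
    unfolding r_def using suminf_exist_split2[OF t] by simp
  then have lim: "(\<lambda>k. sqrt (r k)) \<longlonglongrightarrow> 0" using tendsto_real_sqrt by fastforce
  have "summable (\<lambda>k. s k / sqrt (r k))"
  proof (rule summable_comparison_test')
    show "summable (\<lambda>k. 2 * (sqrt (r k) - sqrt (r (Suc k))))"
      by (intro summable_mult telescope_summable'[OF lim])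
    show "norm (s k / sqrt (r k)) \<le> 2 * (sqrt (r k) - sqrt (r (Suc k)))" if "k \<ge> 0" for k
    proof -
      have le: "sqrt (r (Suc k)) \<le> sqrt (r k)" using r_step[of k] t_pos[of k] by simp
      have "s k \<le> t k" by (simp add: t_def)
      also have "t k = (sqrt (r k) - sqrt (r (Suc k))) * (sqrt (r k) + sqrt (r (Suc k)))"
        using r_pos[of k] r_pos[of "Suc k"] r_step[of k] by (simp add: algebra_simps)
      also have "\<dots> \<le> (sqrt (r k) - sqrt (r (Suc k))) * (2 * sqrt (r k))"
        using le by (intro mult_left_mono) auto
      finally show ?thesis using r_pos[of k] nonneg[of k] by (simp add: field_simps)
    qed
  qed
  then show ?thesis using that[of "\<lambda>k. sqrt (r k)"] lim r_pos by simp
qed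

context normed_space_over
begin

text \<open>By the induction hypothesis the coefficients of a convergent sequence in
  \<open>span D\<close> converge, so \<open>span D\<close> is closed and the new vector
  \<open>y\<close> has a positive distance \<open>\<delta>\<close> from it. Operators of finite rank
  thereby get bounded coordinate functionals.\<close>

lemma coordinates_bounded:
  assumes "finite C" "independent C"
  shows "\<exists>M\<ge>0. \<forall>c. \<forall>y\<in>C. norm (c y) \<le> M * norm (\<Sum>y\<in>C. scale (c y) y)"
  using assms
proof (induction C rule: finite_induct)
  case (insert y D)
  then have y: "y \<notin> span D" and "independent D" by (auto simp: independent_insert)
  then obtain M where M: "M \<ge> 0" "\<And>c z. z \<in> D \<Longrightarrow> norm (c z) \<le> M * norm (\<Sum>z\<in>D. scale (c z) z)"
    using insert.IH by blast
  let ?L = "\<lambda>c. \<Sum>z\<in>D. scale (c z) z"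
  have L_scale: "?L (\<lambda>z. a * c z) = scale a (?L c)" for a c
    by (simp add: scale_sum_right)
  have "\<exists>\<delta>>0. \<forall>c. \<delta> \<le> norm (y + ?L c)"
  proof (rule ccontr)
    assume "\<not> ?thesis"
    then have "\<exists>c. norm (y + ?L c) < inverse (real (Suc n))" for n
      by (metis inverse_positive_iff_positive not_le of_nat_0_less_iff zero_less_Suc)
    then obtain c where c: "\<And>n. norm (y + ?L (c n)) < inverse (real (Suc n))" by metis
    have lim: "(\<lambda>n. y + ?L (c n)) \<longlonglongrightarrow> 0"
      by (rule Lim_null_comparison[OF _ LIMSEQ_inverse_real_of_nat]) (use c in \<open>auto intro: less_imp_le always_eventually\<close>)
    then have "Cauchy (\<lambda>n. y + ?L (c n))" by (rule LIMSEQ_imp_Cauchy)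
    have "convergent (\<lambda>n. c n z)" if z: "z \<in> D" for z
    proof (rule Cauchy_convergent, rule CauchyI)
      fix e :: real assume "e > 0"
      then have "e / (M + 1) > 0" using M(1) by simp
      then obtain n0 where n0: "\<And>m n. m \<ge> n0 \<Longrightarrow> n \<ge> n0 \<Longrightarrow> norm ((y + ?L (c m)) - (y + ?L (c n))) < e / (M + 1)"
        using CauchyD[OF \<open>Cauchy (\<lambda>n. y + ?L (c n))\<close>] by blast
      show "\<exists>n0. \<forall>m\<ge>n0. \<forall>n\<ge>n0. norm (c m z - c n z) < e"
      proof (intro exI allI impI)
        fix m n assume mn: "m \<ge> n0" "n \<ge> n0"
        have "norm (c m z - c n z) \<le> M * norm (?L (\<lambda>z. c m z - c n z))" by (rule M(2)[OF z])
        also have "?L (\<lambda>z. c m z - c n z) = (y + ?L (c m)) - (y + ?L (c n))"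
          by (simp add: scale_left_diff_distrib sum_subtractf)
        also have "M * norm \<dots> \<le> M * (e / (M + 1))"
          using n0[OF mn] M(1) by (intro mult_left_mono) auto
        also have "\<dots> < e" using \<open>e > 0\<close> M(1) by (simp add: field_simps)
        finally show "norm (c m z - c n z) < e" .
      qed
    qed
    then obtain l where l: "\<And>z. z \<in> D \<Longrightarrow> (\<lambda>n. c n z) \<longlonglongrightarrow> l z"
      unfolding convergent_def by metis
    have tendsto_scale: "(\<lambda>n. scale (a n) z) \<longlonglongrightarrow> scale b z" if "a \<longlonglongrightarrow> b" for a b z
    proof (rule Lim_transform_bound[where g = "\<lambda>n. norm (a n - b) * norm z", THEN LIM_zero_cancel])
      show "\<forall>\<^sub>F n in sequentially. norm (scale (a n) z - scale b z) \<le> norm (norm (a n - b) * norm z)"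
        by (simp add: scale_left_diff_distrib[symmetric] norm_scale)
      show "(\<lambda>n. norm (a n - b) * norm z) \<longlonglongrightarrow> 0"
        using tendsto_mult_right[OF tendsto_norm_zero[OF LIM_zero[OF that]], of "norm z"] by simp
    qed
    have "(\<lambda>n. y + ?L (c n)) \<longlonglongrightarrow> y + ?L l"
      by (intro tendsto_intros tendsto_scale l)
    then have "y + ?L l = 0" using lim LIMSEQ_unique by blast
    then have "y = - ?L l" by (simp add: add_eq_0_iff2)
    moreover have "- ?L l \<in> span D" by (intro span_neg span_sum span_scale span_base)
    ultimately show False using y by simp
  qed
  then obtain \<delta> where \<delta>: "\<delta> > 0" "\<And>c. \<delta> \<le> norm (y + ?L c)" by blast
  \<comment> \<open>The coefficient of \<open>y\<close> is at most \<open>norm x / \<delta>\<close>.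
    The others are bounded through \<open>x\<close> minus its \<open>y\<close> term, which has norm
    at most \<open>(1 + norm y / \<delta>) * norm x\<close>.\<close>
  define M' where "M' = 1 / \<delta> + M * (1 + norm y / \<delta>)"
  have "norm (c z) \<le> M' * norm (\<Sum>z\<in>insert y D. scale (c z) z)" if z: "z \<in> insert y D" for c z
  proof -
    define x where "x = (\<Sum>z\<in>insert y D. scale (c z) z)"
    have x: "x = scale (c y) y + ?L c" using insert.hyps by (simp add: x_def)
    have cy: "norm (c y) \<le> (1 / \<delta>) * norm x"
    proof (cases "c y = 0")
      case False
      have "x = scale (c y) (y + ?L (\<lambda>z. (1 / c y) * c z))"
        unfolding L_scale x using False by (simp add: scale_right_distrib)
      then have "norm x = norm (c y) * norm (y + ?L (\<lambda>z. (1 / c y) * c z))" by (simp only: norm_scale)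
      also have "norm (c y) * \<delta> \<le> \<dots>" using \<delta>(2) by (intro mult_left_mono) auto
      finally show ?thesis using \<delta>(1) by (simp add: field_simps)
    qed (use \<delta> in simp)
    have "norm (?L c) = norm (x - scale (c y) y)" by (simp add: x)
    also have "\<dots> \<le> norm x + norm (c y) * norm y" by (metis norm_scale norm_triangle_ineq4)
    also have "\<dots> \<le> norm x + (1 / \<delta>) * norm x * norm y"
      using cy by (intro add_left_mono mult_right_mono) auto
    finally have L: "norm (?L c) \<le> (1 + norm y / \<delta>) * norm x" by (simp add: algebra_simps)
    have "norm (c z) \<le> M' * norm x"
    proof (cases "z = y")
      case True
      have "0 \<le> M * (1 + norm y / \<delta>) * norm x" using M \<delta> by simp
      then show ?thesis using cy True by (simp add: M'_def distrib_right)
    next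
      case False
      then have "norm (c z) \<le> M * norm (?L c)" using z M(2) by auto
      also have "\<dots> \<le> M * ((1 + norm y / \<delta>) * norm x)" using L M(1) by (intro mult_left_mono)
      also have "\<dots> \<le> M' * norm x" using \<delta>(1) by (simp add: M'_def algebra_simps)
      finally show ?thesis .
    qed
    then show ?thesis by (simp add: x_def)
  qed
  moreover have "M' \<ge> 0" using M \<delta> by (simp add: M'_def)
  ultimately show ?case by blast
qed auto

end

section \<open>The dual as a normed space and its bounded functionals\<close>

lemma dual_scale_apply [simp]: "blinfun_apply (dual_scale c f) x = c * blinfun_apply f x"
  by (simp add: dual_scale_def)

lemma norm_dual_scale:
  fixes c :: "'k::real_or_complex" and f :: "'a::real_normed_vector \<Rightarrow>\<^sub>L 'k"
  shows "norm (dual_scale c f) = norm c * norm f"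
proof (rule antisym)
  have le: "norm (dual_scale c f) \<le> norm c * norm f" for c :: 'k and f :: "'a \<Rightarrow>\<^sub>L 'k"
  proof (rule norm_blinfun_bound)
    show "norm (blinfun_apply (dual_scale c f) x) \<le> norm c * norm f * norm x" for x
      using mult_left_mono[OF norm_blinfun[of f x] norm_ge_zero[of c]] by (simp add: norm_mult mult.assoc)
  qed simp
  show "norm (dual_scale c f) \<le> norm c * norm f" by (rule le)
  show "norm c * norm f \<le> norm (dual_scale c f)"
  proof (cases "c = 0")
    case False
    have "dual_scale (inverse c) (dual_scale c f) = f"
      using False by (intro blinfun_eqI) (simp add: mult.assoc[symmetric])
    then show ?thesis using le[of "inverse c" "dual_scale c f"] False by (simp add: norm_divide field_simps)
  qed simp
qed

lemma normed_space_over_dual: "normed_space_over dual_scale"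
proof
qed (auto intro!: blinfun_eqI simp: norm_dual_scale plus_blinfun.rep_eq scaleR_blinfun.rep_eq algebra_simps scaleR_conv_of_real)

context normed_space_over
begin

interpretation dual: normed_space_over "dual_scale :: 'k \<Rightarrow> ('a \<Rightarrow>\<^sub>L 'k) \<Rightarrow> ('a \<Rightarrow>\<^sub>L 'k)"
  by (rule normed_space_over_dual)

lemma dualD: "f \<in> dual scale \<Longrightarrow> blinfun_apply f (scale c x) = c * blinfun_apply f x"
  by (simp add: dual_def)

lemma dual_closed:
  "0 \<in> dual scale"
  "f \<in> dual scale \<Longrightarrow> g \<in> dual scale \<Longrightarrow> f + g \<in> dual scale"
  "f \<in> dual scale \<Longrightarrow> g \<in> dual scale \<Longrightarrow> f - g \<in> dual scale"
  "f \<in> dual scale \<Longrightarrow> dual_scale c f \<in> dual scale"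
  by (auto simp: dual_def plus_blinfun.rep_eq minus_blinfun.rep_eq zero_blinfun.rep_eq algebra_simps)

lemma dual_sum: "(\<And>j. j \<in> J \<Longrightarrow> F j \<in> dual scale) \<Longrightarrow> sum F J \<in> dual scale"
  by (induction J rule: infinite_finite_induct) (auto intro: dual_closed)

text \<open>Only the values on \<open>dual scale\<close> are constrained, as the dual is a subset of
  a type. The explicit bound \<open>a\<close> is the weight that enters sums of nuclear
  norms.\<close>

definition bounded_functional :: "real \<Rightarrow> (('a \<Rightarrow>\<^sub>L 'k) \<Rightarrow> 'k) \<Rightarrow> bool"
  where "bounded_functional a \<alpha> \<longleftrightarrow>
    (\<forall>f\<in>dual scale. \<forall>g\<in>dual scale. \<alpha> (f + g) = \<alpha> f + \<alpha> g) \<and>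
    (\<forall>c. \<forall>f\<in>dual scale. \<alpha> (dual_scale c f) = c * \<alpha> f) \<and>
    (\<forall>f\<in>dual scale. norm (\<alpha> f) \<le> a * norm f)"

lemma bounded_functionalD:
  assumes "bounded_functional a \<alpha>"
  shows "f \<in> dual scale \<Longrightarrow> g \<in> dual scale \<Longrightarrow> \<alpha> (f + g) = \<alpha> f + \<alpha> g"
    and "f \<in> dual scale \<Longrightarrow> \<alpha> (dual_scale c f) = c * \<alpha> f"
    and "f \<in> dual scale \<Longrightarrow> norm (\<alpha> f) \<le> a * norm f"
    and "\<alpha> 0 = 0"
    and "f \<in> dual scale \<Longrightarrow> g \<in> dual scale \<Longrightarrow> \<alpha> (f - g) = \<alpha> f - \<alpha> g"
proof -
  have add: "f \<in> dual scale \<Longrightarrow> g \<in> dual scale \<Longrightarrow> \<alpha> (f + g) = \<alpha> f + \<alpha> g" for f g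
    using assms unfolding bounded_functional_def by blast
  then show "f \<in> dual scale \<Longrightarrow> g \<in> dual scale \<Longrightarrow> \<alpha> (f + g) = \<alpha> f + \<alpha> g" .
  show "f \<in> dual scale \<Longrightarrow> \<alpha> (dual_scale c f) = c * \<alpha> f"
    and "f \<in> dual scale \<Longrightarrow> norm (\<alpha> f) \<le> a * norm f"
    using assms unfolding bounded_functional_def by blast+
  show "\<alpha> 0 = 0" using add[OF dual_closed(1) dual_closed(1)] by simp
  show "f \<in> dual scale \<Longrightarrow> g \<in> dual scale \<Longrightarrow> \<alpha> (f - g) = \<alpha> f - \<alpha> g"
    using add[OF dual_closed(3)[of f g], of g] by simp
qed

lemma bounded_functional_sum:
  assumes "bounded_functional a \<alpha>" "\<And>j. j \<in> J \<Longrightarrow> F j \<in> dual scale"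
  shows "\<alpha> (sum F J) = (\<Sum>j\<in>J. \<alpha> (F j))"
  using assms(2)
  by (induction J rule: infinite_finite_induct)
    (auto simp: bounded_functionalD[OF assms(1)] dual_sum)

text \<open>
  The approximation property makes the trace of a nuclear operator on the dual independent of
  the representation \<open>\<Sum>k. \<alpha> k \<otimes> e k\<close> of the operator.
\<close>

theorem nuclear_trace_unique:
  assumes AP: "approximation_property dual_scale (dual scale)"
    and \<alpha>: "\<And>k. bounded_functional (a k) (\<alpha> k)" and a: "\<And>k. 0 \<le> a k"
    and e: "\<And>k. e k \<in> dual scale" and sum_a: "summable (\<lambda>k. a k * norm (e k))"
    and \<beta>: "\<And>k. bounded_functional (b k) (\<beta> k)" and b: "\<And>k. 0 \<le> b k"
    and h: "\<And>k. h k \<in> dual scale" and sum_b: "summable (\<lambda>k. b k * norm (h k))"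
    and eq: "\<And>f v. f \<in> dual scale \<Longrightarrow>
      (\<Sum>k. \<alpha> k f * blinfun_apply (e k) v) = (\<Sum>k. \<beta> k f * blinfun_apply (h k) v)"
  shows "(\<Sum>k. \<alpha> k (e k)) = (\<Sum>k. \<beta> k (h k))"
proof -
  let ?E = "dual scale"
  \<comment> \<open>For \<open>T\<close> of finite rank, with basis \<open>C\<close> of its range
    and coordinates \<open>\<tau> y\<close>, the trace is the sum over \<open>y\<close> of
    \<open>\<tau> y\<close> at the value of the nuclear operator at \<open>y\<close>. This involves
    the operator and not its representation.\<close>
  have fin_rank: "(\<Sum>k. \<alpha> k (T (e k))) = (\<Sum>k. \<beta> k (T (h k)))"
    if T: "bounded_linear_on ?E dual_scale dual_scale T" "T ` ?E \<subseteq> ?E"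
      and B: "finite B" "T ` ?E \<subseteq> dual.span B" for T and B :: "('a \<Rightarrow>\<^sub>L 'k) set"
  proof -
    have T_add: "T (f + g) = T f + T g" if "f \<in> ?E" "g \<in> ?E" for f g
      using T(1) that by (simp add: bounded_linear_on_def)
    have T_scale: "T (dual_scale c f) = dual_scale c (T f)" if "f \<in> ?E" for f c
      using T(1) that by (simp add: bounded_linear_on_def)
    obtain C0 where C0: "\<And>f. f \<in> ?E \<Longrightarrow> norm (T f) \<le> C0 * norm f"
      using T(1) unfolding bounded_linear_on_def by blast
    obtain C where C: "C \<subseteq> T ` ?E" "dual.independent C" "T ` ?E \<subseteq> dual.span C"
      using dual.basis_exists[of "T ` ?E"] by metis
    have finC: "finite C"
      using dual.independent_span_bound[OF B(1) C(2)] C(1) B(2) by blast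
    have CE: "y \<in> ?E" if "y \<in> C" for y using that C(1) T(2) by blast
    define \<tau> where "\<tau> y f = dual.representation C (T f) y" for y f
    have T_eq: "T f = (\<Sum>y\<in>C. dual_scale (\<tau> y f) y)" if "f \<in> ?E" for f
      unfolding \<tau>_def using that C(3)
      by (subst dual.sum_representation_eq[OF C(2) _ finC order_refl]) auto
    obtain M where M: "M \<ge> 0" "\<And>c y. y \<in> C \<Longrightarrow> norm (c y) \<le> M * norm (\<Sum>y\<in>C. dual_scale (c y) y)"
      using dual.coordinates_bounded[OF finC C(2)] by blast
    have \<tau>: "bounded_functional (M * C0) (\<tau> y)" if y: "y \<in> C" for y
      unfolding bounded_functional_def
    proof (intro conjI ballI allI)
      show "\<tau> y (f + g) = \<tau> y f + \<tau> y g" if "f \<in> ?E" "g \<in> ?E" for f g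
        unfolding \<tau>_def T_add[OF that] using that C(3) by (subst dual.representation_add[OF C(2)]) auto
      show "\<tau> y (dual_scale c f) = c * \<tau> y f" if "f \<in> ?E" for c f
        unfolding \<tau>_def T_scale[OF that] using that C(3) by (subst dual.representation_scale[OF C(2)]) auto
      show "norm (\<tau> y f) \<le> M * C0 * norm f" if "f \<in> ?E" for f
      proof -
        have "norm (\<tau> y f) \<le> M * norm (T f)"
          using M(2)[OF y, of "\<lambda>y. \<tau> y f"] T_eq[OF that] by simp
        also have "\<dots> \<le> M * (C0 * norm f)" using C0[OF that] M(1) by (rule mult_left_mono)
        finally show ?thesis by (simp add: mult.assoc)
      qed
    qed
    have nuclear_sum: "summable (\<lambda>k. dual_scale (\<gamma> k y) (g k))" "summable (\<lambda>k. \<gamma> k y * \<tau> y (g k))"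
      if \<gamma>: "\<And>k. bounded_functional (c k) (\<gamma> k)" and c: "\<And>k. 0 \<le> c k"
        and g: "\<And>k. g k \<in> ?E" and sum_c: "summable (\<lambda>k. c k * norm (g k))" and y: "y \<in> C"
      for \<gamma> c g y
    proof -
      have bound: "norm (\<gamma> k y) * norm (g k) \<le> norm y * (c k * norm (g k))" for k
        using bounded_functionalD(3)[OF \<gamma> CE[OF y], of k] mult_right_mono[of "norm (\<gamma> k y)" "c k * norm y" "norm (g k)"]
        by (simp add: algebra_simps)
      show "summable (\<lambda>k. dual_scale (\<gamma> k y) (g k))"
        using bound by (intro summable_comparison_test'[OF summable_mult[OF sum_c]]) (auto simp: norm_dual_scale)
      show "summable (\<lambda>k. \<gamma> k y * \<tau> y (g k))"
      proof (rule summable_comparison_test'[OF summable_mult[OF sum_c, of "\<bar>M * C0\<bar> * norm y"]])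
        fix k
        have "norm (\<tau> y (g k)) \<le> \<bar>M * C0\<bar> * norm (g k)"
          using bounded_functionalD(3)[OF \<tau>[OF y] g, of k] by (meson abs_ge_self mult_right_mono norm_ge_zero order_trans)
        then have "norm (\<gamma> k y) * norm (\<tau> y (g k)) \<le> norm (\<gamma> k y) * (\<bar>M * C0\<bar> * norm (g k))"
          by (intro mult_left_mono) auto
        also have "\<dots> = \<bar>M * C0\<bar> * (norm (\<gamma> k y) * norm (g k))" by simp
        also have "\<dots> \<le> \<bar>M * C0\<bar> * (norm y * (c k * norm (g k)))"
          using bound by (intro mult_left_mono) auto
        finally show "norm (\<gamma> k y * \<tau> y (g k)) \<le> \<bar>M * C0\<bar> * norm y * (c k * norm (g k))"
          by (simp add: norm_mult mult.assoc)
      qed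
    qed
    have expand: "(\<Sum>k. \<gamma> k (T (g k))) = (\<Sum>y\<in>C. \<Sum>k. \<gamma> k y * \<tau> y (g k))"
      if \<gamma>: "\<And>k. bounded_functional (c k) (\<gamma> k)" and c: "\<And>k. 0 \<le> c k"
        and g: "\<And>k. g k \<in> ?E" and sum_c: "summable (\<lambda>k. c k * norm (g k))" for \<gamma> c g
    proof -
      have "\<gamma> k (T (g k)) = (\<Sum>y\<in>C. \<gamma> k y * \<tau> y (g k))" for k
        unfolding T_eq[OF g]
        by (subst bounded_functional_sum[OF \<gamma>])
          (auto intro!: sum.cong simp: dual_closed(4) CE bounded_functionalD(2)[OF \<gamma> CE] mult.commute)
      then show ?thesis
        using nuclear_sum(2)[OF \<gamma> c g sum_c] by (simp add: suminf_sum)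
    qed
    have "(\<Sum>k. \<alpha> k y * \<tau> y (e k)) = (\<Sum>k. \<beta> k y * \<tau> y (h k))" if y: "y \<in> C" for y
    proof -
      have partial: "\<tau> y (\<Sum>k<n. dual_scale (\<gamma> k y) (g k)) = (\<Sum>k<n. \<gamma> k y * \<tau> y (g k))"
        if "\<And>k. g k \<in> ?E" for \<gamma> :: "nat \<Rightarrow> ('a \<Rightarrow>\<^sub>L 'k) \<Rightarrow> 'k" and g n
        using that
        by (subst bounded_functional_sum[OF \<tau>[OF y]])
          (auto intro!: dual_closed simp: bounded_functionalD(2)[OF \<tau>[OF y]])
      let ?S = "\<lambda>n. \<Sum>k<n. dual_scale (\<alpha> k y) (e k)" and ?S' = "\<lambda>n. \<Sum>k<n. dual_scale (\<beta> k y) (h k)"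
      note s1 = nuclear_sum[OF \<alpha> a e sum_a y] and s2 = nuclear_sum[OF \<beta> b h sum_b y]
      have "(\<Sum>k. dual_scale (\<alpha> k y) (e k)) = (\<Sum>k. dual_scale (\<beta> k y) (h k))"
      proof (rule blinfun_eqI)
        fix v
        have ev: "blinfun_apply (suminf u) v = (\<Sum>k. blinfun_apply (u k) v)" if "summable u" for u :: "nat \<Rightarrow> 'a \<Rightarrow>\<^sub>L 'k"
          using bounded_linear.suminf[OF blinfun.bounded_linear_left that] .
        show "blinfun_apply (\<Sum>k. dual_scale (\<alpha> k y) (e k)) v = blinfun_apply (\<Sum>k. dual_scale (\<beta> k y) (h k)) v"
          unfolding ev[OF s1(1)] ev[OF s2(1)] using eq[OF CE[OF y]] by simp
      qed
      then have "(\<lambda>n. ?S n - ?S' n) \<longlonglongrightarrow> 0"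
        using tendsto_diff[OF summable_LIMSEQ[OF s1(1)] summable_LIMSEQ[OF s2(1)]] by simp
      then have "(\<lambda>n. norm (?S n - ?S' n)) \<longlonglongrightarrow> 0" by (rule tendsto_norm_zero)
      from tendsto_mult_left[OF this, of "M * C0"]
      have lim0: "(\<lambda>n. M * C0 * norm (?S n - ?S' n)) \<longlonglongrightarrow> 0" by simp
      \<comment> \<open>Only differences of partial sums are fed to \<open>\<tau> y\<close>, because
        these visibly lie in \<open>dual scale\<close>, where \<open>\<tau> y\<close> is linear and
        bounded.\<close>
      have SE: "?S n \<in> ?E" "?S' n \<in> ?E" for n by (auto intro!: dual_sum dual_closed e h)
      have "(\<lambda>n. \<tau> y (?S n - ?S' n)) \<longlonglongrightarrow> 0"
        by (rule Lim_null_comparison[OF _ lim0])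
          (auto intro!: always_eventually bounded_functionalD(3)[OF \<tau>[OF y]] dual_closed(3) SE)
      then have "(\<lambda>n. (\<Sum>k<n. \<alpha> k y * \<tau> y (e k)) - (\<Sum>k<n. \<beta> k y * \<tau> y (h k))) \<longlonglongrightarrow> 0"
        by (simp only: bounded_functionalD(5)[OF \<tau>[OF y] SE] partial[where \<gamma> = \<alpha>, OF e] partial[where \<gamma> = \<beta>, OF h])
      moreover have "(\<lambda>n. (\<Sum>k<n. \<alpha> k y * \<tau> y (e k)) - (\<Sum>k<n. \<beta> k y * \<tau> y (h k))) \<longlonglongrightarrow>
          (\<Sum>k. \<alpha> k y * \<tau> y (e k)) - (\<Sum>k. \<beta> k y * \<tau> y (h k))"
        by (intro tendsto_diff summable_LIMSEQ s1 s2)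
      ultimately show ?thesis using LIMSEQ_unique by fastforce
    qed
    then show ?thesis unfolding expand[OF \<alpha> a e sum_a] expand[OF \<beta> b h sum_b] by simp
  qed
  obtain p where p: "\<And>k. p k > 0" "p \<longlonglongrightarrow> 0" "summable (\<lambda>k. a k * norm (e k) / p k)"
    using summable_weights[OF sum_a] a by (metis mult_nonneg_nonneg norm_ge_zero)
  obtain q where q: "\<And>k. q k > 0" "q \<longlonglongrightarrow> 0" "summable (\<lambda>k. b k * norm (h k) / q k)"
    using summable_weights[OF sum_b] b by (metis mult_nonneg_nonneg norm_ge_zero)
  \<comment> \<open>Vectors are rescaled to length \<open>p k\<close>, so that they tend to 0 and
    form a compact set together with the limit; zero vectors stay zero.\<close>
  define normalize where "normalize r g = dual_scale (of_real (r / norm g)) g" for r and g :: "'a \<Rightarrow>\<^sub>L 'k"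
  have compact: "compact (insert 0 (range (\<lambda>k. normalize (p k) (g k))))"
    if "p \<longlonglongrightarrow> 0" "\<And>k. p k > 0" for p g
  proof -
    have "norm (normalize (p k) (g k)) \<le> p k" for k
      using that(2)[of k] by (auto simp: normalize_def norm_dual_scale norm_divide)
    then have "(\<lambda>k. normalize (p k) (g k)) \<longlonglongrightarrow> 0"
      by (intro Lim_null_comparison[OF _ that(1)] always_eventually) auto
    then show ?thesis by (rule compact_insert_limit)
  qed
  let ?K = "insert 0 (range (\<lambda>k. normalize (p k) (e k))) \<union> insert 0 (range (\<lambda>k. normalize (q k) (h k)))"
  have K: "compact ?K" "?K \<subseteq> ?E"
    by (intro compact_Un compact p q) (auto simp: normalize_def intro!: dual_closed e h)
  define S where "S = (\<Sum>k. a k * norm (e k) / p k) + (\<Sum>k. b k * norm (h k) / q k)"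
  \<comment> \<open>\<open>T\<close> moves the rescaled vectors by at most \<open>\<delta>\<close>;
    undoing the rescaling, it moves the traces by at most \<open>\<delta>\<close> times the weighted
    sums that make up \<open>S\<close>.\<close>
  have "norm ((\<Sum>k. \<alpha> k (e k)) - (\<Sum>k. \<beta> k (h k))) \<le> \<delta> * S" if "\<delta> > 0" for \<delta>
  proof -
    obtain T B where T: "bounded_linear_on ?E dual_scale dual_scale T" "T ` ?E \<subseteq> ?E"
      and B: "finite B" "T ` ?E \<subseteq> dual.span B" and approx: "\<And>x. x \<in> ?K \<Longrightarrow> norm (T x - x) \<le> \<delta>"
      using AP K \<open>\<delta> > 0\<close> unfolding approximation_property_def by meson
    have T_scale: "T (dual_scale c f) = dual_scale c (T f)" if "f \<in> ?E" for f c
      using T(1) that by (simp add: bounded_linear_on_def)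
    obtain C0 where C0: "\<And>f. f \<in> ?E \<Longrightarrow> norm (T f) \<le> C0 * norm f"
      using T(1) unfolding bounded_linear_on_def by blast
    have close: "norm ((\<Sum>k. \<gamma> k (g k)) - (\<Sum>k. \<gamma> k (T (g k)))) \<le> \<delta> * (\<Sum>k. c k * norm (g k) / p k)"
      if \<gamma>: "\<And>k. bounded_functional (c k) (\<gamma> k)" and c: "\<And>k. 0 \<le> c k" and g: "\<And>k. g k \<in> ?E"
        and sum_c: "summable (\<lambda>k. c k * norm (g k))" and p: "\<And>k. p k > 0"
        and sum_p: "summable (\<lambda>k. c k * norm (g k) / p k)" and gK: "\<And>k. normalize (p k) (g k) \<in> ?K"
      for \<gamma> c g p
    proof -
      have TE: "T (g k) \<in> ?E" for k using T(2) g by blast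
      have diff: "norm (T (g k) - g k) \<le> \<delta> * (norm (g k) / p k)" for k
      proof (cases "g k = 0")
        case True
        have "norm (T 0) \<le> 0" using C0[OF dual_closed(1)] by simp
        then show ?thesis using True by simp
      next
        case False
        then have gk: "g k = dual_scale (of_real (norm (g k) / p k)) (normalize (p k) (g k))"
          using p[of k] by (intro blinfun_eqI) (simp add: normalize_def mult.assoc[symmetric])
        have "normalize (p k) (g k) \<in> ?E" using gK K(2) by blast
        from T_scale[OF this] have "T (g k) - g k =
            dual_scale (of_real (norm (g k) / p k)) (T (normalize (p k) (g k)) - normalize (p k) (g k))"
          by (subst (1 2) gk) (simp add: dual.scale_right_diff_distrib del: of_real_divide)
        then have "norm (T (g k) - g k) = norm (g k) / p k * norm (T (normalize (p k) (g k)) - normalize (p k) (g k))"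
          using p[of k] by (simp add: norm_dual_scale norm_divide)
        also have "\<dots> \<le> norm (g k) / p k * \<delta>"
          using approx[OF gK] p[of k] by (intro mult_left_mono) (auto intro: less_imp_le)
        finally show ?thesis by (simp add: mult.commute)
      qed
      have \<gamma>_diff: "norm (\<gamma> k (g k) - \<gamma> k (T (g k))) \<le> \<delta> * (c k * norm (g k) / p k)" for k
      proof -
        have "norm (\<gamma> k (g k) - \<gamma> k (T (g k))) = norm (\<gamma> k (T (g k) - g k))"
          by (simp add: bounded_functionalD(5)[OF \<gamma> TE g] norm_minus_commute)
        also have "\<dots> \<le> c k * norm (T (g k) - g k)"
          by (intro bounded_functionalD(3)[OF \<gamma>] dual_closed TE g)
        also have "\<dots> \<le> c k * (\<delta> * (norm (g k) / p k))" using diff c by (intro mult_left_mono)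
        finally show ?thesis by (simp add: algebra_simps)
      qed
      have s1: "summable (\<lambda>k. \<gamma> k (g k))"
        using bounded_functionalD(3)[OF \<gamma> g] by (intro summable_comparison_test'[OF sum_c]) auto
      have s2: "summable (\<lambda>k. \<gamma> k (g k) - \<gamma> k (T (g k)))"
        using \<gamma>_diff by (intro summable_comparison_test'[OF summable_mult[OF sum_p]]) auto
      have s3: "summable (\<lambda>k. \<gamma> k (T (g k)))"
        using summable_diff[OF s1 s2] by simp
      have "(\<Sum>k. \<gamma> k (g k)) - (\<Sum>k. \<gamma> k (T (g k))) = (\<Sum>k. \<gamma> k (g k) - \<gamma> k (T (g k)))"
        by (rule suminf_diff[OF s1 s3])
      also have "norm \<dots> \<le> (\<Sum>k. \<delta> * (c k * norm (g k) / p k))"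
        by (intro norm_suminf_le \<gamma>_diff summable_mult sum_p)
      also have "\<dots> = \<delta> * (\<Sum>k. c k * norm (g k) / p k)" by (rule suminf_mult[OF sum_p])
      finally show ?thesis .
    qed
    have "norm ((\<Sum>k. \<alpha> k (e k)) - (\<Sum>k. \<beta> k (h k))) \<le>
        norm ((\<Sum>k. \<alpha> k (e k)) - (\<Sum>k. \<alpha> k (T (e k)))) + norm ((\<Sum>k. \<beta> k (h k)) - (\<Sum>k. \<beta> k (T (h k))))"
      unfolding fin_rank[OF T B] by (metis norm_minus_commute norm_triangle_ineq4 diff_diff_eq2 diff_add_cancel)
    also have "\<dots> \<le> \<delta> * S"
      unfolding S_def distrib_left
      by (intro add_mono close[OF \<alpha> a e sum_a p(1,3)] close[OF \<beta> b h sum_b q(1,3)]) auto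
    finally show ?thesis .
  qed
  then have lim: "norm ((\<Sum>k. \<alpha> k (e k)) - (\<Sum>k. \<beta> k (h k))) \<le> inverse (real (Suc n)) * S" for n
    by simp
  have "(\<lambda>n. inverse (real (Suc n)) * S) \<longlonglongrightarrow> 0 * S"
    by (intro tendsto_intros LIMSEQ_inverse_real_of_nat)
  then have "norm ((\<Sum>k. \<alpha> k (e k)) - (\<Sum>k. \<beta> k (h k))) \<le> 0 * S"
    by (rule LIMSEQ_le_const) (use lim in blast)
  then show ?thesis by simp
qed

end

section \<open>The bidual ball and iterated limits\<close>

lemma power2_norm_add_scaleR:
  fixes a y :: "'b::real_inner"
  shows "(norm (a + t *\<^sub>R y))\<^sup>2 = (norm a)\<^sup>2 + 2 * t * (a \<bullet> y) + t\<^sup>2 * (norm y)\<^sup>2"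
proof -
  have "(a + t *\<^sub>R y) \<bullet> (a + t *\<^sub>R y) = a \<bullet> a + 2 * t * (a \<bullet> y) + t\<^sup>2 * (y \<bullet> y)"
    by (simp add: inner_add_left inner_add_right inner_commute[of y a] power2_eq_square algebra_simps)
  then show ?thesis by (simp only: power2_norm_eq_inner)
qed

context normed_space_over
begin

text \<open>The real supremum in \<open>sup_norm_on\<close> bounds its members only if they are
  bounded above; the constant inside \<open>bidual\<close> guarantees this, and scaling does the
  rest.\<close>

lemma bidual_ball_iff:
  "z \<in> bidual_ball scale \<longleftrightarrow> bounded_functional 1 z \<and> (\<forall>f. f \<notin> dual scale \<longrightarrow> z f = 0)"
proof
  assume "z \<in> bidual_ball scale"
  then have z: "bounded_linear_on (dual scale) dual_scale (*) z" "\<forall>f. f \<notin> dual scale \<longrightarrow> z f = 0"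
    and sup: "sup_norm_on (dual scale \<inter> cball 0 1) z \<le> 1"
    by (auto simp: bidual_ball_def bidual_def)
  obtain C where C: "\<And>f. f \<in> dual scale \<Longrightarrow> norm (z f) \<le> C * norm f"
    using z(1) unfolding bounded_linear_on_def by blast
  have bdd: "bdd_above ((\<lambda>f. norm (z f)) ` (dual scale \<inter> cball 0 1))"
  proof (rule bdd_aboveI2)
    fix f assume f: "f \<in> dual scale \<inter> cball 0 1"
    have "C * norm f \<le> \<bar>C\<bar> * norm f" by (intro mult_right_mono) auto
    also have "\<dots> \<le> \<bar>C\<bar> * 1" using f by (intro mult_left_mono) auto
    finally show "norm (z f) \<le> \<bar>C\<bar>" using C[of f] f by simp
  qed
  have "norm (z f) \<le> 1 * norm f" if f: "f \<in> dual scale" for f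
  proof (cases "f = 0")
    case False
    let ?g = "dual_scale (of_real (1 / norm f)) f"
    have g: "?g \<in> dual scale \<inter> cball 0 1"
      using False f by (simp add: dual_closed norm_dual_scale norm_divide)
    have "norm (z ?g) \<le> sup_norm_on (dual scale \<inter> cball 0 1) z"
      unfolding sup_norm_on_def by (rule cSUP_upper[OF g bdd])
    moreover have "z ?g = of_real (1 / norm f) * z f"
      using z(1) f unfolding bounded_linear_on_def by blast
    ultimately have "norm (z f) / norm f \<le> 1" using sup by (simp add: norm_mult norm_divide)
    then show ?thesis using False by (simp add: field_simps)
  qed (use C[OF f] in simp)
  then show "bounded_functional 1 z \<and> (\<forall>f. f \<notin> dual scale \<longrightarrow> z f = 0)"
    using z unfolding bounded_functional_def bounded_linear_on_def by blast
next
  assume z: "bounded_functional 1 z \<and> (\<forall>f. f \<notin> dual scale \<longrightarrow> z f = 0)"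
  then have "bounded_linear_on (dual scale) dual_scale (*) z"
    unfolding bounded_functional_def bounded_linear_on_def by blast
  moreover have "sup_norm_on (dual scale \<inter> cball 0 1) z \<le> 1"
    unfolding sup_norm_on_def
  proof (rule cSUP_least)
    have "0 \<in> dual scale \<inter> cball 0 1" by (simp add: dual_closed)
    then show "dual scale \<inter> cball 0 1 \<noteq> {}" by blast
    fix f assume "f \<in> dual scale \<inter> cball 0 1"
    then show "norm (z f) \<le> 1" using bounded_functionalD(3)[of 1 z f] z by simp
  qed
  ultimately show "z \<in> bidual_ball scale" using z by (simp add: bidual_ball_def bidual_def)
qed

lemma norm_dual_le:
  assumes f: "f \<in> dual scale" and M: "\<And>x. norm x \<le> 1 \<Longrightarrow> norm (blinfun_apply f x) \<le> M"
  shows "norm f \<le> M"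
proof (rule norm_blinfun_bound)
  show "0 \<le> M" using M[of 0] by (simp add: blinfun.zero_right)
  fix x
  have "blinfun_apply f x = norm x *\<^sub>R blinfun_apply f (sgn x)"
    by (cases "x = 0") (simp_all add: blinfun.scaleR_right[symmetric] sgn_div_norm blinfun.zero_right)
  then show "norm (blinfun_apply f x) \<le> M * norm x"
    using mult_right_mono[OF M[of "sgn x"], of "norm x"] by (simp add: norm_sgn mult.commute)
qed

text \<open>
  Goldstine's theorem without separation of convex sets: a near-minimizer \<open>x0\<close> of the squared
  distance is almost optimal in the direction of every point of the ball, which bounds the
  distance itself.
\<close>

lemma goldstine:
  assumes z: "bounded_functional 1 z" and F: "finite F" "F \<subseteq> dual scale" and \<epsilon>: "\<epsilon> > 0"
  obtains x where "norm x \<le> 1" "\<And>f. f \<in> F \<Longrightarrow> norm (blinfun_apply f x - z f) < \<epsilon>"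
proof -
  define D where "D x = (\<Sum>f\<in>F. (norm (blinfun_apply f x - z f))\<^sup>2)" for x
  define K where "K = (\<Sum>f\<in>F. (2 * norm f)\<^sup>2)"
  have K: "K \<ge> 0" by (auto simp: K_def intro: sum_nonneg)
  \<comment> \<open>\<open>K\<close> bounds the quadratic coefficient of \<open>D\<close> along
    segments from \<open>x0\<close> in the ball. The parameter \<open>t\<close> is the step length
    along such a segment, and \<open>x0\<close> will minimize \<open>D\<close> up to
    \<open>t\<^sup>2\<close>.\<close>
  define t where "t = min 1 (\<epsilon>\<^sup>2 / (1 + K))"
  have t: "0 < t" "t \<le> 1" "t * (1 + K) \<le> \<epsilon>\<^sup>2"
  proof -
    show "0 < t" using \<epsilon> K by (simp add: t_def)
    show "t \<le> 1" by (simp add: t_def)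
    have "t \<le> \<epsilon>\<^sup>2 / (1 + K)" by (simp add: t_def)
    then show "t * (1 + K) \<le> \<epsilon>\<^sup>2" using K by (simp add: pos_le_divide_eq)
  qed
  have D_nonneg: "0 \<le> D x" for x by (auto simp: D_def intro: sum_nonneg)
  have "\<exists>x\<in>cball 0 1. D x < (INF x\<in>cball (0::'a) 1. D x) + t\<^sup>2"
  proof (subst cINF_less_iff[symmetric])
    show "bdd_below (D ` cball 0 1)" using D_nonneg by (rule bdd_belowI2)
  qed (use t(1) in auto)
  then obtain x0 where x0: "norm x0 \<le> 1" "D x0 < (INF x\<in>cball (0::'a) 1. D x) + t\<^sup>2" by auto
  have D_min: "D x0 - t\<^sup>2 \<le> D x" if "norm x \<le> 1" for x
  proof -
    have "(INF x\<in>cball (0::'a) 1. D x) \<le> D x"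
      using that D_nonneg by (intro cINF_lower bdd_belowI2[of _ 0]) auto
    then show ?thesis using x0 by simp
  qed
  define a where "a f = blinfun_apply f x0 - z f" for f
  have "\<exists>c. \<forall>y. a f \<bullet> y = re (y * c)" for f
    using linear_eq_re_mult[OF bounded_linear.linear[OF bounded_linear_inner_right[of "a f"]]] by metis
  then obtain c where c: "\<And>f y. a f \<bullet> y = re (y * c f)" by metis
  \<comment> \<open>The real part of \<open>G\<close> is half the differential of \<open>D\<close>
    at \<open>x0\<close>.\<close>
  define G where "G = (\<Sum>f\<in>F. dual_scale (c f) f)"
  have G: "G \<in> dual scale" unfolding G_def using F by (auto intro!: dual_sum dual_closed)
  have G_apply: "re (blinfun_apply G x) = (\<Sum>f\<in>F. a f \<bullet> blinfun_apply f x)" for x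
    by (simp add: G_def blinfun.sum_left re_sum c mult.commute)
  have zG: "re (z G) = (\<Sum>f\<in>F. a f \<bullet> z f)"
    unfolding G_def using F
    by (subst bounded_functional_sum[OF z])
      (auto intro!: sum.cong dual_closed simp: re_sum c subset_eq bounded_functionalD(2)[OF z] mult.commute)
  define s where "s = t * (1 + K) / 2"
  \<comment> \<open>Near-minimality is tested at
    \<open>(1 - t) *\<^sub>R x0 + t *\<^sub>R x\<close>. The linear term has factor
    \<open>2 * t\<close>, the errors are \<open>t\<^sup>2\<close> and \<open>t\<^sup>2 * K\<close>;
    dividing by \<open>2 * t\<close> leaves \<open>s\<close>.\<close>
  have step: "re (blinfun_apply G x0) - re (blinfun_apply G x) \<le> s" if x: "norm x \<le> 1" for x
  proof -
    have "norm ((1 - t) *\<^sub>R x0 + t *\<^sub>R x) \<le> (1 - t) * norm x0 + t * norm x"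
      using t by (intro norm_triangle_le) auto
    also have "\<dots> \<le> (1 - t) * 1 + t * 1" using x x0 t by (intro add_mono mult_left_mono) auto
    finally have "D x0 - t\<^sup>2 \<le> D ((1 - t) *\<^sub>R x0 + t *\<^sub>R x)" by (intro D_min) simp
    also have "\<dots> = (\<Sum>f\<in>F. (norm (a f + t *\<^sub>R blinfun_apply f (x - x0)))\<^sup>2)"
      unfolding D_def
      by (intro sum.cong refl arg_cong[of _ _ "\<lambda>y. (norm y)\<^sup>2"])
        (simp add: a_def blinfun.add_right blinfun.scaleR_right blinfun.diff_right algebra_simps)
    also have "\<dots> = (\<Sum>f\<in>F. (norm (a f))\<^sup>2 + 2 * t * (a f \<bullet> blinfun_apply f (x - x0)) + t\<^sup>2 * (norm (blinfun_apply f (x - x0)))\<^sup>2)"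
      unfolding power2_norm_add_scaleR ..
    also have "\<dots> \<le> (\<Sum>f\<in>F. (norm (a f))\<^sup>2 + 2 * t * (a f \<bullet> blinfun_apply f (x - x0)) + t\<^sup>2 * (2 * norm f)\<^sup>2)"
    proof (intro sum_mono add_left_mono mult_left_mono power_mono)
      fix f :: "'a \<Rightarrow>\<^sub>L 'k"
      have "norm (x - x0) \<le> 2" using norm_triangle_ineq4[of x x0] x x0 by simp
      then have "norm f * norm (x - x0) \<le> norm f * 2" by (intro mult_left_mono) auto
      then show "norm (blinfun_apply f (x - x0)) \<le> 2 * norm f"
        using norm_blinfun[of f "x - x0"] by simp
    qed auto
    also have "\<dots> = D x0 + 2 * t * (re (blinfun_apply G x) - re (blinfun_apply G x0)) + t\<^sup>2 * K"
      unfolding G_apply D_def K_def a_def[symmetric]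
      by (simp add: sum.distrib sum_distrib_left[symmetric] blinfun.diff_right inner_diff_right sum_subtractf right_diff_distrib)
    finally have "t * (2 * (re (blinfun_apply G x0) - re (blinfun_apply G x))) \<le> t * (t * (1 + K))"
      by (simp add: algebra_simps power2_eq_square)
    then show ?thesis using t(1) by (simp add: s_def)
  qed
  \<comment> \<open>The ball is invariant under unimodular scalars, so \<open>step\<close> bounds
    the norm of \<open>G\<close>. As \<open>z\<close> has norm at most 1, \<open>re (z G)\<close>
    cannot lie below \<open>- norm G\<close>, and the difference of the values of \<open>x0\<close>
    and \<open>z\<close> at \<open>G\<close> is exactly \<open>D x0\<close>.\<close>
  have "norm G \<le> s - re (blinfun_apply G x0)"
  proof (rule norm_dual_le[OF G], rule norm_le_re)
    fix x :: 'a and b :: 'k assume x: "norm x \<le> 1" and b: "norm b = 1"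
    have "norm (scale (- b) x) \<le> 1" using x b by (simp add: norm_scale)
    from step[OF this] show "re (b * blinfun_apply G x) \<le> s - re (blinfun_apply G x0)"
      unfolding dualD[OF G] by (simp add: re_neg)
  qed
  moreover have "- norm G \<le> re (z G)"
    using bounded_functionalD(3)[OF z G] abs_re_le[of "z G"] by simp
  ultimately have "re (blinfun_apply G x0) - re (z G) \<le> s" by simp
  moreover have "re (blinfun_apply G x0) - re (z G) = D x0"
    unfolding G_apply zG D_def sum_subtractf[symmetric]
    by (intro sum.cong refl) (simp add: a_def power2_norm_eq_inner inner_diff_right[symmetric])
  ultimately have "D x0 \<le> s" by simp
  also have "s < \<epsilon>\<^sup>2" using t \<epsilon> K by (simp add: s_def) (smt (verit) zero_less_power)
  finally have D: "D x0 < \<epsilon>\<^sup>2" .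
  show ?thesis
  proof (rule that[OF x0(1)])
    fix f assume "f \<in> F"
    then have "(norm (blinfun_apply f x0 - z f))\<^sup>2 \<le> D x0"
      unfolding D_def using F(1) by (intro member_le_sum) auto
    then have "(norm (blinfun_apply f x0 - z f))\<^sup>2 < \<epsilon>\<^sup>2" using D by simp
    then show "norm (blinfun_apply f x0 - z f) < \<epsilon>" using \<epsilon> power_less_imp_less_base by fastforce
  qed
qed

text \<open>By Goldstine's theorem every weak* neighbourhood of \<open>z\<close> contains images of
  points of the space. Limits along the filter are therefore unique, and \<open>Lim\<close> is
  meaningful.\<close>

lemma wstar_at_neq_bot:
  assumes z: "z \<in> bidual_ball scale"
  shows "wstar_at scale z \<noteq> bot"
  unfolding wstar_at_def
proof (rule filtercomap_neq_bot)
  fix P assume "eventually P (nhds z)"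
  then obtain U where U: "open U" "z \<in> U" "\<And>y. y \<in> U \<Longrightarrow> P y" by (auto simp: eventually_nhds)
  have "openin (product_topology (\<lambda>_. euclidean) UNIV) U" using U(1) by (simp only: open_fun_def)
  from product_topology_open_contains_basis[OF this U(2)]
  obtain X where X: "z \<in> (\<Pi>\<^sub>E i\<in>UNIV. X i)" "\<And>i. open (X i)" "finite {i. X i \<noteq> UNIV}" "(\<Pi>\<^sub>E i\<in>UNIV. X i) \<subseteq> U"
    by auto
  have zX: "z f \<in> X f" for f using X(1) by (auto simp: PiE_iff)
  \<comment> \<open>Coordinates outside the dual impose nothing: there \<open>z\<close> and all
    embedded points are 0.\<close>
  define F where "F = {f. X f \<noteq> UNIV} \<inter> dual scale"
  have F: "finite F" "F \<subseteq> dual scale" using X(3) by (auto simp: F_def)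
  have "\<exists>e>0. ball (z f) e \<subseteq> X f" for f using X(2)[of f] zX[of f] open_contains_ball by blast
  then obtain e where e: "\<And>f. e f > 0" "\<And>f. ball (z f) (e f) \<subseteq> X f" by metis
  define \<epsilon> where "\<epsilon> = Min (insert 1 (e ` F))"
  have \<epsilon>: "\<epsilon> > 0" "\<And>f. f \<in> F \<Longrightarrow> \<epsilon> \<le> e f" using F(1) e(1) by (auto simp: \<epsilon>_def)
  have zb: "bounded_functional 1 z" "\<And>f. f \<notin> dual scale \<Longrightarrow> z f = 0"
    using z by (auto simp: bidual_ball_iff)
  obtain x where x: "\<And>f. f \<in> F \<Longrightarrow> norm (blinfun_apply f x - z f) < \<epsilon>"
    using goldstine[OF zb(1) F \<epsilon>(1)] by blast
  have "canonical_embedding scale x f \<in> X f" for f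
  proof (cases "f \<in> F")
    case True
    then have "dist (z f) (blinfun_apply f x) < e f" using x[OF True] \<epsilon>(2)[OF True] by (simp add: dist_norm norm_minus_commute)
    then show ?thesis using e(2)[of f] True by (auto simp: canonical_embedding_def F_def)
  next
    case False
    then show ?thesis using zb(2)[of f] zX[of f] by (auto simp: canonical_embedding_def F_def)
  qed
  then have "canonical_embedding scale x \<in> U" using X(4) by (auto simp: PiE_iff)
  then show "\<exists>x. P (canonical_embedding scale x)" using U(3) by blast
qed

lemma Lim_wstar_at:
  assumes z: "z \<in> bidual_ball scale" and f: "f \<in> dual scale"
  shows "Lim (wstar_at scale z) (blinfun_apply f) = z f"
proof (rule tendsto_Lim)
  show "\<not> trivial_limit (wstar_at scale z)" using wstar_at_neq_bot[OF z] .
  have "((\<lambda>y. y f) \<longlongrightarrow> z f) (nhds z)"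
    by (rule continuous_on_tendsto_compose[OF continuous_on_product_coordinates filterlim_ident]) auto
  then have "((\<lambda>x. canonical_embedding scale x f) \<longlongrightarrow> z f) (wstar_at scale z)"
    unfolding wstar_at_def by (rule filterlim_compose) (rule filterlim_filtercomap)
  then show "(blinfun_apply f \<longlongrightarrow> z f) (wstar_at scale z)"
    using f by (simp add: canonical_embedding_def)
qed

section \<open>Extending a form one slot at a time\<close>

definition slice :: "((nat \<Rightarrow> 'a) \<Rightarrow> 'k) \<Rightarrow> nat \<Rightarrow> (nat \<Rightarrow> 'a) \<Rightarrow> 'a \<Rightarrow>\<^sub>L 'k"
  where "slice \<Psi> k x = Blinfun (\<lambda>v. \<Psi> (x(k := v)))"

lemma bform_mform: "bform N C \<Psi> \<Longrightarrow> mform N \<Psi>"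
  by (simp add: bform_def)

lemma bform_bound: "bform N C \<Psi> \<Longrightarrow> norm (\<Psi> x) \<le> C * (\<Prod>i<N. norm (x i))"
  by (simp add: bform_def)

lemma bform_slice_bound:
  assumes "bform (Suc k) C \<Psi>"
  shows "norm (\<Psi> (x(k := v))) \<le> C * (\<Prod>i<k. norm (x i)) * norm v"
proof -
  have "(\<Prod>i<Suc k. norm ((x(k := v)) i)) = (\<Prod>i<k. norm (x i)) * norm v" by simp
  then show ?thesis using bform_bound[OF assms, of "x(k := v)"] by (simp add: mult.assoc)
qed

lemma slice_apply:
  assumes "bform (Suc k) C \<Psi>"
  shows "blinfun_apply (slice \<Psi> k x) v = \<Psi> (x(k := v))"
  unfolding slice_def
proof (subst bounded_linear_Blinfun_apply)
  note m = bform_mform[OF assms]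
  show "bounded_linear (\<lambda>v. \<Psi> (x(k := v)))"
  proof (rule bounded_linear_intro)
    show "\<Psi> (x(k := u + v)) = \<Psi> (x(k := u)) + \<Psi> (x(k := v))" for u v by (rule mform_add[OF m]) simp
    show "\<Psi> (x(k := r *\<^sub>R v)) = r *\<^sub>R \<Psi> (x(k := v))" for r v
      using mform_scale[OF m, of k x "of_real r" v] by (simp add: scale_of_real scaleR_conv_of_real)
    show "norm (\<Psi> (x(k := v))) \<le> norm v * (C * (\<Prod>i<k. norm (x i)))" for v
      using bform_slice_bound[OF assms, of x v] by (simp add: mult.commute)
  qed
qed simp

lemma slice_in_dual:
  assumes "bform (Suc k) C \<Psi>"
  shows "slice \<Psi> k x \<in> dual scale"
  unfolding dual_def using mform_scale[OF bform_mform[OF assms], of k x] by (simp add: slice_apply[OF assms])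

lemma norm_slice_le:
  assumes "bform (Suc k) C \<Psi>" "C \<ge> 0"
  shows "norm (slice \<Psi> k x) \<le> C * (\<Prod>i<k. norm (x i))"
  using bform_slice_bound[OF assms(1)] assms(2)
  by (intro norm_blinfun_bound) (auto simp: slice_apply[OF assms(1)] intro!: mult_nonneg_nonneg prod_nonneg)

text \<open>A functional of the bidual ball has norm at most 1, so filling the last slot with it
  keeps the constant \<open>C\<close>, and the next slot can be treated in the same way.\<close>

lemma bform_functional_slice:
  assumes \<Psi>: "bform (Suc k) C \<Psi>" "C \<ge> 0" and z: "bounded_functional 1 z"
  shows "bform k C (\<lambda>x. z (slice \<Psi> k x))"
  unfolding bform_def mform_def
proof (intro conjI allI impI)
  note m = bform_mform[OF \<Psi>(1)] and D = slice_in_dual[OF \<Psi>(1)]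
  show "z (slice \<Psi> k x) = z (slice \<Psi> k y)" if "\<forall>i<k. x i = y i" for x y
  proof -
    have "slice \<Psi> k x = slice \<Psi> k y"
      using that by (intro blinfun_eqI) (auto simp: slice_apply[OF \<Psi>(1)] less_Suc_eq intro!: mform_cong[OF m])
    then show ?thesis by simp
  qed
  fix x :: "nat \<Rightarrow> 'a" and i assume i: "i < k"
  have tw: "(x(i := u))(k := v) = (x(k := v))(i := u)" for u v using i by (auto simp: fun_upd_twist)
  show "z (slice \<Psi> k (x(i := u + v))) = z (slice \<Psi> k (x(i := u))) + z (slice \<Psi> k (x(i := v)))" for u v
  proof -
    have "slice \<Psi> k (x(i := u + v)) = slice \<Psi> k (x(i := u)) + slice \<Psi> k (x(i := v))"
      using i by (intro blinfun_eqI) (simp add: slice_apply[OF \<Psi>(1)] plus_blinfun.rep_eq tw mform_add[OF m] del: fun_upd_apply)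
    then show ?thesis by (simp add: bounded_functionalD(1)[OF z] D)
  qed
  show "z (slice \<Psi> k (x(i := scale c u))) = c * z (slice \<Psi> k (x(i := u)))" for c u
  proof -
    have "slice \<Psi> k (x(i := scale c u)) = dual_scale c (slice \<Psi> k (x(i := u)))"
      using i by (intro blinfun_eqI) (simp add: slice_apply[OF \<Psi>(1)] tw mform_scale[OF m])
    then show ?thesis by (simp add: bounded_functionalD(2)[OF z] D)
  qed
next
  fix x
  have "norm (z (slice \<Psi> k x)) \<le> 1 * norm (slice \<Psi> k x)"
    by (rule bounded_functionalD(3)[OF z slice_in_dual[OF \<Psi>(1)]])
  then show "norm (z (slice \<Psi> k x)) \<le> C * (\<Prod>i<k. norm (x i))"
    using norm_slice_le[OF \<Psi>, of x] by simp
qed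

text \<open>\<open>partial_ext z N \<Phi> j\<close> has the last \<open>j\<close> of \<open>N\<close> arguments replaced by \<open>z\<close>.\<close>

primrec partial_ext ::
  "(('a \<Rightarrow>\<^sub>L 'k) \<Rightarrow> 'k) \<Rightarrow> nat \<Rightarrow> ((nat \<Rightarrow> 'a) \<Rightarrow> 'k) \<Rightarrow> nat \<Rightarrow> (nat \<Rightarrow> 'a) \<Rightarrow> 'k"
  where
    "partial_ext z N \<Phi> 0 = \<Phi>"
  | "partial_ext z N \<Phi> (Suc j) = (\<lambda>x. z (slice (partial_ext z N \<Phi> j) (N - Suc j) x))"

lemma bform_partial_ext:
  assumes "bform N C \<Phi>" "C \<ge> 0" "bounded_functional 1 z" "j \<le> N"
  shows "bform (N - j) C (partial_ext z N \<Phi> j)"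
  using assms(4)
proof (induction j)
  case (Suc j)
  then have "N - j = Suc (N - Suc j)" by simp
  then show ?case using Suc bform_functional_slice[OF _ assms(2,3)] by simp
qed (use assms in simp)

text \<open>The innermost limit is taken of a functional in the dual, so by
  \<open>Lim_wstar_at\<close> it is the value of \<open>z\<close> there. Removing the inner limits
  one by one leaves an expression without limits.\<close>

lemma iterated_lim_partial_ext:
  assumes \<Phi>: "bform N C \<Phi>" "C \<ge> 0" and z: "z \<in> bidual_ball scale" and "j \<le> N"
  shows "iterated_lim scale (\<lambda>_. z) N \<Phi> = iterated_lim scale (\<lambda>_. z) (N - j) (partial_ext z N \<Phi> j)"
  using assms(4)
proof (induction j)
  case (Suc j)
  have zb: "bounded_functional 1 z" using z by (simp add: bidual_ball_iff)
  have N: "N - j = Suc (N - Suc j)" using Suc.prems by simp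
  have b: "bform (Suc (N - Suc j)) C (partial_ext z N \<Phi> j)"
    using bform_partial_ext[OF \<Phi> zb, of j] Suc.prems N by simp
  have "Lim (wstar_at scale z) (\<lambda>v. partial_ext z N \<Phi> j (x(N - Suc j := v))) = partial_ext z N \<Phi> (Suc j) x" for x
    using Lim_wstar_at[OF z slice_in_dual[OF b], of x] by (simp add: slice_apply[OF b, abs_def])
  then show ?case using Suc N by simp
qed simp

lemma aron_berner_eq_partial_ext:
  assumes "P \<in> hom_polys scale N" "bform N C (polar N P)" "C \<ge> 0" "z \<in> bidual_ball scale"
  shows "aron_berner scale N P z = partial_ext z N (polar N P) N (\<lambda>_. 0)"
  unfolding aron_berner_def arens_extension_def associated_form_eq_polar[OF assms(1)]
  using iterated_lim_partial_ext[OF assms(2-4) order_refl] by simp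

end

section \<open>The norm of the extension on the bidual ball\<close>

lemma injective_tuples_ratio:
  "(\<lambda>n. real (card {m \<in> {..<N} \<rightarrow>\<^sub>E {..<n}. inj_on m {..<N}}) / real n ^ N) \<longlonglongrightarrow> 1"
proof -
  \<comment> \<open>The count is a falling factorial with \<open>N\<close> factors;
    \<open>n > N\<close> keeps the subtractions from being truncated and \<open>n\<close>
    nonzero.\<close>
  have eq: "real (card {m \<in> {..<N} \<rightarrow>\<^sub>E {..<n}. inj_on m {..<N}}) / real n ^ N = (\<Prod>i\<in>{0..<N}. 1 - real i / real n)"
    if n: "n \<ge> Suc N" for n
  proof -
    have "real (card {m \<in> {..<N} \<rightarrow>\<^sub>E {..<n}. inj_on m {..<N}}) = (\<Prod>i\<in>{0..<N}. real (n - i))"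
      by (subst card_inj_on_subset_funcset) auto
    also have "\<dots> = (\<Prod>i\<in>{0..<N}. real n * (1 - real i / real n))"
      using n by (intro prod.cong) (auto simp: of_nat_diff algebra_simps)
    also have "\<dots> = real n ^ N * (\<Prod>i\<in>{0..<N}. 1 - real i / real n)" by (simp add: prod.distrib)
    finally show ?thesis using n by simp
  qed
  have "(\<lambda>n. \<Prod>i\<in>{0..<N}. 1 - real i / real n) \<longlonglongrightarrow> (\<Prod>i\<in>{0..<N}. 1 - 0)"
    by (intro tendsto_prod tendsto_diff tendsto_const lim_const_over_n)
  then have "(\<lambda>n. \<Prod>i\<in>{0..<N}. 1 - real i / real n) \<longlonglongrightarrow> 1" by simp
  then show ?thesis
    by (rule Lim_transform_eventually) (use eq in \<open>auto simp: eventually_sequentially intro!: exI[of _ "Suc N"]\<close>)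
qed

context normed_space_over
begin

text \<open>
  Davie and Gamelin's argument: points \<open>y 0, y 1, \<dots>\<close> of the ball are chosen such that the
  symmetric form of \<open>Q\<close> at any \<open>N\<close> different ones of them is close to the value of the
  extension at \<open>z\<close>, and then so is \<open>Q\<close> at the mean of many of them.
\<close>

theorem norm_aron_berner_le:
  assumes Q: "Q \<in> hom_polys scale N" and z: "z \<in> bidual_ball scale"
  shows "norm (aron_berner scale N Q z) \<le> sup_norm_on (cball 0 1) Q"
proof -
  define \<Phi> where "\<Phi> = polar N Q"
  note sym = polar_symmetric_form[OF Q, folded \<Phi>_def]
  obtain C where C: "C \<ge> 0" "bform N C \<Phi>" using multilinear_imp_bform[OF sym(1)] by metis
  have zb: "bounded_functional 1 z" using z by (simp add: bidual_ball_iff)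
  \<comment> \<open>\<open>\<Psi> k\<close> has \<open>k\<close> arguments left free, so
    \<open>\<Psi> N\<close> is \<open>\<Phi>\<close> and \<open>\<Psi> 0\<close> is the constant
    \<open>L\<close>.\<close>
  define \<Psi> where "\<Psi> k = partial_ext z N \<Phi> (N - k)" for k
  have \<Psi>_bform: "bform k C (\<Psi> k)" if "k \<le> N" for k
    using bform_partial_ext[OF C(2,1) zb, of "N - k"] that by (simp add: \<Psi>_def)
  have \<Psi>_step: "\<Psi> k x = z (slice (\<Psi> (Suc k)) k x)" if "k < N" for k x
  proof -
    have "N - k = Suc (N - Suc k)" "N - (N - k) = k" using that by auto
    then show ?thesis by (simp add: \<Psi>_def)
  qed
  have \<Psi>_N: "\<Psi> N = \<Phi>" by (simp add: \<Psi>_def)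
  note \<Psi>_cong = mform_cong[OF bform_mform[OF \<Psi>_bform]]
  define L where "L = \<Psi> 0 (\<lambda>_. 0)"
  have AB: "aron_berner scale N Q z = L"
    using aron_berner_eq_partial_ext[OF Q, folded \<Phi>_def, OF C(2,1) z] by (simp add: L_def \<Psi>_def)
  have L_bound: "norm L \<le> C" using bform_bound[OF \<Psi>_bform[of 0], of "\<lambda>_. 0"] by (simp add: L_def)
  let ?s = "sup_norm_on (cball 0 1) Q"
  have main: "norm L \<le> ?s + real N * \<epsilon> + 2 * C * (1 - real (card {m \<in> {..<N} \<rightarrow>\<^sub>E {..<n}. inj_on m {..<N}}) / real n ^ N)"
    if \<epsilon>: "\<epsilon> > 0" and n: "n > 0" for \<epsilon> n
  proof -
    \<comment> \<open>The condition on a new point \<open>r\<close>: placed in slot \<open>k\<close>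
      behind any earlier points, it acts like \<open>z\<close> up to \<open>\<epsilon>\<close>. Only
      finitely many functionals are involved, so Goldstine's theorem provides
      \<open>r\<close>.\<close>
    define P where "P y n r \<longleftrightarrow> norm r \<le> 1 \<and> (\<forall>k<N. \<forall>m. (\<forall>i<k. m i < n) \<longrightarrow>
      norm (\<Psi> (Suc k) ((\<lambda>i. y (m i))(k := r)) - \<Psi> k (\<lambda>i. y (m i))) < \<epsilon>)" for y :: "nat \<Rightarrow> 'a" and n r
    have "\<exists>y. \<forall>n. P y n (y n)"
    proof (rule dependent_wellorder_choice)
      show "P f n r = P g n r" if "\<And>j. j < n \<Longrightarrow> f j = g j" for r f g n
      proof -
        have eq: "\<Psi> (Suc k) ((\<lambda>i. f (m i))(k := r)) = \<Psi> (Suc k) ((\<lambda>i. g (m i))(k := r))"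
          "\<Psi> k (\<lambda>i. f (m i)) = \<Psi> k (\<lambda>i. g (m i))" if "k < N" "\<forall>i<k. m i < n" for k m
          using that \<open>\<And>j. j < n \<Longrightarrow> f j = g j\<close> by (auto intro!: mform_cong[OF bform_mform[OF \<Psi>_bform]] simp: less_Suc_eq)
        show ?thesis unfolding P_def by (intro conj_cong refl iff_allI imp_cong) (simp only: eq)
      qed
      fix n :: nat and y :: "nat \<Rightarrow> 'a"
      define F where "F = (\<Union>k\<in>{..<N}. (\<lambda>m. slice (\<Psi> (Suc k)) k (\<lambda>i. y (m i))) ` ({..<k} \<rightarrow>\<^sub>E {..<n}))"
      have finF: "finite F" unfolding F_def by (intro finite_UN_I finite_imageI finite_PiE) simp_all
      have FE: "F \<subseteq> dual scale"
      proof
        fix f assume "f \<in> F"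
        then obtain k m where k: "k < N" and f: "f = slice (\<Psi> (Suc k)) k (\<lambda>i. y (m i))"
          unfolding F_def by blast
        have "bform (Suc k) C (\<Psi> (Suc k))" using k by (intro \<Psi>_bform) simp
        then show "f \<in> dual scale" unfolding f by (rule slice_in_dual)
      qed
      from goldstine[OF zb finF FE \<epsilon>] obtain r where r: "norm r \<le> 1"
        "\<And>f. f \<in> F \<Longrightarrow> norm (blinfun_apply f r - z f) < \<epsilon>" by blast
      have "norm (\<Psi> (Suc k) ((\<lambda>i. y (m i))(k := r)) - \<Psi> k (\<lambda>i. y (m i))) < \<epsilon>"
        if k: "k < N" and m: "\<forall>i<k. m i < n" for k m
      proof -
        define m' where "m' = restrict m {..<k}"
        let ?f = "slice (\<Psi> (Suc k)) k (\<lambda>i. y (m' i))"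
        have "m' \<in> {..<k} \<rightarrow>\<^sub>E {..<n}" using m by (auto simp: m'_def)
        then have "?f \<in> F" using k by (auto simp: F_def)
        from r(2)[OF this] have "norm (\<Psi> (Suc k) ((\<lambda>i. y (m' i))(k := r)) - \<Psi> k (\<lambda>i. y (m' i))) < \<epsilon>"
          using k by (simp add: slice_apply[OF \<Psi>_bform] \<Psi>_step)
        moreover have "\<Psi> (Suc k) ((\<lambda>i. y (m' i))(k := r)) = \<Psi> (Suc k) ((\<lambda>i. y (m i))(k := r))"
          "\<Psi> k (\<lambda>i. y (m' i)) = \<Psi> k (\<lambda>i. y (m i))"
          using k by (auto intro!: \<Psi>_cong simp: m'_def less_Suc_eq)
        ultimately show ?thesis by simp
      qed
      then show "\<exists>r. P y n r" using r(1) by (auto simp: P_def)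
    qed
    then obtain y where y: "\<And>n. P y n (y n)" by blast
    have y1: "norm (y n) \<le> 1" for n using y[of n] unfolding P_def by (rule conjunct1)
    have y2: "norm (\<Psi> (Suc k) ((\<lambda>i. y (m i))(k := y n)) - \<Psi> k (\<lambda>i. y (m i))) < \<epsilon>"
      if "k < N" "\<And>i. i < k \<Longrightarrow> m i < n" for n k m
      using y[of n] that unfolding P_def by simp
    \<comment> \<open>For increasing indices every point was chosen after those in the slots before
      it, so each passage from \<open>\<Psi> k\<close> to \<open>\<Psi> (Suc k)\<close> costs at
      most \<open>\<epsilon>\<close>.\<close>
    have increasing: "norm (\<Phi> (\<lambda>i. y (m i)) - L) \<le> real N * \<epsilon>" if m: "strict_mono_on {..<N} m" for m
    proof -
      have "norm (\<Psi> k (\<lambda>i. y (m i)) - L) \<le> real k * \<epsilon>" if "k \<le> N" for k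
        using that
      proof (induction k)
        case 0
        have "\<Psi> 0 (\<lambda>i. y (m i)) = L" unfolding L_def by (rule \<Psi>_cong) auto
        then show ?case by simp
      next
        case (Suc k)
        have "norm (\<Psi> (Suc k) ((\<lambda>i. y (m i))(k := y (m k))) - \<Psi> k (\<lambda>i. y (m i))) < \<epsilon>"
          using Suc.prems m by (intro y2) (auto simp: strict_mono_on_def)
        moreover have "(\<lambda>i. y (m i))(k := y (m k)) = (\<lambda>i. y (m i))" by auto
        ultimately have "norm (\<Psi> (Suc k) (\<lambda>i. y (m i)) - \<Psi> k (\<lambda>i. y (m i))) < \<epsilon>" by simp
        moreover have "norm (\<Psi> k (\<lambda>i. y (m i)) - L) \<le> real k * \<epsilon>" using Suc by simp
        ultimately have "norm ((\<Psi> (Suc k) (\<lambda>i. y (m i)) - \<Psi> k (\<lambda>i. y (m i))) + (\<Psi> k (\<lambda>i. y (m i)) - L)) \<le> \<epsilon> + real k * \<epsilon>"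
          by (intro norm_triangle_le) simp
        then show ?case by (simp add: algebra_simps)
      qed
      from this[of N] show ?thesis by (simp add: \<Psi>_N)
    qed
    \<comment> \<open>Sorting the indices reduces this to the increasing case, by symmetry of
      \<open>\<Phi>\<close>.\<close>
    have injective: "norm (\<Phi> (\<lambda>i. y (m i)) - L) \<le> real N * \<epsilon>" if m: "inj_on m {..<N}" for m
    proof -
      have cardm: "card (m ` {..<N}) = N" using card_image[OF m] by simp
      obtain h where h: "bij_betw h {..<N} (m ` {..<N})" "strict_mono_on {..<N} h"
        using ex_bij_betw_strict_mono_card[of "m ` {..<N}"] unfolding cardm by blast
      define \<sigma> where "\<sigma> i = (if i \<in> {..<N} then inv_into {..<N} m (h i) else i)" for i
      have "bij_betw (inv_into {..<N} m \<circ> h) {..<N} {..<N}"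
        by (rule bij_betw_trans[OF h(1)]) (rule bij_betw_inv_into[OF inj_on_imp_bij_betw[OF m]])
      then have "bij_betw \<sigma> {..<N} {..<N}"
        by (rule bij_betw_cong[THEN iffD1, rotated]) (simp add: \<sigma>_def)
      then have \<sigma>: "\<sigma> permutes {..<N}" by (rule bij_imp_permutes) (simp add: \<sigma>_def)
      have m\<sigma>: "m (\<sigma> i) = h i" if "i < N" for i
        using that bij_betwE[OF h(1)] by (auto simp: \<sigma>_def f_inv_into_f)
      have "\<Phi> (\<lambda>i. y (m i)) = \<Phi> ((\<lambda>i. y (m i)) \<circ> \<sigma>)"
        using sym(2) \<sigma> by (simp add: symmetric_form_def)
      also have "\<dots> = \<Phi> (\<lambda>i. y (h i))"
        using m\<sigma> by (intro mform_cong[OF bform_mform[OF C(2)]]) simp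
      finally show ?thesis using increasing[OF h(2)] by simp
    qed
    have arbitrary: "norm (\<Phi> (\<lambda>i. y (m i)) - L) \<le> 2 * C" for m
    proof -
      have "norm (\<Phi> (\<lambda>i. y (m i))) \<le> C * (\<Prod>i<N. norm (y (m i)))" by (rule bform_bound[OF C(2)])
      also have "\<dots> \<le> C * 1" using C(1) y1 by (intro mult_left_mono prod_le_1) auto
      finally show ?thesis using norm_triangle_ineq4[of "\<Phi> (\<lambda>i. y (m i))" L] L_bound by simp
    qed
    define A where "A = {..<N} \<rightarrow>\<^sub>E {..<n}"
    define I where "I = {m \<in> A. inj_on m {..<N}}"
    have finA: "finite A" unfolding A_def by (intro finite_PiE) simp_all
    have IA: "I \<subseteq> A" by (auto simp: I_def)
    note fin = finA IA finite_subset[OF IA finA]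
    have cardA: "real (card A) = real n ^ N" by (simp add: A_def card_funcsetE)
    \<comment> \<open>Expanded, the value at the sum of \<open>n\<close> points runs over all index
      tuples. The injective ones contribute nearly \<open>L\<close>, the others are a vanishing
      share as \<open>n\<close> grows, and the mean of the points stays in the ball.\<close>
    have "Q (\<Sum>i<n. y i) = (\<Sum>m\<in>A. \<Phi> (\<lambda>i. y (m i)))"
      unfolding A_def using mform_sum_all[OF bform_mform[OF C(2)], of "{..<n}" y] sym(3) by simp
    then have "of_real (real (card A)) * L = Q (\<Sum>i<n. y i) - (\<Sum>m\<in>A. \<Phi> (\<lambda>i. y (m i)) - L)"
      by (simp add: sum_subtractf)
    then have "norm (of_real (real (card A)) * L) \<le> norm (Q (\<Sum>i<n. y i)) + norm (\<Sum>m\<in>A. \<Phi> (\<lambda>i. y (m i)) - L)"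
      by (metis norm_triangle_ineq4)
    moreover have "norm (Q (\<Sum>i<n. y i)) \<le> ?s * real n ^ N"
    proof -
      have "norm (Q (\<Sum>i<n. y i)) \<le> ?s * norm (\<Sum>i<n. y i) ^ N" by (rule norm_hom_poly_le[OF Q])
      also have "\<dots> \<le> ?s * real n ^ N"
      proof (intro mult_left_mono power_mono)
        have "norm (\<Sum>i<n. y i) \<le> (\<Sum>i<n. 1)" using y1 by (intro sum_norm_le)
        then show "norm (\<Sum>i<n. y i) \<le> real n" by simp
        have "norm (Q 0) \<le> ?s"
          unfolding sup_norm_on_def by (intro cSUP_upper hom_poly_bdd_above[OF Q]) auto
        then show "0 \<le> ?s" using norm_ge_zero order_trans by blast
      qed auto
      finally show ?thesis .
    qed
    moreover have "norm (\<Sum>m\<in>A. \<Phi> (\<lambda>i. y (m i)) - L) \<le> real n ^ N * (real N * \<epsilon>) + (real n ^ N - real (card I)) * (2 * C)"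
    proof -
      have "norm (\<Sum>m\<in>A. \<Phi> (\<lambda>i. y (m i)) - L) \<le> (\<Sum>m\<in>A. norm (\<Phi> (\<lambda>i. y (m i)) - L))" by (rule norm_sum)
      also have "\<dots> = (\<Sum>m\<in>A - I. norm (\<Phi> (\<lambda>i. y (m i)) - L)) + (\<Sum>m\<in>I. norm (\<Phi> (\<lambda>i. y (m i)) - L))"
        by (rule sum.subset_diff[OF fin(2,1)])
      also have "\<dots> \<le> (\<Sum>m\<in>A - I. 2 * C) + (\<Sum>m\<in>I. real N * \<epsilon>)"
        by (intro add_mono sum_mono arbitrary injective) (simp add: I_def)
      also have "\<dots> = real (card (A - I)) * (2 * C) + real (card I) * (real N * \<epsilon>)" by simp
      also have "real (card (A - I)) = real n ^ N - real (card I)"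
        using fin by (simp add: card_Diff_subset card_mono of_nat_diff cardA[symmetric])
      also have "real (card I) * (real N * \<epsilon>) \<le> real n ^ N * (real N * \<epsilon>)"
        unfolding cardA[symmetric] using \<epsilon> fin by (intro mult_right_mono) (auto intro: card_mono)
      finally show ?thesis by simp
    qed
    ultimately have "real n ^ N * norm L \<le> real n ^ N * (?s + real N * \<epsilon>) + (real n ^ N - real (card I)) * (2 * C)"
      by (simp add: norm_mult norm_power cardA algebra_simps)
    also have "\<dots> = real n ^ N * (?s + real N * \<epsilon> + 2 * C * (1 - real (card I) / real n ^ N))"
      using n by (simp add: field_simps)
    finally show ?thesis using n by (simp add: I_def A_def)
  qed
  have limit: "norm L \<le> ?s + real N * \<epsilon>" if \<epsilon>: "\<epsilon> > 0" for \<epsilon>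
  proof (rule LIMSEQ_le_const)
    show "(\<lambda>n. ?s + real N * \<epsilon> + 2 * C * (1 - real (card {m \<in> {..<N} \<rightarrow>\<^sub>E {..<n}. inj_on m {..<N}}) / real n ^ N))
        \<longlonglongrightarrow> ?s + real N * \<epsilon>"
      using tendsto_add[OF tendsto_const[of "?s + real N * \<epsilon>"]
          tendsto_mult[OF tendsto_const[of "2 * C"] tendsto_diff[OF tendsto_const[of 1] injective_tuples_ratio[of N]]]]
      by simp
    show "\<exists>n0. \<forall>n\<ge>n0. norm L \<le> ?s + real N * \<epsilon> + 2 * C * (1 - real (card {m \<in> {..<N} \<rightarrow>\<^sub>E {..<n}. inj_on m {..<N}}) / real n ^ N)"
      using main[OF \<epsilon>] by (intro exI[of _ 1]) auto
  qed
  have "norm L \<le> ?s"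
  proof (rule field_le_epsilon)
    fix e :: real assume "e > 0"
    then have "norm L \<le> ?s + real N * (e / (real N + 1))" by (intro limit) simp
    also have "real N * (e / (real N + 1)) \<le> e" using \<open>e > 0\<close> by (simp add: field_simps)
    finally show "norm L \<le> ?s + e" by simp
  qed
  then show ?thesis by (simp add: AB)
qed

end

section \<open>Random functionals\<close>

text \<open>The limit is the supremum of the rationals that the sequence eventually exceeds.
  Convergence is thus a matter of countably many bits becoming constant.\<close>

lemma convergent_if_rational_cuts:
  fixes X :: "nat \<Rightarrow> real"
  assumes bound: "\<And>n. \<bar>X n\<bar> \<le> B"
    and cut: "\<And>q. q \<in> \<rat> \<Longrightarrow> eventually (\<lambda>n. X n > q) sequentially \<or> eventually (\<lambda>n. X n \<le> q) sequentially"
  shows "convergent X"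
proof -
  define A where "A = {q \<in> \<rat>. eventually (\<lambda>n. X n > q) sequentially}"
  obtain q0 where q0: "q0 \<in> \<rat>" "q0 < - B" using Rats_dense_in_real[of "- B - 1" "- B"] by auto
  have "X n > q0" for n using bound[of n] q0(2) by linarith
  then have A_ne: "A \<noteq> {}" using q0 by (auto simp: A_def)
  have A_bdd: "q \<le> B" if "q \<in> A" for q
  proof -
    obtain n where "X n > q" using \<open>q \<in> A\<close> by (auto simp: A_def eventually_sequentially)
    then show ?thesis using bound[of n] by linarith
  qed
  then have bdd: "bdd_above A" by (rule bdd_aboveI)
  have "X \<longlonglongrightarrow> Sup A"
  proof (rule order_tendstoI)
    fix c assume "c < Sup A"
    then obtain q where "q \<in> A" "c < q" using less_cSup_iff[OF A_ne bdd] by auto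
    then show "eventually (\<lambda>n. c < X n) sequentially" by (auto simp: A_def elim: eventually_mono)
  next
    fix c assume "Sup A < c"
    then obtain q where q: "q \<in> \<rat>" "Sup A < q" "q < c" using Rats_dense_in_real by blast
    then have "q \<notin> A" using cSup_upper[OF _ bdd] by force
    then have "eventually (\<lambda>n. X n \<le> q) sequentially" using cut[OF q(1)] q(1) by (auto simp: A_def)
    then show "eventually (\<lambda>n. X n < c) sequentially" using q(3) by (auto elim: eventually_mono)
  qed
  then show ?thesis by (rule convergentI)
qed

section \<open>Coding bit sequences by real numbers\<close>

definition ternary :: "(nat \<Rightarrow> bool) \<Rightarrow> real"
  where "ternary b = (\<Sum>i. of_bool (b i) * (1/3) ^ i)"

lemma summable_ternary: "summable (\<lambda>i. of_bool (b i) * (1/3::real) ^ i)"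
  by (rule summable_comparison_test'[OF summable_geometric[of "1/3"]]) auto

lemma ternary_bounds: "0 \<le> ternary b" "ternary b \<le> 3 / 2"
proof -
  show "0 \<le> ternary b" unfolding ternary_def by (rule suminf_nonneg[OF summable_ternary]) auto
  have "ternary b \<le> (\<Sum>i. (1/3) ^ i)"
    unfolding ternary_def by (rule suminf_le[OF _ summable_ternary summable_geometric]) auto
  then show "ternary b \<le> 3 / 2" by (simp add: suminf_geometric)
qed

text \<open>The first differing digit \<open>j\<close> contributes \<open>(1/3) ^ j\<close> and all
  later ones together at most half of that. Base 2 would leave no such gap. Convergence of codes
  therefore makes every bit eventually constant.\<close>

lemma ternary_eqD:
  assumes "\<bar>ternary b - ternary c\<bar> < (1/3) ^ k / 2"
  shows "b k = c k"
proof (rule ccontr)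
  assume "b k \<noteq> c k"
  define j where "j = (LEAST j. b j \<noteq> c j)"
  have j: "b j \<noteq> c j" unfolding j_def using \<open>b k \<noteq> c k\<close> by (rule LeastI)
  have eq: "b i = c i" if "i < j" for i using not_less_Least[of i "\<lambda>j. b j \<noteq> c j"] that by (auto simp: j_def)
  have "j \<le> k" unfolding j_def using \<open>b k \<noteq> c k\<close> by (rule Least_le)
  define d where "d i = (of_bool (b i) - of_bool (c i)) * (1/3::real) ^ i" for i
  have d: "summable d"
    unfolding d_def left_diff_distrib by (intro summable_diff summable_ternary)
  have "ternary b - ternary c = suminf d"
    unfolding ternary_def d_def left_diff_distrib by (rule suminf_diff[OF summable_ternary summable_ternary])
  also have "\<dots> = (\<Sum>i. d (i + Suc j)) + (\<Sum>i<Suc j. d i)" by (rule suminf_split_initial_segment[OF d])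
  also have "(\<Sum>i<Suc j. d i) = d j" using eq by (simp add: d_def)
  finally have diff: "ternary b - ternary c = (\<Sum>i. d (i + Suc j)) + d j" .
  have "\<bar>\<Sum>i. d (i + Suc j)\<bar> \<le> (\<Sum>i. (1/3) ^ Suc j * (1/3) ^ i)"
    unfolding real_norm_def[symmetric]
    by (intro norm_suminf_le summable_mult summable_geometric) (auto simp: d_def abs_mult power_add)
  also have "\<dots> = (1/3) ^ Suc j * (\<Sum>i. (1/3) ^ i)"
    by (rule suminf_mult) (simp add: summable_geometric)
  also have "\<dots> = (1/3) ^ j / 2" by (simp add: suminf_geometric)
  finally have "\<bar>\<Sum>i. d (i + Suc j)\<bar> \<le> (1/3) ^ j / 2" .
  moreover have "\<bar>d j\<bar> = (1/3) ^ j" using j by (auto simp: d_def)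
  ultimately have "(1/3) ^ j / 2 \<le> \<bar>ternary b - ternary c\<bar>" unfolding diff by linarith
  moreover have "(1/3::real) ^ k \<le> (1/3) ^ j" using \<open>j \<le> k\<close> by (intro power_decreasing) auto
  ultimately show False using assms by linarith
qed

text \<open>
  The sample points are coded by real numbers whose ternary digits record on which side of every
  rational cut the functions lie, so that Helly's selection theorem and Skorohod's
  representation theorem for real distributions apply. The equality tests in the coding make
  it injective on the countable union of the supports.
\<close>

theorem skorohod_countable_coordinates:
  fixes p :: "nat \<Rightarrow> 'p pmf" and a :: "nat \<Rightarrow> 'p \<Rightarrow> real"
  assumes bounded: "\<And>n x. \<bar>a n x\<bar> \<le> B n"
  obtains \<Omega> :: "real measure" and Z :: "nat \<Rightarrow> real \<Rightarrow> 'p" and r :: "nat \<Rightarrow> nat"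
  where "prob_space \<Omega>" "strict_mono r"
    and "\<And>m. Z m \<in> measurable \<Omega> (count_space UNIV)"
    and "\<And>m. distr \<Omega> (count_space UNIV) (Z m) = measure_pmf (p (r m))"
    and "\<And>n \<omega>. convergent (\<lambda>m. a n (Z m \<omega>))"
proof -
  define S where "S = (\<Union>m. set_pmf (p m))"
  have S: "countable S" "S \<noteq> {}" by (auto simp: S_def set_pmf_not_empty)
  define s where "s = from_nat_into S"
  have s: "range s = S" unfolding s_def using S by (simp add: range_from_nat_into)
  define rat where "rat = from_nat_into (\<rat> :: real set)"
  have rat: "range rat = \<rat>" unfolding rat_def using countable_rat Rats_0 by (subst range_from_nat_into) auto
  \<comment> \<open>An index decodes either to \<open>n\<close>, the test for the sample point
    \<open>s n\<close>, or to a pair, the comparison of a coordinate with a rational number.\<close>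
  define bit where "bit x i = (case sum_decode i of
      Inl n \<Rightarrow> x = s n
    | Inr k \<Rightarrow> (case prod_decode k of (n, q) \<Rightarrow> a n x > rat q))" for x i
  define \<kappa> where "\<kappa> x = ternary (bit x)" for x
  have inj: "x = y" if "\<kappa> x = \<kappa> y" "x \<in> S" for x y
  proof -
    obtain n where "x = s n" using \<open>x \<in> S\<close> s by auto
    then have "bit x (sum_encode (Inl n))" by (simp add: bit_def)
    moreover have "bit x i = bit y i" for i
      using that(1) by (intro ternary_eqD) (simp add: \<kappa>_def)
    ultimately have "bit y (sum_encode (Inl n))" by simp
    then show ?thesis using \<open>x = s n\<close> by (simp add: bit_def)
  qed
  then have inj_\<kappa>: "inj_on \<kappa> S" by (auto simp: inj_on_def)
  define \<mu> where "\<mu> m = distr (measure_pmf (p m)) borel \<kappa>" for m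
  have \<mu>: "real_distribution (\<mu> m)" for m
  proof -
    have "prob_space (\<mu> m)" unfolding \<mu>_def by (rule prob_space.prob_space_distr) (auto intro: measure_pmf.prob_space_axioms)
    then show ?thesis by (auto simp: real_distribution_def real_distribution_axioms_def \<mu>_def)
  qed
  have "tight \<mu>"
    unfolding tight_def
  proof (intro conjI allI impI \<mu>)
    fix e :: real assume "e > 0"
    \<comment> \<open>All codes lie between 0 and 3/2, so the laws live on one bounded
      interval.\<close>
    have "measure (\<mu> m) {-1<..2} = 1" for m
    proof -
      have "-1 < \<kappa> x \<and> \<kappa> x \<le> 2" for x using ternary_bounds[of "bit x"] by (simp add: \<kappa>_def)
      then have "\<kappa> -` {-1<..2} = UNIV" by auto
      then show ?thesis by (simp add: \<mu>_def measure_distr)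
    qed
    then show "\<exists>a b. a < b \<and> (\<forall>m. 1 - e < measure (\<mu> m) {a<..b})"
      using \<open>e > 0\<close> by (intro exI[of _ "-1"] exI[of _ 2]) auto
  qed
  from tight_imp_convergent_subsubsequence[OF this strict_mono_id]
  obtain r M where r: "strict_mono r" and M: "real_distribution M" and conv: "weak_conv_m (\<mu> \<circ> id \<circ> r) M" by blast
  have "weak_conv_m (\<lambda>m. \<mu> (r m)) M" using conv by (simp add: o_def)
  from Skorohod[OF \<mu> M this] obtain \<Omega> :: "real measure" and Y Y' where \<Omega>: "prob_space \<Omega>"
    and Y[measurable]: "\<And>n. Y n \<in> measurable \<Omega> borel" and law: "\<And>n. distr \<Omega> borel (Y n) = \<mu> (r n)"
    and lim: "\<And>x. x \<in> space \<Omega> \<Longrightarrow> (\<lambda>n. Y n x) \<longlonglongrightarrow> Y' x"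
    by blast
  define K where "K = \<kappa> ` S"
  have countable_K: "countable K" unfolding K_def using S(1) by (rule countable_image)
  have K[measurable]: "K \<in> sets borel" by (rule sets.countable[OF _ countable_K]) simp
  \<comment> \<open>The set \<open>K\<close> of codes is countable, hence Borel. Off it, an event of
    probability 0 for every \<open>Y n\<close>, some sample point is chosen.\<close>
  define dec where "dec y = (if y \<in> K then inv_into S \<kappa> y else s 0)" for y
  have dec_\<kappa>: "dec (\<kappa> x) = x" if "x \<in> S" for x using that inj_\<kappa> by (simp add: dec_def K_def)
  have \<kappa>_dec: "\<kappa> (dec y) = y" if "y \<in> K" for y using that by (simp add: dec_def K_def f_inv_into_f)
  have dec[measurable]: "dec \<in> measurable borel (count_space UNIV)"
    by (rule measurable_discrete_difference[where X = K and f = "\<lambda>_. s 0"]) (auto simp: dec_def countable_K)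
  define good where "good \<omega> \<longleftrightarrow> \<omega> \<in> space \<Omega> \<and> (\<forall>n. Y n \<omega> \<in> K)" for \<omega>
  \<comment> \<open>One good event serves all \<open>n\<close>. Off it the points do not depend on
    \<open>m\<close>, so convergence holds everywhere and not only almost everywhere.\<close>
  define Z where "Z m \<omega> = (if good \<omega> then dec (Y m \<omega>) else s 0)" for m \<omega>
  have AE_good: "AE \<omega> in \<Omega>. good \<omega>"
  proof -
    have "AE \<omega> in \<Omega>. Y n \<omega> \<in> K" for n
    proof -
      have "\<kappa> x \<in> K" if "x \<in> set_pmf (p m)" for x m using that by (auto simp: K_def S_def)
      then have "AE y in \<mu> (r n). y \<in> K"
        unfolding \<mu>_def using K by (subst AE_distr_iff) (auto simp: AE_measure_pmf_iff)
      then show ?thesis unfolding law[symmetric] by (subst (asm) AE_distr_iff) auto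
    qed
    then have "AE \<omega> in \<Omega>. \<forall>n. Y n \<omega> \<in> K" by (simp add: AE_all_countable)
    then show ?thesis by (auto simp: good_def)
  qed
  have Z_meas: "Z m \<in> measurable \<Omega> (count_space UNIV)" for m
    unfolding Z_def good_def by measurable
  show ?thesis
  proof (rule that[OF \<Omega> r Z_meas])
    fix m
    have "distr \<Omega> (count_space UNIV) (Z m) = distr \<Omega> (count_space UNIV) (\<lambda>\<omega>. dec (Y m \<omega>))"
    proof (rule distr_cong_AE)
      show "AE \<omega> in \<Omega>. Z m \<omega> = dec (Y m \<omega>)" using AE_good by eventually_elim (simp add: Z_def)
    qed (use Z_meas in auto)
    also have "\<dots> = distr (distr \<Omega> borel (Y m)) (count_space UNIV) dec"
      by (subst distr_distr) (auto simp: o_def)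
    also have "\<dots> = distr (measure_pmf (p (r m))) (count_space UNIV) (\<lambda>x. dec (\<kappa> x))"
      unfolding law \<mu>_def by (subst distr_distr) (auto simp: o_def)
    also have "\<dots> = measure_pmf (map_pmf (\<lambda>x. dec (\<kappa> x)) (p (r m)))" by (simp add: map_pmf_rep_eq)
    also have "map_pmf (\<lambda>x. dec (\<kappa> x)) (p (r m)) = map_pmf (\<lambda>x. x) (p (r m))"
      by (intro map_pmf_cong refl dec_\<kappa>) (auto simp: S_def)
    finally show "distr \<Omega> (count_space UNIV) (Z m) = measure_pmf (p (r m))" by simp
  next
    fix n \<omega>
    show "convergent (\<lambda>m. a n (Z m \<omega>))"
    proof (cases "good \<omega>")
      case False
      then show ?thesis by (simp add: Z_def convergent_const)
    next
      case True
      have \<kappa>Z: "\<kappa> (Z m \<omega>) = Y m \<omega>" for m using True \<kappa>_dec by (simp add: Z_def good_def)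
      have "Cauchy (\<lambda>m. Y m \<omega>)" using lim[of \<omega>] True by (auto simp: good_def intro: LIMSEQ_imp_Cauchy)
      \<comment> \<open>The limit of the codes need not be a code. It suffices that they form a
        Cauchy sequence, which freezes every bit.\<close>
      have const: "\<exists>m0. \<forall>m\<ge>m0. bit (Z m \<omega>) i = bit (Z m0 \<omega>) i" for i
      proof -
        have "(1/3::real) ^ i / 2 > 0" by simp
        from CauchyD[OF \<open>Cauchy (\<lambda>m. Y m \<omega>)\<close> this]
        obtain m0 where "\<And>m. m \<ge> m0 \<Longrightarrow> \<bar>Y m \<omega> - Y m0 \<omega>\<bar> < (1/3) ^ i / 2" by auto
        then show ?thesis by (intro exI[of _ m0] allI impI ternary_eqD) (simp add: \<kappa>_def[symmetric] \<kappa>Z)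
      qed
      show ?thesis
      proof (rule convergent_if_rational_cuts[OF bounded])
        fix q :: real assume "q \<in> \<rat>"
        then obtain k where k: "q = rat k" using rat by auto
        define i where "i = sum_encode (Inr (prod_encode (n, k)))"
        have bit: "bit x i \<longleftrightarrow> a n x > q" for x by (simp add: bit_def i_def k)
        obtain m0 where "\<And>m. m \<ge> m0 \<Longrightarrow> bit (Z m \<omega>) i = bit (Z m0 \<omega>) i" using const by blast
        then show "(\<forall>\<^sub>F m in sequentially. a n (Z m \<omega>) > q) \<or> (\<forall>\<^sub>F m in sequentially. a n (Z m \<omega>) \<le> q)"
          unfolding bit eventually_sequentially by (metis not_less)
      qed
    qed
  qed
qed

section \<open>The integral formula\<close>

text \<open>Dominated convergence applied to the partial sums; the single terms are integrable as
  differences of partial sums.\<close>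

lemma (in prob_space) sums_integral_bounded:
  fixes u :: "nat \<Rightarrow> 'a \<Rightarrow> 'b::{banach, second_countable_topology}"
  assumes u: "\<And>k. u k \<in> borel_measurable M"
    and bound: "\<And>n \<omega>. \<omega> \<in> space M \<Longrightarrow> norm (\<Sum>k<n. u k \<omega>) \<le> K"
    and lim: "\<And>\<omega>. \<omega> \<in> space M \<Longrightarrow> (\<lambda>n. \<Sum>k<n. u k \<omega>) \<longlonglongrightarrow> S \<omega>"
  shows "S \<in> borel_measurable M" "(\<lambda>k. integral\<^sup>L M (u k)) sums integral\<^sup>L M S"
proof -
  have sum_meas: "(\<lambda>\<omega>. \<Sum>k<n. u k \<omega>) \<in> borel_measurable M" for n
    using u by (intro borel_measurable_sum)
  show S: "S \<in> borel_measurable M" by (rule borel_measurable_LIMSEQ_metric[OF sum_meas lim])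
  have int_sum: "integrable M (\<lambda>\<omega>. \<Sum>k<n. u k \<omega>)" for n
    by (rule integrable_const_bound[where B = K]) (use sum_meas bound in auto)
  have int: "integrable M (u k)" for k
    using Bochner_Integration.integrable_diff[OF int_sum[of "Suc k"] int_sum[of k]] by simp
  have "(\<lambda>n. integral\<^sup>L M (\<lambda>\<omega>. \<Sum>k<n. u k \<omega>)) \<longlonglongrightarrow> integral\<^sup>L M S"
    by (rule integral_dominated_convergence[where w = "\<lambda>_. K"]) (use sum_meas S bound lim in auto)
  then show "(\<lambda>k. integral\<^sup>L M (u k)) sums integral\<^sup>L M S"
    unfolding sums_def using int by simp
qed

section \<open>Greedy expansion along a dense sequence\<close>

primrec greedy_residual :: "(nat \<Rightarrow> 'v::real_normed_vector) \<Rightarrow> 'v \<Rightarrow> nat \<Rightarrow> 'v"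
  where
    "greedy_residual e f 0 = f"
  | "greedy_residual e f (Suc k) =
      (if norm (greedy_residual e f k - e k) \<le> norm (greedy_residual e f k) / 2
       then greedy_residual e f k - e k else greedy_residual e f k)"

text \<open>Whether \<open>e k\<close> is used depends on \<open>f\<close> only through norms of
  \<open>greedy_residual e f k\<close> and of its difference from \<open>e k\<close>. For a random
  \<open>f\<close> the event of a hit is thereby measurable, while the vectors \<open>e k\<close>
  stay deterministic.\<close>

definition greedy_hit :: "(nat \<Rightarrow> 'v::real_normed_vector) \<Rightarrow> 'v \<Rightarrow> nat \<Rightarrow> bool"
  where "greedy_hit e f k \<longleftrightarrow> norm (greedy_residual e f k - e k) \<le> norm (greedy_residual e f k) / 2"

lemma greedy_sum:
  "f = (\<Sum>i<k. if greedy_hit e f i then e i else 0) + greedy_residual e f k"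
  by (induction k) (auto simp: greedy_hit_def)

text \<open>At a hit \<open>norm (e k)\<close> is at most the sum of the old and the new residual
  norm. As the new one is at most half of the old one, the sum is at most 3 times their difference,
  and the differences telescope.\<close>

lemma greedy_sum_norm:
  "(\<Sum>i<k. if greedy_hit e f i then norm (e i) else 0) \<le> 3 * (norm f - norm (greedy_residual e f k))"
proof (induction k)
  case (Suc k)
  show ?case
  proof (cases "greedy_hit e f k")
    case True
    let ?r = "greedy_residual e f k"
    have r: "greedy_residual e f (Suc k) = ?r - e k" "norm (?r - e k) \<le> norm ?r / 2"
      using True by (auto simp: greedy_hit_def)
    have "norm (e k) \<le> norm ?r + norm (?r - e k)"
      using norm_triangle_ineq4[of ?r "?r - e k"] by simp
    then show ?thesis using Suc True r by simp
  next
    case False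
    then have "greedy_residual e f (Suc k) = greedy_residual e f k" by (simp add: greedy_hit_def)
    then show ?thesis using Suc False by (simp del: greedy_residual.simps)
  qed
qed simp

text \<open>Without a hit from \<open>k\<close> on, a nonzero residual would stay constant, but then
  density of the tail provides an index that is a hit. So the norm is halved again and
  again.\<close>

lemma greedy_residual_tendsto_0:
  assumes E: "f \<in> E" "\<And>k. e k \<in> E" "\<And>x y. x \<in> E \<Longrightarrow> y \<in> E \<Longrightarrow> x - y \<in> E"
    and dense: "\<And>x \<delta> k. x \<in> E \<Longrightarrow> \<delta> > 0 \<Longrightarrow> \<exists>i\<ge>k. norm (x - e i) \<le> \<delta>"
  shows "greedy_residual e f \<longlonglongrightarrow> 0"
proof -
  let ?r = "greedy_residual e f"
  have rE: "?r k \<in> E" for k by (induction k) (use E in auto)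
  have step: "norm (?r (Suc k)) \<le> norm (?r k)" for k
    by (auto intro: order_trans[of _ "norm (greedy_residual e f k) / 2"])
  have dec: "norm (?r j) \<le> norm (?r i)" if "i \<le> j" for i j
    using lift_Suc_antimono_le[of "\<lambda>k. norm (?r k)", OF step that] .
  have half: "\<exists>j\<ge>k. norm (?r j) \<le> norm (?r k) / 2" for k
  proof (cases "?r k = 0")
    case False
    then obtain i where i: "i \<ge> k" "norm (?r k - e i) \<le> norm (?r k) / 2"
      using dense[OF rE, of "norm (?r k) / 2" k k] by auto
    show ?thesis
    proof (cases "\<exists>j\<ge>k. greedy_hit e f j")
      case True
      then obtain j where j: "j \<ge> k" "greedy_hit e f j" by blast
      then have "norm (?r (Suc j)) \<le> norm (?r j) / 2" by (simp add: greedy_hit_def)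
      also have "\<dots> \<le> norm (?r k) / 2" using dec[OF j(1)] by simp
      finally show ?thesis using j(1) by (intro exI[of _ "Suc j"]) simp
    next
      case no_hit: False
      have const: "?r j = ?r k" if "j \<ge> k" for j
        using that
      proof (induction j rule: dec_induct)
        case (step n)
        then have "\<not> greedy_hit e f n" using no_hit by blast
        then show ?case using step.IH by (simp add: greedy_hit_def)
      qed simp
      have "greedy_hit e f i" using i(2) unfolding greedy_hit_def const[OF i(1)] .
      then show ?thesis using no_hit i(1) by blast
    qed
  next
    case True
    then show ?thesis by (intro exI[of _ k]) simp
  qed
  have small: "\<exists>k. norm (?r k) \<le> norm f / 2 ^ n" for n
  proof (induction n)
    case (Suc n)
    then obtain k where "norm (?r k) \<le> norm f / 2 ^ n" by blast
    moreover obtain j where "norm (?r j) \<le> norm (?r k) / 2" using half by blast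
    ultimately show ?case by (intro exI[of _ j]) simp
  qed (auto intro: exI[of _ 0])
  show ?thesis
  proof (rule LIMSEQ_I)
    fix \<delta> :: real assume "\<delta> > 0"
    have "(\<lambda>n. norm f * (1/2) ^ n) \<longlonglongrightarrow> norm f * 0"
      by (intro tendsto_intros LIMSEQ_power_zero) simp
    then have "eventually (\<lambda>n. norm f * (1/2) ^ n < \<delta>) sequentially"
      using \<open>\<delta> > 0\<close> by (intro order_tendstoD) auto
    then obtain n where n: "norm f / 2 ^ n < \<delta>"
      by (auto simp: eventually_sequentially power_divide)
    obtain k where "norm (?r k) \<le> norm f / 2 ^ n" using small by blast
    then show "\<exists>k. \<forall>j\<ge>k. norm (?r j - 0) < \<delta>"
      using dec n by (intro exI[of _ k]) (auto intro: le_less_trans order_trans)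
  qed
qed

section \<open>Measurability in a separable dual\<close>

context normed_space_over
begin

text \<open>Enumerating pairs and forgetting the second component repeats every vector infinitely
  often, so each tail is still dense, as the greedy expansion requires.\<close>

lemma separable_dual_dense_sequence:
  assumes "separable_space (top_of_set (dual scale))"
  obtains e :: "nat \<Rightarrow> 'a \<Rightarrow>\<^sub>L 'k" where "\<And>k. e k \<in> dual scale"
    and "\<And>f \<delta> k. f \<in> dual scale \<Longrightarrow> \<delta> > 0 \<Longrightarrow> \<exists>i\<ge>k. norm (f - e i) \<le> \<delta>"
proof -
  obtain U where U: "countable U" "U \<subseteq> dual scale" "top_of_set (dual scale) closure_of U = dual scale"
    using assms by (auto simp: separable_space_def)
  have dense: "\<exists>u\<in>U. norm (f - u) < \<delta>" if f: "f \<in> dual scale" and \<delta>: "\<delta> > 0" for f \<delta>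
  proof -
    have "openin (top_of_set (dual scale)) (dual scale \<inter> ball f \<delta>)" by (simp add: openin_open_Int)
    moreover have "f \<in> top_of_set (dual scale) closure_of U" using U(3) f by simp
    ultimately obtain u where "u \<in> U" "u \<in> ball f \<delta>"
      using f \<delta> unfolding in_closure_of by (metis IntE IntI centre_in_ball)
    then show ?thesis by (auto simp: dist_norm)
  qed
  then have "U \<noteq> {}" using dual_closed(1) zero_less_one by blast
  define d where "d = from_nat_into U"
  have d: "range d = U" unfolding d_def using U(1) \<open>U \<noteq> {}\<close> by (simp add: range_from_nat_into)
  define e where "e k = d (fst (prod_decode k))" for k
  show ?thesis
  proof (rule that[of e])
    show "e k \<in> dual scale" for k using U(2) d by (auto simp: e_def)
    fix f and \<delta> :: real and k assume "f \<in> dual scale" "\<delta> > 0"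
    then obtain u where "u \<in> U" "norm (f - u) < \<delta>" using dense by blast
    then obtain n where n: "norm (f - d n) < \<delta>" using d by auto
    have "k \<le> prod_encode (n, k)" by (rule le_prod_encode_2)
    then show "\<exists>i\<ge>k. norm (f - e i) \<le> \<delta>"
      using n by (intro exI[of _ "prod_encode (n, k)"]) (simp add: e_def)
  qed
qed

lemma separable_dual_norming_sequence:
  assumes "separable_space (top_of_set (dual scale))"
  obtains v where "\<And>l::nat. norm (v l) \<le> 1"
    and "\<And>f r. f \<in> dual scale \<Longrightarrow> (\<And>l. norm (blinfun_apply f (v l)) \<le> r) \<Longrightarrow> norm f \<le> r"
proof -
  obtain e :: "nat \<Rightarrow> 'a \<Rightarrow>\<^sub>L 'k" where e: "\<And>k. e k \<in> dual scale"
    and dense: "\<And>f \<delta> k. f \<in> dual scale \<Longrightarrow> \<delta> > 0 \<Longrightarrow> \<exists>i\<ge>k. norm (f - e i) \<le> \<delta>"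
    using separable_dual_dense_sequence[OF assms] by metis
  have "\<exists>x. norm x \<le> 1 \<and> norm (e n) - inverse (real (Suc k)) \<le> norm (blinfun_apply (e n) x)" for n k
  proof (rule ccontr)
    assume "\<not> ?thesis"
    then have "norm (blinfun_apply (e n) x) \<le> norm (e n) - inverse (real (Suc k))" if "norm x \<le> 1" for x
      using that by (meson less_imp_le not_le)
    then have "norm (e n) \<le> norm (e n) - inverse (real (Suc k))" by (rule norm_dual_le[OF e])
    then show False by simp
  qed
  then obtain x where x: "\<And>n k. norm (x n k) \<le> 1"
    "\<And>n k. norm (e n) - inverse (real (Suc k)) \<le> norm (blinfun_apply (e n) (x n k))" by metis
  show ?thesis
  proof (rule that[of "\<lambda>l. case_prod x (prod_decode l)"])
    show "norm (case_prod x (prod_decode l)) \<le> 1" for l using x by (auto split: prod.split)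
    fix f r assume f: "f \<in> dual scale" and *: "\<And>l. norm (blinfun_apply f (case_prod x (prod_decode l))) \<le> r"
    have r: "norm (blinfun_apply f (x n k)) \<le> r" for n k using *[of "prod_encode (n, k)"] by simp
    show "norm f \<le> r"
    proof (rule field_le_epsilon)
      fix \<delta> :: real assume "\<delta> > 0"
      then obtain n where n: "norm (f - e n) \<le> \<delta> / 3" using dense[OF f, of "\<delta> / 3"] by auto
      obtain k where k: "inverse (real (Suc k)) < \<delta> / 3" using reals_Archimedean[of "\<delta> / 3"] \<open>\<delta> > 0\<close> by auto
      have "norm f \<le> norm (e n) + norm (f - e n)" by (metis add.commute diff_add_cancel norm_triangle_ineq)
      also have "norm (e n) \<le> norm (blinfun_apply (e n) (x n k)) + inverse (real (Suc k))" using x(2)[of n k] by simp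
      also have "blinfun_apply (e n) (x n k) = blinfun_apply f (x n k) - blinfun_apply (f - e n) (x n k)"
        by (simp add: blinfun.diff_left)
      also have "norm \<dots> \<le> r + norm (f - e n)"
      proof -
        have "norm (blinfun_apply (f - e n) (x n k)) \<le> norm (f - e n) * norm (x n k)" by (rule norm_blinfun)
        also have "\<dots> \<le> norm (f - e n) * 1" using x(1) by (intro mult_left_mono) auto
        finally show ?thesis using r[of n k] norm_triangle_ineq4 by (smt (verit))
      qed
      finally show "norm f \<le> r + \<delta>" using n k by simp
    qed
  qed
qed

text \<open>A norming sequence of points turns \<open>norm f \<le> r\<close> into countably many
  conditions on values of \<open>f\<close>, so measurability of the evaluations is enough.\<close>

lemma borel_measurable_norm_dual:
  assumes sep: "separable_space (top_of_set (dual scale))"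
    and g: "\<And>\<omega>. \<omega> \<in> space M \<Longrightarrow> g \<omega> \<in> dual scale"
    and meas: "\<And>v. (\<lambda>\<omega>. blinfun_apply (g \<omega>) v) \<in> borel_measurable M"
  shows "(\<lambda>\<omega>. norm (g \<omega>)) \<in> borel_measurable M"
proof -
  obtain v where v: "\<And>l::nat. norm (v l) \<le> 1"
    "\<And>f r. f \<in> dual scale \<Longrightarrow> (\<And>l. norm (blinfun_apply f (v l)) \<le> r) \<Longrightarrow> norm f \<le> r"
    using separable_dual_norming_sequence[OF sep] by metis
  have "norm (blinfun_apply f (v l)) \<le> norm f" for f l
    using order_trans[OF norm_blinfun[of f "v l"] mult_left_mono[OF v(1)[of l] norm_ge_zero[of f]]] by simp
  then have iff: "norm f \<le> r \<longleftrightarrow> (\<forall>l. norm (blinfun_apply f (v l)) \<le> r)" if "f \<in> dual scale" for f r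
    using v(2)[OF that] order_trans by blast
  note meas[measurable]
  show ?thesis
  proof (rule borel_measurableI_le)
    fix r
    have "{\<omega> \<in> space M. norm (g \<omega>) \<le> r} = {\<omega> \<in> space M. \<forall>l. norm (blinfun_apply (g \<omega>) (v l)) \<le> r}"
      using iff g by blast
    also have "\<dots> \<in> sets M" by measurable
    finally show "{\<omega> \<in> space M. norm (g \<omega>) \<le> r} \<in> sets M" .
  qed
qed

text \<open>
  Two nuclear representations of one operator on the dual are compared: on the left the greedy
  expansion of \<open>g\<close> along a dense sequence turns the integral into a series.
\<close>

theorem integral_trace_eq:
  assumes AP: "approximation_property dual_scale (dual scale)"
    and sep: "separable_space (top_of_set (dual scale))"
    and M: "prob_space M"
    and \<xi>: "\<And>\<omega>. \<omega> \<in> space M \<Longrightarrow> bounded_functional 1 (\<xi> \<omega>)"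
    and \<xi>_meas: "\<And>f. f \<in> dual scale \<Longrightarrow> (\<lambda>\<omega>. \<xi> \<omega> f) \<in> borel_measurable M"
    and w: "w \<in> borel_measurable M" "\<And>\<omega>. \<omega> \<in> space M \<Longrightarrow> norm (w \<omega>) \<le> W"
    and g: "\<And>\<omega>. \<omega> \<in> space M \<Longrightarrow> g \<omega> \<in> dual scale" "\<And>\<omega>. \<omega> \<in> space M \<Longrightarrow> norm (g \<omega>) \<le> C"
    and g_meas: "\<And>v. (\<lambda>\<omega>. blinfun_apply (g \<omega>) v) \<in> borel_measurable M"
    and c: "summable (\<lambda>j. norm (c j))" and x: "\<And>j. norm (x j) \<le> 1"
    and \<psi>: "\<And>j. \<psi> j \<in> dual scale" "\<And>j. norm (\<psi> j) \<le> C"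
    and eq: "\<And>f v. f \<in> dual scale \<Longrightarrow>
      integral\<^sup>L M (\<lambda>\<omega>. w \<omega> * \<xi> \<omega> f * blinfun_apply (g \<omega>) v) =
        (\<Sum>j. c j * blinfun_apply f (x j) * blinfun_apply (\<psi> j) v)"
  shows "(\<lambda>\<omega>. \<xi> \<omega> (g \<omega>)) \<in> borel_measurable M"
    and "integral\<^sup>L M (\<lambda>\<omega>. w \<omega> * \<xi> \<omega> (g \<omega>)) = (\<Sum>j. c j * blinfun_apply (\<psi> j) (x j))"
proof -
  interpret prob_space M by fact
  note \<xi>D = bounded_functionalD[OF \<xi>]
  obtain \<omega>0 where \<omega>0: "\<omega>0 \<in> space M" using not_empty by blast
  have W: "0 \<le> W" using w(2)[OF \<omega>0] norm_ge_zero order_trans by blast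
  have C: "0 \<le> C" using g(2)[OF \<omega>0] norm_ge_zero order_trans by blast
  obtain e :: "nat \<Rightarrow> 'a \<Rightarrow>\<^sub>L 'k" where e: "\<And>k. e k \<in> dual scale"
    and dense: "\<And>f \<delta> k. f \<in> dual scale \<Longrightarrow> \<delta> > 0 \<Longrightarrow> \<exists>i\<ge>k. norm (f - e i) \<le> \<delta>"
    using separable_dual_dense_sequence[OF sep] by metis
  have res_dual: "greedy_residual e f k \<in> dual scale" if "f \<in> dual scale" for f k
    by (induction k) (use that e in \<open>auto intro: dual_closed\<close>)
  define H where "H k = {\<omega> \<in> space M. greedy_hit e (g \<omega>) k}" for k
  \<comment> \<open>Hits and residuals are measurable by a joint induction: a hit compares norms of
    residuals, and the next residual is selected by the hit.\<close>
  have H_meas: "H k \<in> sets M \<and> (\<forall>v. (\<lambda>\<omega>. blinfun_apply (greedy_residual e (g \<omega>) k) v) \<in> borel_measurable M)" for k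
  proof -
    have hit: "H k \<in> sets M" if "\<forall>v. (\<lambda>\<omega>. blinfun_apply (greedy_residual e (g \<omega>) k) v) \<in> borel_measurable M" for k
    proof -
      note that[rule_format, measurable]
      have [measurable]: "(\<lambda>\<omega>. norm (greedy_residual e (g \<omega>) k)) \<in> borel_measurable M"
        "(\<lambda>\<omega>. norm (greedy_residual e (g \<omega>) k - e k)) \<in> borel_measurable M"
        by (rule borel_measurable_norm_dual[OF sep];
            use that g e in \<open>auto intro!: res_dual dual_closed(3) simp: blinfun.diff_left\<close>)+
      show ?thesis unfolding H_def greedy_hit_def by measurable
    qed
    have "\<forall>v. (\<lambda>\<omega>. blinfun_apply (greedy_residual e (g \<omega>) k) v) \<in> borel_measurable M"
    proof (induction k)
      case (Suc k)
      note Suc.IH[rule_format, measurable] and hit[OF Suc.IH, measurable]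
      show ?case
      proof
        fix v
        have "(\<lambda>\<omega>. if \<omega> \<in> H k then blinfun_apply (greedy_residual e (g \<omega>) k) v - blinfun_apply (e k) v
            else blinfun_apply (greedy_residual e (g \<omega>) k) v) \<in> borel_measurable M" by measurable
        then show "(\<lambda>\<omega>. blinfun_apply (greedy_residual e (g \<omega>) (Suc k)) v) \<in> borel_measurable M"
          by (rule measurable_cong[THEN iffD1, rotated]) (auto simp: H_def greedy_hit_def blinfun.diff_left)
      qed
    qed (use g_meas in simp)
    then show ?thesis using hit by blast
  qed
  then have H[measurable]: "H k \<in> sets M" for k by blast
  note w(1)[measurable] and \<xi>_meas[measurable] and g_meas[measurable]
  have hit_iff: "greedy_hit e (g \<omega>) k \<longleftrightarrow> \<omega> \<in> H k" if "\<omega> \<in> space M" for \<omega> k using that by (simp add: H_def)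
  have sum_e: "(\<Sum>i<k. indicat_real (H i) \<omega> * norm (e i)) \<le> 3 * C" if \<omega>: "\<omega> \<in> space M" for \<omega> k
  proof -
    have "(\<Sum>i<k. indicat_real (H i) \<omega> * norm (e i)) = (\<Sum>i<k. if greedy_hit e (g \<omega>) i then norm (e i) else 0)"
      by (intro sum.cong) (auto simp: hit_iff[OF \<omega>])
    also have "\<dots> \<le> 3 * (norm (g \<omega>) - norm (greedy_residual e (g \<omega>) k))" by (rule greedy_sum_norm)
    also have "\<dots> \<le> 3 * C"
    proof (rule mult_left_mono)
      show "norm (g \<omega>) - norm (greedy_residual e (g \<omega>) k) \<le> C"
        using g(2)[OF \<omega>] norm_ge_zero[of "greedy_residual e (g \<omega>) k"] by (rule diff_le_eq[THEN iffD2, OF add_increasing2, rotated])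
    qed simp
    finally show ?thesis .
  qed
  have res_0: "greedy_residual e (g \<omega>) \<longlonglongrightarrow> 0" if "\<omega> \<in> space M" for \<omega>
    by (rule greedy_residual_tendsto_0[where E = "dual scale"]) (use g that e dense in \<open>auto intro: dual_closed\<close>)
  \<comment> \<open>The greedy partial sums, with the random choices moved into indicators of fixed
    events.\<close>
  define G where "G n \<omega> = (\<Sum>i<n. dual_scale (indicator (H i) \<omega>) (e i))" for n \<omega>
  have G: "G n \<omega> = g \<omega> - greedy_residual e (g \<omega>) n" if \<omega>: "\<omega> \<in> space M" for n \<omega>
  proof -
    have "G n \<omega> = (\<Sum>i<n. if greedy_hit e (g \<omega>) i then e i else 0)"
      unfolding G_def by (intro sum.cong refl blinfun_eqI) (auto simp: hit_iff[OF \<omega>] zero_blinfun.rep_eq)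
    then show ?thesis using greedy_sum[of "g \<omega>" e n] by (simp add: algebra_simps)
  qed
  have G_norm: "norm (G n \<omega>) \<le> 3 * C" if \<omega>: "\<omega> \<in> space M" for n \<omega>
  proof -
    have "norm (G n \<omega>) \<le> (\<Sum>i<n. indicat_real (H i) \<omega> * norm (e i))"
      unfolding G_def by (intro sum_norm_le) (auto simp: norm_dual_scale indicator_def)
    then show ?thesis using sum_e[OF \<omega>] order_trans by blast
  qed
  have G_dual: "G n \<omega> \<in> dual scale" for n \<omega>
    unfolding G_def by (intro dual_sum dual_closed e)
  have \<xi>_G: "(\<Sum>k<n. w \<omega> * \<xi> \<omega> (e k) * indicator (H k) \<omega>) = w \<omega> * \<xi> \<omega> (G n \<omega>)" if "\<omega> \<in> space M" for n \<omega>
    unfolding G_def using that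
    by (subst bounded_functional_sum[OF \<xi>])
      (auto simp: sum_distrib_left \<xi>D(2) e intro!: dual_closed sum.cong)
  have \<xi>_lim: "(\<lambda>n. \<xi> \<omega> (G n \<omega>)) \<longlonglongrightarrow> \<xi> \<omega> (g \<omega>)" if \<omega>: "\<omega> \<in> space M" for \<omega>
  proof (rule LIM_zero_cancel, rule Lim_null_comparison)
    show "(\<lambda>n. norm (greedy_residual e (g \<omega>) n)) \<longlonglongrightarrow> 0" using res_0[OF \<omega>] by (rule tendsto_norm_zero)
    show "\<forall>\<^sub>F n in sequentially. norm (\<xi> \<omega> (G n \<omega>) - \<xi> \<omega> (g \<omega>)) \<le> norm (greedy_residual e (g \<omega>) n)"
    proof (intro always_eventually allI)
      fix n
      have "norm (\<xi> \<omega> (G n \<omega> - g \<omega>)) \<le> 1 * norm (G n \<omega> - g \<omega>)"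
        by (intro \<xi>D(3) \<omega> dual_closed(3) G_dual g(1))
      moreover have "norm (G n \<omega> - g \<omega>) = norm (greedy_residual e (g \<omega>) n)" by (simp add: G[OF \<omega>])
      ultimately show "norm (\<xi> \<omega> (G n \<omega>) - \<xi> \<omega> (g \<omega>)) \<le> norm (greedy_residual e (g \<omega>) n)"
        unfolding \<xi>D(5)[OF \<omega> G_dual g(1)[OF \<omega>]] by simp
    qed
  qed
  have \<xi>G_meas: "(\<lambda>\<omega>. \<xi> \<omega> (G n \<omega>)) \<in> borel_measurable M" for n
  proof -
    have "(\<lambda>\<omega>. \<Sum>k<n. \<xi> \<omega> (e k) * indicator (H k) \<omega>) \<in> borel_measurable M" using e by measurable
    then show ?thesis
    proof (rule measurable_cong[THEN iffD1, rotated])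
      fix \<omega> assume "\<omega> \<in> space M"
      then show "(\<Sum>k<n. \<xi> \<omega> (e k) * indicator (H k) \<omega>) = \<xi> \<omega> (G n \<omega>)"
        unfolding G_def
        by (subst bounded_functional_sum[OF \<xi>]) (auto simp: \<xi>D(2) e intro!: dual_closed sum.cong)
    qed
  qed
  show "(\<lambda>\<omega>. \<xi> \<omega> (g \<omega>)) \<in> borel_measurable M"
    by (rule borel_measurable_LIMSEQ_metric[OF \<xi>G_meas \<xi>_lim])
  \<comment> \<open>Integration over the event \<open>H k\<close> gives the deterministic functional
    to be paired with \<open>e k\<close>; the integral of
    \<open>w \<omega> * \<xi> \<omega> (g \<omega>)\<close> then is the trace of the operator
    represented by these pairs.\<close>
  define \<alpha> where "\<alpha> k f = (if f \<in> dual scale then integral\<^sup>L M (\<lambda>\<omega>. w \<omega> * \<xi> \<omega> f * indicator (H k) \<omega>) else 0)" for k f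
  have \<xi>_bound: "norm (w \<omega> * \<xi> \<omega> f) \<le> W * norm f" if "\<omega> \<in> space M" "f \<in> dual scale" for \<omega> f
    unfolding norm_mult using w(2)[OF that(1)] \<xi>D(3)[OF that] W by (intro mult_mono) auto
  have ind_bound: "norm (w \<omega> * \<xi> \<omega> f * indicator (H k) \<omega>) \<le> W * norm f * indicat_real (H k) \<omega>"
    if "\<omega> \<in> space M" "f \<in> dual scale" for \<omega> f k
    using \<xi>_bound[OF that] by (auto simp: indicator_def)
  have H_int[simp]: "integrable M (indicat_real (H k))" for k
    by (intro integrable_real_indicator H) (simp add: emeasure_eq_measure)
  have int_ind: "integrable M (\<lambda>\<omega>. w \<omega> * \<xi> \<omega> f * indicator (H k) \<omega>)" if f: "f \<in> dual scale" for f k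
    by (rule Bochner_Integration.integrable_bound[where f = "\<lambda>\<omega>. W * norm f * indicat_real (H k) \<omega>"])
      (use f ind_bound W in \<open>auto simp: abs_mult\<close>)
  define a where "a k = W * prob (H k)" for k
  have \<alpha>_bf: "bounded_functional (a k) (\<alpha> k)" for k
    unfolding bounded_functional_def
  proof (intro conjI ballI allI)
    show "\<alpha> k (f + h) = \<alpha> k f + \<alpha> k h" if "f \<in> dual scale" "h \<in> dual scale" for f h
    proof -
      have "integral\<^sup>L M (\<lambda>\<omega>. w \<omega> * \<xi> \<omega> (f + h) * indicator (H k) \<omega>) =
          integral\<^sup>L M (\<lambda>\<omega>. w \<omega> * \<xi> \<omega> f * indicator (H k) \<omega> + w \<omega> * \<xi> \<omega> h * indicator (H k) \<omega>)"
        using that by (intro Bochner_Integration.integral_cong) (auto simp: \<xi>D(1) algebra_simps)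
      then show ?thesis
        using that int_ind by (simp add: \<alpha>_def dual_closed Bochner_Integration.integral_add)
    qed
    show "\<alpha> k (dual_scale b f) = b * \<alpha> k f" if "f \<in> dual scale" for b f
    proof -
      have "integral\<^sup>L M (\<lambda>\<omega>. w \<omega> * \<xi> \<omega> (dual_scale b f) * indicator (H k) \<omega>) =
          integral\<^sup>L M (\<lambda>\<omega>. b * (w \<omega> * \<xi> \<omega> f * indicator (H k) \<omega>))"
        using that by (intro Bochner_Integration.integral_cong) (auto simp: \<xi>D(2))
      then show ?thesis using that by (simp add: \<alpha>_def dual_closed)
    qed
    show "norm (\<alpha> k f) \<le> a k * norm f" if f: "f \<in> dual scale" for f
    proof -
      have "norm (integral\<^sup>L M (\<lambda>\<omega>. w \<omega> * \<xi> \<omega> f * indicator (H k) \<omega>)) \<le>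
          integral\<^sup>L M (\<lambda>\<omega>. W * norm f * indicat_real (H k) \<omega>)"
        using f int_ind ind_bound
        by (intro order_trans[OF Bochner_Integration.integral_norm_bound integral_mono]) auto
      then show ?thesis using f by (simp add: \<alpha>_def a_def mult_ac)
    qed
  qed
  have a_nonneg: "0 \<le> a k" for k using W by (simp add: a_def)
  \<comment> \<open>The factor \<open>prob (H k)\<close> in \<open>a k\<close> makes the nuclear
    norm an expectation: the norms of the vectors used sum to at most \<open>3 * C\<close> at every
    sample point.\<close>
  have sum_a: "summable (\<lambda>k. a k * norm (e k))"
  proof (rule summableI_nonneg_bounded)
    show "0 \<le> a k * norm (e k)" for k using a_nonneg by simp
    show "(\<Sum>k<n. a k * norm (e k)) \<le> W * (3 * C)" for n
    proof -
      have "(\<Sum>k<n. prob (H k) * norm (e k)) = integral\<^sup>L M (\<lambda>\<omega>. \<Sum>k<n. indicat_real (H k) \<omega> * norm (e k))"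
        by (subst Bochner_Integration.integral_sum) (auto intro!: integrable_mult_left)
      also have "\<dots> \<le> integral\<^sup>L M (\<lambda>_. 3 * C)"
      proof (rule integral_mono)
        show "integrable M (\<lambda>\<omega>. \<Sum>k<n. indicat_real (H k) \<omega> * norm (e k))"
          by (intro Bochner_Integration.integrable_sum integrable_mult_left H_int)
      qed (simp_all only: sum_e integrable_const)
      also have "\<dots> = 3 * C" by (simp add: prob_space)
      finally have "W * (\<Sum>k<n. prob (H k) * norm (e k)) \<le> W * (3 * C)" using W by (rule mult_left_mono)
      then show ?thesis by (simp add: a_def sum_distrib_left mult.assoc)
    qed
  qed
  have sum_b: "summable (\<lambda>j. norm (c j) * norm (\<psi> j))"
    by (rule summable_comparison_test'[OF summable_mult2[OF c, of C]]) (auto intro!: mult_left_mono \<psi>)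
  have \<beta>_bf: "bounded_functional (norm (c j)) (\<lambda>f. c j * blinfun_apply f (x j))" for j
    unfolding bounded_functional_def
  proof (intro conjI ballI allI)
    show "norm (c j * blinfun_apply f (x j)) \<le> norm (c j) * norm f" for f
      using order_trans[OF norm_blinfun[of f "x j"] mult_left_mono[OF x[of j] norm_ge_zero[of f]]]
      by (simp add: norm_mult mult_left_mono)
  qed (auto simp: blinfun.add_left algebra_simps)
  \<comment> \<open>Hypothesis \<open>eq\<close> says that both representations define the same
    operator; the right-hand side is the trace of the one built from the points
    \<open>x j\<close>.\<close>
  have "(\<Sum>k. \<alpha> k (e k)) = (\<Sum>j. c j * blinfun_apply (\<psi> j) (x j))"
  proof (rule nuclear_trace_unique[OF AP \<alpha>_bf a_nonneg e sum_a \<beta>_bf norm_ge_zero \<psi>(1) sum_b])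
    fix f v assume f: "f \<in> dual scale"
    have "(\<lambda>k. integral\<^sup>L M (\<lambda>\<omega>. w \<omega> * \<xi> \<omega> f * indicator (H k) \<omega> * blinfun_apply (e k) v)) sums
        integral\<^sup>L M (\<lambda>\<omega>. w \<omega> * \<xi> \<omega> f * blinfun_apply (g \<omega>) v)"
    proof (rule sums_integral_bounded(2))
      show "(\<lambda>\<omega>. w \<omega> * \<xi> \<omega> f * indicator (H k) \<omega> * blinfun_apply (e k) v) \<in> borel_measurable M" for k
        using f by measurable
      fix \<omega> assume \<omega>: "\<omega> \<in> space M"
      have sum_eq: "(\<Sum>k<n. w \<omega> * \<xi> \<omega> f * indicator (H k) \<omega> * blinfun_apply (e k) v) = w \<omega> * \<xi> \<omega> f * blinfun_apply (G n \<omega>) v" for n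
        by (simp only: G_def blinfun.sum_left sum_distrib_left dual_scale_apply mult.assoc)
      show "norm (\<Sum>k<n. w \<omega> * \<xi> \<omega> f * indicator (H k) \<omega> * blinfun_apply (e k) v) \<le> W * norm f * (3 * C * norm v)" for n
      proof -
        have "norm (blinfun_apply (G n \<omega>) v) \<le> 3 * C * norm v"
          using order_trans[OF norm_blinfun mult_right_mono[OF G_norm[OF \<omega>]]] by simp
        then show ?thesis
          unfolding sum_eq norm_mult[of _ "blinfun_apply (G n \<omega>) v"] using \<xi>_bound[OF \<omega> f] W by (intro mult_mono) auto
      qed
      have "(\<lambda>n. G n \<omega>) \<longlonglongrightarrow> g \<omega> - 0"
        unfolding G[OF \<omega>] by (intro tendsto_intros res_0[OF \<omega>])
      then have "(\<lambda>n. blinfun_apply (G n \<omega>) v) \<longlonglongrightarrow> blinfun_apply (g \<omega>) v"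
        by (intro blinfun.tendsto) auto
      then show "(\<lambda>n. \<Sum>k<n. w \<omega> * \<xi> \<omega> f * indicator (H k) \<omega> * blinfun_apply (e k) v) \<longlonglongrightarrow>
          w \<omega> * \<xi> \<omega> f * blinfun_apply (g \<omega>) v"
        unfolding sum_eq by (rule tendsto_mult_left)
    qed
    then have "(\<Sum>k. \<alpha> k f * blinfun_apply (e k) v) = integral\<^sup>L M (\<lambda>\<omega>. w \<omega> * \<xi> \<omega> f * blinfun_apply (g \<omega>) v)"
      using f by (simp add: \<alpha>_def sums_iff)
    then show "(\<Sum>k. \<alpha> k f * blinfun_apply (e k) v) = (\<Sum>j. c j * blinfun_apply f (x j) * blinfun_apply (\<psi> j) v)"
      using eq[OF f] by simp
  qed
  moreover have "(\<lambda>k. integral\<^sup>L M (\<lambda>\<omega>. w \<omega> * \<xi> \<omega> (e k) * indicator (H k) \<omega>)) sums integral\<^sup>L M (\<lambda>\<omega>. w \<omega> * \<xi> \<omega> (g \<omega>))"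
  proof (rule sums_integral_bounded(2))
    show "(\<lambda>\<omega>. w \<omega> * \<xi> \<omega> (e k) * indicator (H k) \<omega>) \<in> borel_measurable M" for k using e by measurable
    fix \<omega> assume \<omega>: "\<omega> \<in> space M"
    show "norm (\<Sum>k<n. w \<omega> * \<xi> \<omega> (e k) * indicator (H k) \<omega>) \<le> W * (3 * C)" for n
      unfolding \<xi>_G[OF \<omega>] using order_trans[OF \<xi>_bound[OF \<omega> G_dual] mult_left_mono[OF G_norm[OF \<omega>] W]] .
    show "(\<lambda>n. \<Sum>k<n. w \<omega> * \<xi> \<omega> (e k) * indicator (H k) \<omega>) \<longlonglongrightarrow> w \<omega> * \<xi> \<omega> (g \<omega>)"
      unfolding \<xi>_G[OF \<omega>] by (intro tendsto_intros \<xi>_lim[OF \<omega>])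
  qed
  then have "(\<Sum>k. \<alpha> k (e k)) = integral\<^sup>L M (\<lambda>\<omega>. w \<omega> * \<xi> \<omega> (g \<omega>))"
    using e by (simp add: \<alpha>_def sums_iff)
  ultimately show "integral\<^sup>L M (\<lambda>\<omega>. w \<omega> * \<xi> \<omega> (g \<omega>)) = (\<Sum>j. c j * blinfun_apply (\<psi> j) (x j))" by simp
qed

end

section \<open>Combinations of point evaluations as random points and as series\<close>

lemma double_series_flatten:
  fixes u :: "nat \<Rightarrow> nat \<Rightarrow> 'b::banach"
  assumes fin: "\<And>m i. i \<ge> L m \<Longrightarrow> u m i = 0" and sum: "summable (\<lambda>m. \<Sum>i<L m. norm (u m i))"
  shows "summable (\<lambda>n. norm (case_prod u (prod_decode n)))"
    and "(\<lambda>n. case_prod u (prod_decode n)) sums (\<Sum>m. \<Sum>i<L m. u m i)"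
proof -
  have bij: "bij_betw prod_decode UNIV (UNIV \<times> UNIV)" by (simp add: bij_prod_decode)
  have inner_norm: "((\<lambda>i. norm (u m i)) has_sum (\<Sum>i<L m. norm (u m i))) UNIV" for m
    by (rule has_sum_finite_neutralI[of "{..<L m}"]) (use fin in auto)
  have "(\<lambda>m. \<Sum>i<L m. norm (u m i)) summable_on UNIV"
    using sum by (subst summable_on_UNIV_nonneg_real_iff) (auto intro: sum_nonneg)
  then have abs: "(\<lambda>p. norm (case_prod u p)) summable_on (UNIV \<times> UNIV)"
    by (intro Infinite_Sum.abs_summable_on_Sigma_iff[THEN iffD2] conjI ballI)
      (simp_all add: infsumI[OF inner_norm] sum_nonneg has_sum_imp_summable[OF inner_norm])
  then have "((\<lambda>n. norm (case_prod u (prod_decode n))) has_sum infsum (\<lambda>p. norm (case_prod u p)) (UNIV \<times> UNIV)) UNIV"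
    by (subst has_sum_reindex_bij_betw[OF bij]) (rule has_sum_infsum)
  then show "summable (\<lambda>n. norm (case_prod u (prod_decode n)))"
    using has_sum_imp_sums sums_summable by blast
  define S where "S = infsum (case_prod u) (UNIV \<times> UNIV)"
  have S: "(case_prod u has_sum S) (UNIV \<times> UNIV)"
    unfolding S_def by (rule has_sum_infsum[OF Infinite_Sum.abs_summable_summable[OF abs]])
  then have "((\<lambda>n. case_prod u (prod_decode n)) has_sum S) UNIV"
    by (subst has_sum_reindex_bij_betw[OF bij])
  then have "(\<lambda>n. case_prod u (prod_decode n)) sums S" by (rule has_sum_imp_sums)
  moreover have "((\<lambda>m. \<Sum>i<L m. u m i) has_sum S) UNIV"
    by (rule has_sum_SigmaD[OF S]) (rule has_sum_finite_neutralI[of "{..<L _}"], use fin in auto)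
  then have "(\<lambda>m. \<Sum>i<L m. u m i) sums S" by (rule has_sum_imp_sums)
  ultimately show "(\<lambda>n. case_prod u (prod_decode n)) sums (\<Sum>m. \<Sum>i<L m. u m i)" by (simp add: sums_iff)
qed

lemma expectation_pmf_of_list:
  fixes h :: "'p \<Rightarrow> 'b::{banach, second_countable_topology}"
  assumes "pmf_of_list_wf xs"
  shows "measure_pmf.expectation (pmf_of_list xs) h = (\<Sum>(a, r)\<leftarrow>xs. r *\<^sub>R h a)"
proof -
  have *: "(\<Sum>a\<in>A. sum_list (map snd (filter (\<lambda>z. fst z = a) ys)) *\<^sub>R h a) = (\<Sum>(a, r)\<leftarrow>ys. r *\<^sub>R h a)"
    if "finite A" "fst ` set ys \<subseteq> A" for A and ys :: "('p \<times> real) list"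
    using that(2)
  proof (induction ys)
    case (Cons y ys)
    have "(\<Sum>a\<in>A. sum_list (map snd (filter (\<lambda>z. fst z = a) (y # ys))) *\<^sub>R h a) =
        (\<Sum>a\<in>A. (if a = fst y then snd y *\<^sub>R h a else 0) + sum_list (map snd (filter (\<lambda>z. fst z = a) ys)) *\<^sub>R h a)"
      by (intro sum.cong) (auto simp: scaleR_add_left)
    also have "\<dots> = snd y *\<^sub>R h (fst y) + (\<Sum>(a, r)\<leftarrow>ys. r *\<^sub>R h a)"
      using Cons that(1) by (simp add: sum.distrib)
    finally show ?case by (simp add: case_prod_unfold)
  qed simp
  have "measure_pmf.expectation (pmf_of_list xs) h = (\<Sum>a\<in>fst ` set xs. pmf (pmf_of_list xs) a *\<^sub>R h a)"
    using set_pmf_of_list[OF assms] by (intro integral_measure_pmf) auto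
  then show ?thesis using *[of "fst ` set xs" xs] by (simp add: pmf_pmf_of_list[OF assms])
qed

lemma componentwise_convergent:
  fixes X :: "nat \<Rightarrow> 'b::euclidean_space"
  assumes "\<And>b. b \<in> Basis \<Longrightarrow> convergent (\<lambda>m. X m \<bullet> b)"
  shows "convergent X"
proof -
  have "X \<longlonglongrightarrow> (\<Sum>b\<in>Basis. lim (\<lambda>m. X m \<bullet> b) *\<^sub>R b)"
    unfolding tendsto_componentwise_iff[of X] using assms by (auto simp: convergent_LIMSEQ_iff)
  then show ?thesis by (rule convergentI)
qed

context normed_space_over
begin

text \<open>By homogeneity \<open>c * R x\<close> is \<open>norm c * norm x ^ N\<close> times the
  same expression at \<open>sgn c\<close> and \<open>sgn x\<close>. The moduli become probabilities
  and the directions points of the balls.\<close>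

lemma combination_pmf:
  assumes "cost N w \<le> 1"
  obtains p :: "('k \<times> 'a) pmf"
  where "set_pmf p \<subseteq> cball 0 1 \<times> cball 0 1"
    and "\<And>R. R \<in> hom_polys scale N \<Longrightarrow> measure_pmf.expectation p (\<lambda>(\<theta>, x). \<theta> * R x) = evl w R"
proof -
  \<comment> \<open>The missing mass is placed at \<open>(0, 0)\<close>, where the scalar 0 makes
    the contribution vanish for every \<open>N\<close>.\<close>
  define xs where "xs = map (\<lambda>(c, x). ((sgn c, sgn x), norm c * norm x ^ N)) w @ [((0, 0), 1 - cost N w)]"
  have "sum_list (map snd xs) = 1"
    by (simp add: xs_def o_def case_prod_unfold cost_def)
  then have wf: "pmf_of_list_wf xs"
    by (intro pmf_of_list_wfI) (use assms in \<open>auto simp: xs_def\<close>)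
  show ?thesis
  proof (rule that[of "pmf_of_list xs"])
    show "set_pmf (pmf_of_list xs) \<subseteq> cball 0 1 \<times> cball 0 1"
    proof (rule order_trans[OF set_pmf_of_list[OF wf]])
      show "set (map fst xs) \<subseteq> cball 0 1 \<times> cball 0 1" by (auto simp: xs_def norm_sgn)
    qed
    fix R assume R: "R \<in> hom_polys scale N"
    have mono: "(norm c * norm x ^ N) *\<^sub>R (sgn c * R (sgn x)) = c * R x" for c x
    proof -
      note hom_poly_sgn[OF R, of x]
      moreover have "of_real (norm c) * sgn c = c"
        by (cases "c = 0") (simp_all add: sgn_div_norm scaleR_conv_of_real)
      ultimately show ?thesis by (simp add: scaleR_conv_of_real algebra_simps)
    qed
    have "measure_pmf.expectation (pmf_of_list xs) (\<lambda>(\<theta>, x). \<theta> * R x) = (\<Sum>(c, x)\<leftarrow>w. (norm c * norm x ^ N) *\<^sub>R (sgn c * R (sgn x)))"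
      unfolding expectation_pmf_of_list[OF wf] by (simp add: xs_def o_def case_prod_unfold)
    then show "measure_pmf.expectation (pmf_of_list xs) (\<lambda>(\<theta>, x). \<theta> * R x) = evl w R"
      by (simp add: mono evl_def)
  qed
qed

text \<open>Homogeneity moves the norms of the points into the coefficients, whose absolute sum is
  then the total cost. Absolute convergence allows the terms of all lists to be enumerated through
  pairs.\<close>

lemma combination_series:
  fixes d :: "nat \<Rightarrow> ('k \<times> 'a) list"
  assumes "summable (\<lambda>m. cost N (d m))"
  obtains c :: "nat \<Rightarrow> 'k" and x :: "nat \<Rightarrow> 'a"
  where "summable (\<lambda>j. norm (c j))" "\<And>j. norm (x j) \<le> 1"
    and "\<And>R. R \<in> hom_polys scale N \<Longrightarrow> (\<lambda>j. c j * R (x j)) sums (\<Sum>m. evl (d m) R)"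
proof -
  \<comment> \<open>Lists are padded with \<open>(0, 0)\<close>, which gives the coefficient
    \<open>b m i = 0\<close>.\<close>
  define y where "y m i = (if i < length (d m) then d m ! i else (0, 0))" for m i
  define b where "b m i = fst (y m i) * of_real (norm (snd (y m i)) ^ N)" for m i
  define z where "z m i = sgn (snd (y m i))" for m i
  have cost_eq: "(\<Sum>i<length (d m). norm (b m i)) = cost N (d m)" for m
    unfolding cost_def sum_list_sum_nth
    by (simp add: atLeast0LessThan b_def y_def case_prod_unfold norm_mult norm_power)
  have fin: "b m i = 0" if "i \<ge> length (d m)" for m i using that by (simp add: b_def y_def)
  have sb: "summable (\<lambda>m. \<Sum>i<length (d m). norm (b m i))" using assms by (simp only: cost_eq)
  define c where "c n = case_prod b (prod_decode n)" for n
  define x where "x n = case_prod z (prod_decode n)" for n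
  show ?thesis
  proof (rule that[of c x])
    show sc: "summable (\<lambda>j. norm (c j))"
      unfolding c_def by (rule double_series_flatten(1)[OF fin sb])
    show x1: "norm (x j) \<le> 1" for j by (simp add: x_def z_def case_prod_unfold norm_sgn)
    fix R assume R: "R \<in> hom_polys scale N"
    obtain C where C: "C \<ge> 0" "\<And>x. norm (R x) \<le> C * norm x ^ N" using hom_poly_bound[OF R] by metis
    have Rz: "norm (R (z m i)) \<le> C" for m i
    proof -
      have "C * norm (z m i) ^ N \<le> C * 1" using C(1) by (intro mult_left_mono power_le_one) (auto simp: z_def norm_sgn)
      then show ?thesis using C(2)[of "z m i"] by simp
    qed
    have mono: "b m i * R (z m i) = fst (y m i) * R (snd (y m i))" for m i
      by (subst (2) hom_poly_sgn[OF R]) (simp add: b_def z_def)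
    have evl_eq: "(\<Sum>i<length (d m). b m i * R (z m i)) = evl (d m) R" for m
      unfolding evl_def sum_list_sum_nth
      by (simp add: mono atLeast0LessThan y_def case_prod_unfold)
    have "summable (\<lambda>m. \<Sum>i<length (d m). norm (b m i * R (z m i)))"
    proof (rule summable_comparison_test'[OF summable_mult2[OF sb, of C]])
      show "norm (\<Sum>i<length (d m). norm (b m i * R (z m i))) \<le> (\<Sum>i<length (d m). norm (b m i)) * C" for m
        using Rz by (auto simp: norm_mult sum_distrib_right intro!: sum_mono mult_left_mono abs_of_nonneg[THEN ord_eq_le_trans] sum_nonneg)
    qed
    from double_series_flatten(2)[where L = "\<lambda>m. length (d m)" and u = "\<lambda>m i. b m i * R (z m i)", OF _ this]
    show "(\<lambda>j. c j * R (x j)) sums (\<Sum>m. evl (d m) R)"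
      by (simp add: evl_eq fin c_def x_def case_prod_unfold)
  qed
qed

lemma bform_product:
  assumes f: "\<And>i. i < N \<Longrightarrow> f i \<in> dual scale"
  shows "bform N (\<Prod>i<N. norm (f i)) (\<lambda>x. \<Prod>i<N. blinfun_apply (f i) (x i))"
  unfolding bform_def mform_def
proof (intro conjI allI impI)
  show "(\<Prod>i<N. blinfun_apply (f i) (x i)) = (\<Prod>i<N. blinfun_apply (f i) (y i))" if "\<forall>i<N. x i = y i" for x y
    using that by (intro prod.cong) auto
  fix x :: "nat \<Rightarrow> 'a" and i assume i: "i < N"
  have eq: "(\<Prod>j<N. blinfun_apply (f j) ((x(i := u)) j)) =
      blinfun_apply (f i) u * (\<Prod>j\<in>{..<N} - {i}. blinfun_apply (f j) (x j))" for u
    using i by (subst prod.remove[of _ i]) auto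
  show "(\<Prod>j<N. blinfun_apply (f j) ((x(i := u + v)) j)) =
      (\<Prod>j<N. blinfun_apply (f j) ((x(i := u)) j)) + (\<Prod>j<N. blinfun_apply (f j) ((x(i := v)) j))" for u v
    unfolding eq by (simp add: blinfun.add_right algebra_simps)
  show "(\<Prod>j<N. blinfun_apply (f j) ((x(i := scale c u)) j)) = c * (\<Prod>j<N. blinfun_apply (f j) ((x(i := u)) j))" for c u
    unfolding eq using dualD[OF f[OF i]] by (simp add: algebra_simps)
next
  fix x :: "nat \<Rightarrow> 'a"
  show "norm (\<Prod>i<N. blinfun_apply (f i) (x i)) \<le> (\<Prod>i<N. norm (f i)) * (\<Prod>i<N. norm (x i))"
    unfolding prod_norm[symmetric] prod.distrib[symmetric] by (intro prod_mono) (auto intro: norm_blinfun)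
qed

text \<open>Almost sure convergence is arranged for countably many coordinates only: the scalar and
  the values of a dense sequence of functionals. Boundedness of the points extends it to the whole
  dual, and the pointwise limits form an element of the bidual ball.\<close>

lemma representing_random_functional:
  assumes sep: "separable_space (top_of_set (dual scale))" and w: "\<And>m. cost N (w m) \<le> 1"
  obtains \<Omega> :: "real measure" and \<theta> :: "real \<Rightarrow> 'k" and \<xi> :: "real \<Rightarrow> ('a \<Rightarrow>\<^sub>L 'k) \<Rightarrow> 'k" and r :: "nat \<Rightarrow> nat"
  where "prob_space \<Omega>" "strict_mono r" "\<theta> \<in> borel_measurable \<Omega>" "\<And>\<omega>. norm (\<theta> \<omega>) \<le> 1"
    and "\<And>\<omega>. \<xi> \<omega> \<in> bidual_ball scale"
    and "\<And>f. f \<in> dual scale \<Longrightarrow> (\<lambda>\<omega>. \<xi> \<omega> f) \<in> borel_measurable \<Omega>"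
    and "\<And>f. (\<And>i. i < N \<Longrightarrow> f i \<in> dual scale) \<Longrightarrow>
      (\<lambda>m. evl (w (r m)) (\<lambda>x. \<Prod>i<N. blinfun_apply (f i) x)) \<longlonglongrightarrow>
        integral\<^sup>L \<Omega> (\<lambda>\<omega>. \<theta> \<omega> * (\<Prod>i<N. \<xi> \<omega> (f i)))"
proof -
  obtain e :: "nat \<Rightarrow> 'a \<Rightarrow>\<^sub>L 'k" where e: "\<And>k. e k \<in> dual scale"
    and dense: "\<And>f \<delta> k. f \<in> dual scale \<Longrightarrow> \<delta> > 0 \<Longrightarrow> \<exists>i\<ge>k. norm (f - e i) \<le> \<delta>"
    using separable_dual_dense_sequence[OF sep] by metis
  have "\<exists>p. set_pmf p \<subseteq> cball 0 1 \<times> cball 0 1 \<and>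
    (\<forall>R\<in>hom_polys scale N. measure_pmf.expectation p (\<lambda>(\<theta>, x). \<theta> * R x) = evl (w m) R)" for m
    using combination_pmf[OF w[of m]] by metis
  then obtain p where p: "\<And>m. set_pmf (p m) \<subseteq> cball 0 1 \<times> cball 0 1"
    and p_evl: "\<And>m R. R \<in> hom_polys scale N \<Longrightarrow> measure_pmf.expectation (p m) (\<lambda>(\<theta>, x). \<theta> * R x) = evl (w m) R"
    by metis
  \<comment> \<open>The coordinate functions must be bounded on the whole type and not only on the
    supports; \<open>clip\<close> achieves this without changing any of the expectations.\<close>
  define clip where "clip q = (if q \<in> cball 0 1 \<times> cball 0 1 then q else (0, 0))" for q :: "'k \<times> 'a"
  have clip: "norm (fst (clip q)) \<le> 1" "norm (snd (clip q)) \<le> 1" for q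
    by (auto simp: clip_def)
  define b where "b = from_nat_into (Basis :: 'k set)"
  have b: "range b = Basis" unfolding b_def by (simp add: range_from_nat_into countable_finite)
  have b_in: "b j \<in> Basis" for j using b by auto
  \<comment> \<open>Index 0 is the random scalar and \<open>Suc k\<close> the value of
    \<open>e k\<close>; inner products with the basis split each into real coordinates.\<close>
  define val where "val i q = (case i of 0 \<Rightarrow> fst (clip q) | Suc k \<Rightarrow> blinfun_apply (e k) (snd (clip q)))" for i q
  have e_bound: "norm (blinfun_apply f (snd (clip q))) \<le> norm f" for f :: "'a \<Rightarrow>\<^sub>L 'k" and q
    using order_trans[OF norm_blinfun mult_left_mono[OF clip(2)[of q] norm_ge_zero[of f]]] by simp
  define a where "a n q = (case prod_decode n of (i, j) \<Rightarrow> val i q \<bullet> b j)" for n q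
  define K where "K n = (case fst (prod_decode n) of 0 \<Rightarrow> 1 | Suc k \<Rightarrow> norm (e k))" for n
  have "\<bar>a n q\<bar> \<le> K n" for n q
  proof -
    obtain i j where ij: "prod_decode n = (i, j)" by fastforce
    have "\<bar>val i q \<bullet> b j\<bar> \<le> norm (val i q)" using b_in by (rule Basis_le_norm)
    also have "\<dots> \<le> K n" using clip(1) e_bound by (auto simp: val_def K_def ij split: nat.split)
    finally show ?thesis by (simp add: a_def ij)
  qed
  from skorohod_countable_coordinates[where a = a and p = p, OF this]
  obtain \<Omega> :: "real measure" and Z r where \<Omega>: "prob_space \<Omega>" and r: "strict_mono r"
    and Z[measurable]: "\<And>m. Z m \<in> measurable \<Omega> (count_space UNIV)"
    and law: "\<And>m. distr \<Omega> (count_space UNIV) (Z m) = measure_pmf (p (r m))"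
    and conv_a: "\<And>n \<omega>. convergent (\<lambda>m. a n (Z m \<omega>))"
    by metis
  interpret prob_space \<Omega> by fact
  define t where "t m \<omega> = fst (clip (Z m \<omega>))" for m \<omega>
  define x where "x m \<omega> = snd (clip (Z m \<omega>))" for m \<omega>
  have t1: "norm (t m \<omega>) \<le> 1" and x1: "norm (x m \<omega>) \<le> 1" for m \<omega> by (simp_all add: t_def x_def clip)
  have conv_val: "convergent (\<lambda>m. val i (Z m \<omega>))" for i \<omega>
  proof (rule componentwise_convergent)
    fix c :: 'k assume "c \<in> Basis"
    then obtain j where "c = b j" using b by blast
    then show "convergent (\<lambda>m. val i (Z m \<omega>) \<bullet> c)"
      using conv_a[of "prod_encode (i, j)" \<omega>] by (simp add: a_def)
  qed
  have conv_t: "convergent (\<lambda>m. t m \<omega>)" for \<omega> using conv_val[of 0 \<omega>] by (simp add: val_def t_def)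
  have conv_e: "convergent (\<lambda>m. blinfun_apply (e k) (x m \<omega>))" for k \<omega>
    using conv_val[of "Suc k" \<omega>] by (simp add: val_def x_def)
  have apply_bound: "norm (blinfun_apply f (x m \<omega>)) \<le> norm f" for f :: "'a \<Rightarrow>\<^sub>L 'k" and m \<omega>
    unfolding x_def by (rule e_bound)
  have conv_x: "convergent (\<lambda>m. blinfun_apply f (x m \<omega>))" if f: "f \<in> dual scale" for f \<omega>
  proof (rule Cauchy_convergent, rule CauchyI)
    fix \<delta> :: real assume "\<delta> > 0"
    then obtain k where k: "norm (f - e k) \<le> \<delta> / 4" using dense[OF f, of "\<delta> / 4"] by auto
    have close: "norm (blinfun_apply f (x m \<omega>) - blinfun_apply (e k) (x m \<omega>)) \<le> \<delta> / 4" for m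
      using order_trans[OF apply_bound[of "f - e k" m \<omega>] k] by (simp add: blinfun.diff_left)
    have "\<delta> / 2 > 0" using \<open>\<delta> > 0\<close> by simp
    from CauchyD[OF convergent_Cauchy[OF conv_e] this] obtain m0 where
      m0: "\<And>m n. m \<ge> m0 \<Longrightarrow> n \<ge> m0 \<Longrightarrow> norm (blinfun_apply (e k) (x m \<omega>) - blinfun_apply (e k) (x n \<omega>)) < \<delta> / 2"
      by blast
    show "\<exists>m0. \<forall>m\<ge>m0. \<forall>n\<ge>m0. norm (blinfun_apply f (x m \<omega>) - blinfun_apply f (x n \<omega>)) < \<delta>"
    proof (intro exI allI impI)
      fix m n assume "m \<ge> m0" "n \<ge> m0"
      then have "dist (blinfun_apply (e k) (x m \<omega>)) (blinfun_apply (e k) (x n \<omega>)) < \<delta> / 2"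
        using m0 by (simp add: dist_norm)
      moreover have "dist (blinfun_apply f (x m \<omega>)) (blinfun_apply (e k) (x m \<omega>)) \<le> \<delta> / 4"
        "dist (blinfun_apply (e k) (x n \<omega>)) (blinfun_apply f (x n \<omega>)) \<le> \<delta> / 4"
        using close by (simp_all add: dist_norm norm_minus_commute)
      ultimately have "dist (blinfun_apply f (x m \<omega>)) (blinfun_apply f (x n \<omega>)) < \<delta>"
        using dist_triangle[of "blinfun_apply f (x m \<omega>)" "blinfun_apply f (x n \<omega>)" "blinfun_apply (e k) (x m \<omega>)"]
          dist_triangle[of "blinfun_apply (e k) (x m \<omega>)" "blinfun_apply f (x n \<omega>)" "blinfun_apply (e k) (x n \<omega>)"]
        by linarith
      then show "norm (blinfun_apply f (x m \<omega>) - blinfun_apply f (x n \<omega>)) < \<delta>" by (simp add: dist_norm)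
    qed
  qed
  define \<theta> where "\<theta> \<omega> = lim (\<lambda>m. t m \<omega>)" for \<omega>
  define \<xi> where "\<xi> \<omega> f = (if f \<in> dual scale then lim (\<lambda>m. blinfun_apply f (x m \<omega>)) else 0)" for \<omega> f
  have \<theta>: "(\<lambda>m. t m \<omega>) \<longlonglongrightarrow> \<theta> \<omega>" for \<omega>
    using conv_t by (simp add: \<theta>_def convergent_LIMSEQ_iff)
  have \<xi>: "(\<lambda>m. blinfun_apply f (x m \<omega>)) \<longlonglongrightarrow> \<xi> \<omega> f" if "f \<in> dual scale" for f \<omega>
    using conv_x[OF that] that by (simp add: \<xi>_def convergent_LIMSEQ_iff)
  have t_meas[measurable]: "t m \<in> borel_measurable \<Omega>" for m
    unfolding t_def by (rule measurable_compose[OF Z]) simp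
  have x_meas[measurable]: "(\<lambda>\<omega>. blinfun_apply f (x m \<omega>)) \<in> borel_measurable \<Omega>" for f m
    unfolding x_def by (rule measurable_compose[OF Z]) simp
  show ?thesis
  proof (rule that[OF \<Omega> r])
    show \<theta>_meas: "\<theta> \<in> borel_measurable \<Omega>" by (rule borel_measurable_LIMSEQ_metric[OF t_meas \<theta>])
    show "norm (\<theta> \<omega>) \<le> 1" for \<omega>
      by (rule Lim_norm_ubound[OF _ \<theta>]) (use t1 in auto)
    show "\<xi> \<omega> \<in> bidual_ball scale" for \<omega>
      unfolding bidual_ball_iff bounded_functional_def
    proof (intro conjI ballI allI impI)
      show "\<xi> \<omega> (f + g) = \<xi> \<omega> f + \<xi> \<omega> g" if "f \<in> dual scale" "g \<in> dual scale" for f g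
        by (rule LIMSEQ_unique[OF \<xi>])
          (use that tendsto_add[OF \<xi>[OF that(1)] \<xi>[OF that(2)]] in \<open>auto simp: blinfun.add_left dual_closed\<close>)
      show "\<xi> \<omega> (dual_scale c f) = c * \<xi> \<omega> f" if "f \<in> dual scale" for c f
        by (rule LIMSEQ_unique[OF \<xi>])
          (use that tendsto_mult_left[OF \<xi>[OF that]] in \<open>auto simp: dual_closed\<close>)
      show "norm (\<xi> \<omega> f) \<le> 1 * norm f" if "f \<in> dual scale" for f
        by (rule Lim_norm_ubound[OF _ \<xi>[OF that]]) (use apply_bound in auto)
    qed (simp add: \<xi>_def)
    show \<xi>_meas: "(\<lambda>\<omega>. \<xi> \<omega> f) \<in> borel_measurable \<Omega>" if "f \<in> dual scale" for f
      by (rule borel_measurable_LIMSEQ_metric[OF x_meas \<xi>[OF that]])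
    fix f assume f: "\<And>i. i < N \<Longrightarrow> f i \<in> dual scale"
    let ?F = "\<lambda>x. \<Prod>i<N. blinfun_apply (f i) x"
    have F: "?F \<in> hom_polys scale N"
      using hom_polysI[OF bform_imp_multilinear[OF bform_product[of N f]]] f by simp
    have evl_eq: "evl (w (r m)) ?F = integral\<^sup>L \<Omega> (\<lambda>\<omega>. t m \<omega> * ?F (x m \<omega>))" for m
    proof -
      have "evl (w (r m)) ?F = measure_pmf.expectation (p (r m)) (\<lambda>q. fst (clip q) * ?F (snd (clip q)))"
        unfolding p_evl[OF F, symmetric]
        by (intro integral_cong_AE) (use p in \<open>auto simp: AE_measure_pmf_iff clip_def case_prod_unfold subset_eq\<close>)
      also have "\<dots> = integral\<^sup>L \<Omega> (\<lambda>\<omega>. fst (clip (Z m \<omega>)) * ?F (snd (clip (Z m \<omega>))))"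
        unfolding law[symmetric] by (rule integral_distr[OF Z]) simp
      finally show ?thesis by (simp add: t_def x_def)
    qed
    show "(\<lambda>m. evl (w (r m)) ?F) \<longlonglongrightarrow> integral\<^sup>L \<Omega> (\<lambda>\<omega>. \<theta> \<omega> * (\<Prod>i<N. \<xi> \<omega> (f i)))"
      unfolding evl_eq
    proof (rule integral_dominated_convergence[where w = "\<lambda>_. \<Prod>i<N. norm (f i)"])
      show "(\<lambda>\<omega>. \<theta> \<omega> * (\<Prod>i<N. \<xi> \<omega> (f i))) \<in> borel_measurable \<Omega>"
        by (intro borel_measurable_times \<theta>_meas borel_measurable_prod \<xi>_meas f) auto
      show "(\<lambda>\<omega>. t m \<omega> * ?F (x m \<omega>)) \<in> borel_measurable \<Omega>" for m
        by measurable
      show "AE \<omega> in \<Omega>. (\<lambda>m. t m \<omega> * ?F (x m \<omega>)) \<longlonglongrightarrow> \<theta> \<omega> * (\<Prod>i<N. \<xi> \<omega> (f i))"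
        by (intro AE_I2 tendsto_mult \<theta> tendsto_prod \<xi> f) auto
      show "AE \<omega> in \<Omega>. norm (t m \<omega> * ?F (x m \<omega>)) \<le> (\<Prod>i<N. norm (f i))" for m
      proof (rule AE_I2)
        fix \<omega>
        have "norm (?F (x m \<omega>)) \<le> (\<Prod>i<N. norm (f i))"
          unfolding prod_norm[symmetric] by (intro prod_mono) (auto intro: apply_bound)
        then have "norm (t m \<omega>) * norm (?F (x m \<omega>)) \<le> 1 * (\<Prod>i<N. norm (f i))"
          using t1 by (intro mult_mono) auto
        then show "norm (t m \<omega> * ?F (x m \<omega>)) \<le> (\<Prod>i<N. norm (f i))" by (simp add: norm_mult)
      qed
    qed simp
  qed
qed

text \<open>
  By downward induction on the number \<open>k\<close> of arguments that are still fixed, the integral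
  formula passes from products of functionals to \<open>N\<close>-linear forms.
\<close>

lemma integral_formula:
  assumes AP: "approximation_property dual_scale (dual scale)"
    and sep: "separable_space (top_of_set (dual scale))"
    and \<Omega>: "prob_space \<Omega>"
    and \<theta>: "\<theta> \<in> borel_measurable \<Omega>" "\<And>\<omega>. norm (\<theta> \<omega>) \<le> 1"
    and \<xi>: "\<And>\<omega>. \<xi> \<omega> \<in> bidual_ball scale"
    and \<xi>_meas: "\<And>f. f \<in> dual scale \<Longrightarrow> (\<lambda>\<omega>. \<xi> \<omega> f) \<in> borel_measurable \<Omega>"
    and c: "summable (\<lambda>j. norm (c j))" and x: "\<And>j. norm (x j) \<le> 1"
    and products: "\<And>f. (\<And>i. i < N \<Longrightarrow> f i \<in> dual scale) \<Longrightarrow>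
      integral\<^sup>L \<Omega> (\<lambda>\<omega>. \<theta> \<omega> * (\<Prod>i<N. \<xi> \<omega> (f i))) = (\<Sum>j. c j * (\<Prod>i<N. blinfun_apply (f i) (x j)))"
    and \<Phi>: "bform N C \<Phi>" "C \<ge> 0"
    and "k \<le> N" and f: "\<And>i. i < k \<Longrightarrow> f i \<in> dual scale"
  shows "(\<lambda>\<omega>. partial_ext (\<xi> \<omega>) N \<Phi> (N - k) v) \<in> borel_measurable \<Omega>"
    and "integral\<^sup>L \<Omega> (\<lambda>\<omega>. \<theta> \<omega> * (\<Prod>i<k. \<xi> \<omega> (f i)) * partial_ext (\<xi> \<omega>) N \<Phi> (N - k) v) =
      (\<Sum>j. c j * (\<Prod>i<k. blinfun_apply (f i) (x j)) * \<Phi> (\<lambda>i. if i < k then v i else x j))"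
proof -
  interpret prob_space \<Omega> by fact
  have \<xi>b: "bounded_functional 1 (\<xi> \<omega>)" for \<omega> using \<xi> by (simp add: bidual_ball_iff)
  have apply_x: "norm (blinfun_apply h (x j)) \<le> norm h" for h j
    using order_trans[OF norm_blinfun[of h "x j"] mult_left_mono[OF x[of j] norm_ge_zero[of h]]] by simp
  have "(\<forall>v. (\<lambda>\<omega>. partial_ext (\<xi> \<omega>) N \<Phi> (N - k) v) \<in> borel_measurable \<Omega>) \<and>
    (\<forall>v f. (\<forall>i<k. f i \<in> dual scale) \<longrightarrow>
      integral\<^sup>L \<Omega> (\<lambda>\<omega>. \<theta> \<omega> * (\<Prod>i<k. \<xi> \<omega> (f i)) * partial_ext (\<xi> \<omega>) N \<Phi> (N - k) v) =
      (\<Sum>j. c j * (\<Prod>i<k. blinfun_apply (f i) (x j)) * \<Phi> (\<lambda>i. if i < k then v i else x j)))"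
    using \<open>k \<le> N\<close>
  proof (induction k rule: inc_induct)
    case base
    have "integral\<^sup>L \<Omega> (\<lambda>\<omega>. \<theta> \<omega> * (\<Prod>i<N. \<xi> \<omega> (f i)) * \<Phi> v) =
        (\<Sum>j. c j * (\<Prod>i<N. blinfun_apply (f i) (x j)) * \<Phi> (\<lambda>i. if i < N then v i else x j))"
      if f: "\<forall>i<N. f i \<in> dual scale" for v f
    proof -
      have \<Phi>v: "\<Phi> (\<lambda>i. if i < N then v i else x j) = \<Phi> v" for j
        by (rule mform_cong[OF bform_mform[OF \<Phi>(1)]]) simp
      have "summable (\<lambda>j. c j * (\<Prod>i<N. blinfun_apply (f i) (x j)))"
      proof (rule summable_comparison_test'[OF summable_mult2[OF c, of "\<Prod>i<N. norm (f i)"]])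
        show "norm (c j * (\<Prod>i<N. blinfun_apply (f i) (x j))) \<le> norm (c j) * (\<Prod>i<N. norm (f i))" for j
          unfolding norm_mult prod_norm[symmetric] by (intro mult_left_mono prod_mono) (auto intro: apply_x)
      qed
      from suminf_mult2[OF this, of "\<Phi> v"] show ?thesis using products[of f] f by (simp add: \<Phi>v)
    qed
    then show ?case by simp
  next
    \<comment> \<open>Slot \<open>k\<close> stops being paired with a functional \<open>f k\<close>
      and is filled with \<open>\<xi> \<omega>\<close> on the left and with \<open>x j\<close> on
      the right. Letting \<open>f k\<close> and the vector in slot \<open>k\<close> vary gives an
      operator on the dual whose trace is either side of the new formula.\<close>
    case (step k)
    have N: "N - k = Suc (N - Suc k)" "N - Suc (N - Suc k) = k" using step.hyps by auto
    define \<Psi> where "\<Psi> \<omega> = partial_ext (\<xi> \<omega>) N \<Phi> (N - Suc k)" for \<omega>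
    have \<Psi>: "bform (Suc k) C (\<Psi> \<omega>)" for \<omega>
      using bform_partial_ext[OF \<Phi> \<xi>b, of "N - Suc k"] step.hyps by (simp add: \<Psi>_def)
    have ext: "partial_ext (\<xi> \<omega>) N \<Phi> (N - k) v = \<xi> \<omega> (slice (\<Psi> \<omega>) k v)" for \<omega> v
      by (simp add: N \<Psi>_def)
    have \<Psi>_meas: "(\<lambda>\<omega>. \<Psi> \<omega> v) \<in> borel_measurable \<Omega>" for v using step.IH by (simp add: \<Psi>_def)
    have \<Psi>_int: "integral\<^sup>L \<Omega> (\<lambda>\<omega>. \<theta> \<omega> * (\<Prod>i<Suc k. \<xi> \<omega> (f i)) * \<Psi> \<omega> v) =
        (\<Sum>j. c j * (\<Prod>i<Suc k. blinfun_apply (f i) (x j)) * \<Phi> (\<lambda>i. if i < Suc k then v i else x j))"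
      if "\<And>i. i < Suc k \<Longrightarrow> f i \<in> dual scale" for v f
      using step.IH that unfolding \<Psi>_def by blast
    \<comment> \<open>The slots above \<open>k\<close> hold \<open>x j\<close>, of norm at most 1,
      so the constant \<open>C\<close> is kept.\<close>
    define \<Phi>' where "\<Phi>' j u = \<Phi> (\<lambda>i. if i < Suc k then u i else x j)" for j u
    have \<Phi>': "bform (Suc k) C (\<Phi>' j)" for j
      unfolding bform_def mform_def
    proof (intro conjI allI impI)
      note m = bform_mform[OF \<Phi>(1)]
      show "\<Phi>' j u = \<Phi>' j u'" if "\<forall>i<Suc k. u i = u' i" for u u'
        unfolding \<Phi>'_def using that by (intro mform_cong[OF m]) auto
      fix u :: "nat \<Rightarrow> 'a" and i assume i: "i < Suc k"
      then have iN: "i < N" using step.hyps by simp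
      have upd: "(\<lambda>l. if l < Suc k then (u(i := y)) l else x j) = (\<lambda>l. if l < Suc k then u l else x j)(i := y)" for y
        using i by auto
      show "\<Phi>' j (u(i := y + y')) = \<Phi>' j (u(i := y)) + \<Phi>' j (u(i := y'))" for y y'
        unfolding \<Phi>'_def upd by (rule mform_add[OF m iN])
      show "\<Phi>' j (u(i := scale b y)) = b * \<Phi>' j (u(i := y))" for b y
        unfolding \<Phi>'_def upd by (rule mform_scale[OF m iN])
    next
      fix u :: "nat \<Rightarrow> 'a"
      have sub: "{..<Suc k} \<subseteq> {..<N}" using step.hyps by auto
      have "(\<Prod>i<N. norm (if i < Suc k then u i else x j)) =
          (\<Prod>i\<in>{..<N} - {..<Suc k}. norm (if i < Suc k then u i else x j)) * (\<Prod>i<Suc k. norm (if i < Suc k then u i else x j))"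
        by (rule prod.subset_diff[OF sub finite_lessThan])
      also have "(\<Prod>i<Suc k. norm (if i < Suc k then u i else x j)) = (\<Prod>i<Suc k. norm (u i))"
        by (rule prod.cong) simp_all
      also have "(\<Prod>i\<in>{..<N} - {..<Suc k}. norm (if i < Suc k then u i else x j)) * (\<Prod>i<Suc k. norm (u i))
          \<le> 1 * (\<Prod>i<Suc k. norm (u i))"
        by (intro mult_right_mono prod_le_1 prod_nonneg) (simp_all add: x)
      finally have "(\<Prod>i<N. norm (if i < Suc k then u i else x j)) \<le> (\<Prod>i<Suc k. norm (u i))" by (simp only: mult_1)
      from mult_left_mono[OF this \<Phi>(2)]
      show "norm (\<Phi>' j u) \<le> C * (\<Prod>i<Suc k. norm (u i))"
        unfolding \<Phi>'_def using bform_bound[OF \<Phi>(1)] by (rule order_trans[rotated])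
    qed
    have main: "(\<lambda>\<omega>. \<xi> \<omega> (slice (\<Psi> \<omega>) k v)) \<in> borel_measurable \<Omega>"
      "integral\<^sup>L \<Omega> (\<lambda>\<omega>. \<theta> \<omega> * (\<Prod>i<k. \<xi> \<omega> (f i)) * \<xi> \<omega> (slice (\<Psi> \<omega>) k v)) =
        (\<Sum>j. c j * (\<Prod>i<k. blinfun_apply (f i) (x j)) * blinfun_apply (slice (\<Phi>' j) k v) (x j))"
      if f: "\<And>i. i < k \<Longrightarrow> f i \<in> dual scale" for v f
    proof -
      have w_bound: "norm (\<theta> \<omega> * (\<Prod>i<k. \<xi> \<omega> (f i))) \<le> 1 * (\<Prod>i<k. norm (f i))" for \<omega>
        unfolding norm_mult prod_norm[symmetric]
        using \<theta>(2) bounded_functionalD(3)[OF \<xi>b f] by (intro mult_mono prod_mono) (auto intro: prod_nonneg)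
      have w_meas: "(\<lambda>\<omega>. \<theta> \<omega> * (\<Prod>i<k. \<xi> \<omega> (f i))) \<in> borel_measurable \<Omega>"
        using f by (intro borel_measurable_times \<theta>(1) borel_measurable_prod \<xi>_meas) auto
      have c': "summable (\<lambda>j. norm (c j * (\<Prod>i<k. blinfun_apply (f i) (x j))))"
      proof (rule summable_comparison_test'[OF summable_mult2[OF c, of "\<Prod>i<k. norm (f i)"]])
        fix j
        have "norm (c j * (\<Prod>i<k. blinfun_apply (f i) (x j))) \<le> norm (c j) * (\<Prod>i<k. norm (f i))"
          unfolding norm_mult prod_norm[symmetric] by (intro mult_left_mono prod_mono) (auto intro: apply_x)
        then show "norm (norm (c j * (\<Prod>i<k. blinfun_apply (f i) (x j)))) \<le> norm (c j) * (\<Prod>i<k. norm (f i))"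
          by simp
      qed
      have eq: "integral\<^sup>L \<Omega> (\<lambda>\<omega>. \<theta> \<omega> * (\<Prod>i<k. \<xi> \<omega> (f i)) * \<xi> \<omega> h * blinfun_apply (slice (\<Psi> \<omega>) k v) u) =
          (\<Sum>j. c j * (\<Prod>i<k. blinfun_apply (f i) (x j)) * blinfun_apply h (x j) * blinfun_apply (slice (\<Phi>' j) k v) u)"
        if h: "h \<in> dual scale" for h u
      proof -
        \<comment> \<open>The formula for \<open>Suc k\<close> is used with \<open>h\<close> as the
          functional and \<open>u\<close> as the vector of slot \<open>k\<close>.\<close>
        have "(f(k := h)) i \<in> dual scale" if "i < Suc k" for i
          using that f h by (auto simp: less_Suc_eq)
        from \<Psi>_int[of "f(k := h)" "v(k := u)", OF this] show ?thesis
          by (simp add: slice_apply[OF \<Psi>] slice_apply[OF \<Phi>'] \<Phi>'_def less_Suc_eq mult.assoc cong: if_cong)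
      qed
      have g_meas: "(\<lambda>\<omega>. blinfun_apply (slice (\<Psi> \<omega>) k v) u) \<in> borel_measurable \<Omega>" for u
        unfolding slice_apply[OF \<Psi>] by (rule \<Psi>_meas)
      note result = integral_trace_eq[OF AP sep \<Omega> \<xi>b \<xi>_meas w_meas w_bound slice_in_dual[OF \<Psi>] norm_slice_le[OF \<Psi> \<Phi>(2)]
          g_meas c' x slice_in_dual[OF \<Phi>'] norm_slice_le[OF \<Phi>' \<Phi>(2)] eq]
      show "(\<lambda>\<omega>. \<xi> \<omega> (slice (\<Psi> \<omega>) k v)) \<in> borel_measurable \<Omega>"
        by (rule result(1))
      show "integral\<^sup>L \<Omega> (\<lambda>\<omega>. \<theta> \<omega> * (\<Prod>i<k. \<xi> \<omega> (f i)) * \<xi> \<omega> (slice (\<Psi> \<omega>) k v)) =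
          (\<Sum>j. c j * (\<Prod>i<k. blinfun_apply (f i) (x j)) * blinfun_apply (slice (\<Phi>' j) k v) (x j))"
        by (rule result(2))
    qed
    have last: "blinfun_apply (slice (\<Phi>' j) k v) (x j) = \<Phi> (\<lambda>i. if i < k then v i else x j)" for j v
      unfolding slice_apply[OF \<Phi>'] \<Phi>'_def by (rule arg_cong[of _ _ \<Phi>]) (auto simp: less_Suc_eq)
    \<comment> \<open>Measurability does not mention functionals, so its instance takes the zero
      functionals.\<close>
    show ?case
      unfolding ext using main(1)[of "\<lambda>_. 0"] main(2) by (auto simp: last dual_closed)
  qed
  then show "(\<lambda>\<omega>. partial_ext (\<xi> \<omega>) N \<Phi> (N - k) v) \<in> borel_measurable \<Omega>"
    and "integral\<^sup>L \<Omega> (\<lambda>\<omega>. \<theta> \<omega> * (\<Prod>i<k. \<xi> \<omega> (f i)) * partial_ext (\<xi> \<omega>) N \<Phi> (N - k) v) =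
      (\<Sum>j. c j * (\<Prod>i<k. blinfun_apply (f i) (x j)) * \<Phi> (\<lambda>i. if i < k then v i else x j))"
    using f by auto
qed

theorem norm_attaining_dense:
  assumes AP: "approximation_property dual_scale (dual scale)"
    and sep: "separable_space (top_of_set (dual scale))"
    and P: "P \<in> hom_polys scale N" and \<epsilon>: "\<epsilon> > 0"
  shows "\<exists>Q \<in> hom_polys scale N. attains_norm_on (bidual_ball scale) (aron_berner scale N Q) \<and>
    sup_norm_on (cball 0 1) (\<lambda>x. P x - Q x) < \<epsilon>"
proof -
  \<comment> \<open>Half of \<open>\<epsilon>\<close> leaves room for the strict inequality in the
    conclusion.\<close>
  have \<epsilon>2: "\<epsilon> / 2 > 0" using \<epsilon> by simp
  obtain Q w d where Q: "Q \<in> hom_polys scale N"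
    and PQ: "\<And>x. norm (P x - Q x) \<le> \<epsilon> / 2 * norm x ^ N"
    and w: "\<And>m. cost N (w m) \<le> 1"
    and max: "\<And>m x. norm x \<le> 1 \<Longrightarrow> norm (Q x) \<le> re (evl (w m) Q) + 4 * (1/2) ^ m"
    and d: "\<And>m. cost N (d m) \<le> (1 / (\<epsilon> / 2) + 1) * (1/2) ^ m"
    and wd: "\<And>m R. R \<in> hom_polys scale N \<Longrightarrow> evl (w (Suc m)) R = evl (w m) R + evl (d m) R"
    using bishop_phelps_hom_polys[OF P \<epsilon>2] by metis
  \<comment> \<open>With \<open>w 0\<close> in front of the differences, \<open>w m\<close>
    telescopes to the sum of \<open>d' 0\<close> up to \<open>d' m\<close>, and the limit of
    \<open>w\<close> is the sum of one series.\<close>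
  define d' where "d' m = (case m of 0 \<Rightarrow> w 0 | Suc k \<Rightarrow> d k)" for m
  have evl_w: "evl (w m) R = (\<Sum>k<Suc m. evl (d' k) R)" if "R \<in> hom_polys scale N" for m R
    by (induction m) (use wd[OF that] in \<open>auto simp: d'_def\<close>)
  have "summable (\<lambda>m. cost N (d' (Suc m)))"
    by (rule summable_comparison_test'[OF summable_mult[OF summable_geometric[of "1/2::real"], of "1 / (\<epsilon> / 2) + 1"]])
      (use d cost_nonneg in \<open>auto simp: d'_def\<close>)
  then have "summable (\<lambda>m. cost N (d' m))" by (rule summable_Suc_iff[THEN iffD1])
  then obtain c :: "nat \<Rightarrow> 'k" and x :: "nat \<Rightarrow> 'a" where c: "summable (\<lambda>j. norm (c j))" and x: "\<And>j. norm (x j) \<le> 1"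
    and series: "\<And>R. R \<in> hom_polys scale N \<Longrightarrow> (\<lambda>j. c j * R (x j)) sums (\<Sum>m. evl (d' m) R)"
    using combination_series by metis
  have evl_lim: "(\<lambda>m. evl (w m) R) \<longlonglongrightarrow> (\<Sum>j. c j * R (x j))" if R: "R \<in> hom_polys scale N" for R
  proof -
    obtain C where C: "C \<ge> 0" "\<And>x. norm (R x) \<le> C * norm x ^ N" using hom_poly_bound[OF R] by metis
    have "summable (\<lambda>m. evl (d' m) R)"
      by (rule summable_comparison_test'[OF summable_mult[OF \<open>summable (\<lambda>m. cost N (d' m))\<close>, of C]]) (rule norm_evl_le[OF C(2)])
    then have "(\<lambda>m. \<Sum>k<m. evl (d' k) R) \<longlonglongrightarrow> (\<Sum>m. evl (d' m) R)" by (rule summable_LIMSEQ)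
    then have "(\<lambda>m. \<Sum>k<Suc m. evl (d' k) R) \<longlonglongrightarrow> (\<Sum>m. evl (d' m) R)" by (rule LIMSEQ_Suc)
    then show ?thesis unfolding evl_w[OF R] using series[OF R] by (simp add: sums_iff)
  qed
  obtain \<Omega> :: "real measure" and \<theta> :: "real \<Rightarrow> 'k" and \<xi> :: "real \<Rightarrow> ('a \<Rightarrow>\<^sub>L 'k) \<Rightarrow> 'k" and r :: "nat \<Rightarrow> nat"
    where \<Omega>: "prob_space \<Omega>" and r: "strict_mono r"
    and \<theta>: "\<theta> \<in> borel_measurable \<Omega>" "\<And>\<omega>. norm (\<theta> \<omega>) \<le> 1"
    and \<xi>: "\<And>\<omega>. \<xi> \<omega> \<in> bidual_ball scale"
    and \<xi>_meas: "\<And>f. f \<in> dual scale \<Longrightarrow> (\<lambda>\<omega>. \<xi> \<omega> f) \<in> borel_measurable \<Omega>"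
    and prods: "\<And>f. (\<And>i. i < N \<Longrightarrow> f i \<in> dual scale) \<Longrightarrow>
      (\<lambda>m. evl (w (r m)) (\<lambda>x. \<Prod>i<N. blinfun_apply (f i) x)) \<longlonglongrightarrow>
        integral\<^sup>L \<Omega> (\<lambda>\<omega>. \<theta> \<omega> * (\<Prod>i<N. \<xi> \<omega> (f i)))"
  proof -
    show thesis
    proof (rule representing_random_functional[where w = w and N = N, OF sep w], goal_cases)
      case (1 \<Omega> \<theta> \<xi> r)
      show ?case by (rule that) (fact 1)+
    qed
  qed
  interpret prob_space \<Omega> by fact
  \<comment> \<open>The same limit is an expectation along the subsequence \<open>r\<close> and the
    sum of the series along the full sequence.\<close>
  have products: "integral\<^sup>L \<Omega> (\<lambda>\<omega>. \<theta> \<omega> * (\<Prod>i<N. \<xi> \<omega> (f i))) = (\<Sum>j. c j * (\<Prod>i<N. blinfun_apply (f i) (x j)))"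
    if f: "\<And>i. i < N \<Longrightarrow> f i \<in> dual scale" for f
  proof (rule LIMSEQ_unique[OF prods[OF f]])
    let ?F = "\<lambda>x. \<Prod>i<N. blinfun_apply (f i) x"
    have "?F \<in> hom_polys scale N"
      using hom_polysI[OF bform_imp_multilinear[OF bform_product[of N f]]] f by simp
    from LIMSEQ_subseq_LIMSEQ[OF evl_lim[OF this] r]
    show "(\<lambda>m. evl (w (r m)) ?F) \<longlonglongrightarrow> (\<Sum>j. c j * ?F (x j))" by (simp add: o_def)
  qed
  define \<Phi> where "\<Phi> = polar N Q"
  note sym = polar_symmetric_form[OF Q, folded \<Phi>_def]
  obtain C where C: "C \<ge> 0" "bform N C \<Phi>" using multilinear_imp_bform[OF sym(1)] by metis
  let ?A = "aron_berner scale N Q"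
  let ?s = "sup_norm_on (cball 0 1) Q"
  have A: "?A (\<xi> \<omega>) = partial_ext (\<xi> \<omega>) N \<Phi> N (\<lambda>_. 0)" for \<omega>
    unfolding \<Phi>_def by (rule aron_berner_eq_partial_ext[OF Q C(2)[unfolded \<Phi>_def] C(1) \<xi>])
  \<comment> \<open>At \<open>k = 0\<close> no argument is fixed and no functional is left: the left
    side contains the extension of \<open>Q\<close>, the right side \<open>Q\<close> at the points
    \<open>x j\<close>.\<close>
  note formula = integral_formula[OF AP sep \<Omega> \<theta> \<xi> \<xi>_meas c x products C(2,1), of 0, simplified]
  have A_meas: "(\<lambda>\<omega>. ?A (\<xi> \<omega>)) \<in> borel_measurable \<Omega>" unfolding A by (rule formula(1))
  have "integral\<^sup>L \<Omega> (\<lambda>\<omega>. \<theta> \<omega> * ?A (\<xi> \<omega>)) = (\<Sum>j. c j * Q (x j))"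
    unfolding A formula(2) by (simp add: sym(3))
  then have lim: "(\<lambda>m. evl (w m) Q) \<longlonglongrightarrow> integral\<^sup>L \<Omega> (\<lambda>\<omega>. \<theta> \<omega> * ?A (\<xi> \<omega>))"
    using evl_lim[OF Q] by simp
  have A_le: "norm (?A z) \<le> ?s" if "z \<in> bidual_ball scale" for z by (rule norm_aron_berner_le[OF Q that])
  have \<theta>A_le: "norm (\<theta> \<omega> * ?A (\<xi> \<omega>)) \<le> norm (?A (\<xi> \<omega>))" for \<omega>
    using mult_right_mono[OF \<theta>(2)[of \<omega>] norm_ge_zero[of "?A (\<xi> \<omega>)"]] by (simp add: norm_mult)
  have A_int: "integrable \<Omega> (\<lambda>\<omega>. ?A (\<xi> \<omega>))"
    by (rule integrable_const_bound[where B = ?s]) (use A_le \<xi> A_meas in auto)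
  have \<theta>A_int: "integrable \<Omega> (\<lambda>\<omega>. \<theta> \<omega> * ?A (\<xi> \<omega>))"
    by (rule Bochner_Integration.integrable_bound[OF A_int]) (use \<theta>(1) A_meas \<theta>A_le in auto)
  \<comment> \<open>The near-maximality of \<open>w m\<close> passes to the limit, where the error
    \<open>4 * (1/2) ^ m\<close> vanishes.\<close>
  have s_le: "?s \<le> re (integral\<^sup>L \<Omega> (\<lambda>\<omega>. \<theta> \<omega> * ?A (\<xi> \<omega>)))"
    unfolding sup_norm_on_def
  proof (rule cSUP_least)
    fix y :: 'a assume "y \<in> cball 0 1"
    then have y: "norm y \<le> 1" by simp
    have "(\<lambda>m. re (evl (w m) Q) + 4 * (1/2) ^ m) \<longlonglongrightarrow> re (integral\<^sup>L \<Omega> (\<lambda>\<omega>. \<theta> \<omega> * ?A (\<xi> \<omega>))) + 4 * 0"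
      by (intro tendsto_add tendsto_re lim tendsto_mult tendsto_const LIMSEQ_power_zero) simp
    then show "norm (Q y) \<le> re (integral\<^sup>L \<Omega> (\<lambda>\<omega>. \<theta> \<omega> * ?A (\<xi> \<omega>)))"
      using LIMSEQ_le_const[of _ _ "norm (Q y)"] max[OF y] by simp
  qed simp
  \<comment> \<open>On a probability space a function that is smaller than a constant everywhere has
    a smaller mean, which would contradict \<open>s_le\<close>.\<close>
  have "\<exists>\<omega>. norm (?A (\<xi> \<omega>)) = ?s"
  proof (rule ccontr)
    assume no: "\<not> ?thesis"
    have less: "norm (?A (\<xi> \<omega>)) < ?s" for \<omega> using A_le[OF \<xi>[of \<omega>]] no by (auto simp: less_le)
    have "?s \<le> norm (integral\<^sup>L \<Omega> (\<lambda>\<omega>. \<theta> \<omega> * ?A (\<xi> \<omega>)))" using s_le re_le order_trans by blast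
    also have "\<dots> \<le> integral\<^sup>L \<Omega> (\<lambda>\<omega>. norm (\<theta> \<omega> * ?A (\<xi> \<omega>)))" by (rule Bochner_Integration.integral_norm_bound)
    also have "\<dots> \<le> integral\<^sup>L \<Omega> (\<lambda>\<omega>. norm (?A (\<xi> \<omega>)))"
      by (intro integral_mono integrable_norm \<theta>A_int A_int \<theta>A_le)
    also have "\<dots> < integral\<^sup>L \<Omega> (\<lambda>_. ?s)"
      by (rule integral_less_AE_space) (use A_int less in \<open>auto simp: emeasure_space_1\<close>)
    also have "\<dots> = ?s" by (simp add: prob_space)
    finally show False by simp
  qed
  then obtain \<omega> where \<omega>: "norm (?A (\<xi> \<omega>)) = ?s" by blast
  \<comment> \<open>The upper bound is \<open>norm_aron_berner_le\<close>, and the point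
    \<open>\<xi> \<omega>\<close> just found gives the lower one.\<close>
  have "sup_norm_on (bidual_ball scale) ?A = ?s"
    unfolding sup_norm_on_def[of "bidual_ball scale"]
  proof (rule antisym)
    show "(SUP z\<in>bidual_ball scale. norm (?A z)) \<le> ?s"
      by (rule cSUP_least) (use \<xi> A_le in auto)
    have "bdd_above ((\<lambda>z. norm (?A z)) ` bidual_ball scale)" by (rule bdd_aboveI2) (rule A_le)
    from cSUP_upper[OF \<xi> this] show "?s \<le> (SUP z\<in>bidual_ball scale. norm (?A z))" using \<omega> by metis
  qed
  then have "attains_norm_on (bidual_ball scale) ?A"
    unfolding attains_norm_on_def using \<xi> \<omega> by metis
  moreover have "sup_norm_on (cball 0 1) (\<lambda>x. P x - Q x) \<le> \<epsilon> / 2"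
    unfolding sup_norm_on_def
  proof (rule cSUP_least)
    fix y :: 'a assume "y \<in> cball 0 1"
    then have "\<epsilon> / 2 * norm y ^ N \<le> \<epsilon> / 2 * 1" using \<epsilon> by (intro mult_left_mono power_le_one) auto
    then show "norm (P y - Q y) \<le> \<epsilon> / 2" using PQ[of y] by simp
  qed simp
  ultimately show ?thesis using Q \<epsilon> by (intro bexI[of _ Q] conjI) auto
qed

end

theorem corollary2p4:
  fixes scale :: "'k::real_or_complex \<Rightarrow> 'a::banach \<Rightarrow> 'a"
    and N :: nat
  assumes "normed_space_over scale"
    and "separable_space (top_of_set (dual scale))"
    and "approximation_property dual_scale (dual scale)"
  shows "\<forall>P \<in> hom_polys scale N. \<forall>\<epsilon>>0.
    \<exists>Q \<in> {Q \<in> hom_polys scale N. attains_norm_on (bidual_ball scale) (aron_berner scale N Q)}.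
      sup_norm_on (cball 0 1) (\<lambda>x. P x - Q x) < \<epsilon>"
  using normed_space_over.norm_attaining_dense[OF assms(1,3,2)] by blast

end
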